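(* There exist absolute constants $\rho,\mu>0$ such that for every integer $d\ge2$ and all distinct $j,k\in\{1,\ldots,d\}$, the operator $R_{\mathrm{dis}}^{(jj-kk)}=R_{\mathrm{dis}}^{(jj)}-R_{\mathrm{dis}}^{(kk)}$ satisfies $$4c_d\left(1+\frac{d-2}{2^{d/2}}-\frac{\rho}{4^{d/2}}\right)\le\|R_{\mathrm{dis}}^{(jj-kk)}\|_{\ell^2(\mathbb Z^d)\to\ell^2(\mathbb Z^d)}\le4c_d\left(1+\frac{\mu d}{2^{d/2}}\right).$$ In particular, as $d\to\infty$, $$\|R_{\mathrm{dis}}^{(jj-kk)}\|_{\ell^2(\mathbb Z^d)\to\ell^2(\mathbb Z^d)}=4c_d\left(1+(1+o(1))\frac{d}{2^{d/2}}\right).$$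
   Context: For an integer $d\ge2$ put $c_d=\Gamma\left(\frac{d+2}{2}\right)/\pi^{d/2}$, and let $|\cdot|$ be the Euclidean norm. For $j,k\in\{1,\ldots,d\}$ and $f:\mathbb Z^d\to\mathbb C$, $$R_{\mathrm{dis}}^{(jk)}f(n)=c_d\sum_{m\in\mathbb Z^d\setminus\{0\}}\frac{m_jm_k}{|m|^{d+2}}f(n-m),\qquad n\in\mathbb Z^d,$$ so that $R_{\mathrm{dis}}^{(jj-kk)}:=R_{\mathrm{dis}}^{(jj)}-R_{\mathrm{dis}}^{(kk)}$ is convolution on $\mathbb Z^d$ with the kernel $c_d\frac{m_j^2-m_k^2}{|m|^{d+2}}$ for $m\neq0$ (and $0$ at $m=0$). $\|T\|_{\ell^p(\mathbb Z^d)\to\ell^p(\mathbb Z^d)}$ denotes the operator norm. "Absolute constant" means a constant independent of $d$, $j$, $k$. $o(1)$ denotes a quantity tending to $0$ as $d\to\infty$. *)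

theory Defs
  imports "HOL-Analysis.Analysis"
begin

text \<open>
  The dimension \<open>d\<close> is quantified inside the statement, so \<open>\<int>\<^sup>d\<close> is a carrier set
  rather than a type: a vector is a function with coordinates indexed by \<open>{1..d}\<close>, extended
  by \<open>0\<close> to all of \<open>nat\<close>.
\<close>

definition int_lattice :: "nat \<Rightarrow> (nat \<Rightarrow> int) set" where
  "int_lattice d = {m. \<forall>i. i \<notin> {1..d} \<longrightarrow> m i = 0}"

definition eucl_norm :: "nat \<Rightarrow> (nat \<Rightarrow> int) \<Rightarrow> real" where
  "eucl_norm d m = sqrt (\<Sum>i=1..d. (real_of_int (m i))\<^sup>2)"

definition riesz_const :: "nat \<Rightarrow> real" where
  "riesz_const d = Gamma (real (d + 2) / 2) / pi powr (real d / 2)"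

text \<open>
  For \<open>f\<close> in \<open>\<ell>\<^sup>2\<close> the series below converges absolutely at every \<open>n\<close>, because the kernel is
  square summable; the unordered sum \<open>infsum\<close> is therefore the intended one. Only the
  values of \<open>f\<close> on \<open>int_lattice d\<close> matter when \<open>n\<close> lies in \<open>int_lattice d\<close>.
\<close>

definition R_dis ::
  "nat \<Rightarrow> nat \<Rightarrow> nat \<Rightarrow> ((nat \<Rightarrow> int) \<Rightarrow> complex) \<Rightarrow> (nat \<Rightarrow> int) \<Rightarrow> complex" where
  "R_dis d j k f n =
     of_real (riesz_const d) *
     (\<Sum>\<^sub>\<infinity>m \<in> int_lattice d - {\<lambda>_. 0}.
        of_real (real_of_int (m j * m k) / eucl_norm d m ^ (d + 2)) * f (\<lambda>i. n i - m i))"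

definition R_dis_diff ::
  "nat \<Rightarrow> nat \<Rightarrow> nat \<Rightarrow> ((nat \<Rightarrow> int) \<Rightarrow> complex) \<Rightarrow> (nat \<Rightarrow> int) \<Rightarrow> complex" where
  "R_dis_diff d j k f n = R_dis d j j f n - R_dis d k k f n"

text \<open>
  The norms take values in the extended reals, so that a finite upper bound on
  \<open>lp_opnorm p A T\<close> includes the assertion that \<open>T\<close> maps \<open>\<ell>\<^sup>p(A)\<close> boundedly into itself.
\<close>

definition lp_norm :: "real \<Rightarrow> 'a set \<Rightarrow> ('a \<Rightarrow> complex) \<Rightarrow> ereal" where
  "lp_norm p A f =
     (if (\<lambda>x. norm (f x) powr p) summable_on A
      then ereal ((\<Sum>\<^sub>\<infinity>x\<in>A. norm (f x) powr p) powr (1 / p))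
      else \<infinity>)"

definition lp_opnorm ::
  "real \<Rightarrow> 'a set \<Rightarrow> (('a \<Rightarrow> complex) \<Rightarrow> ('a \<Rightarrow> complex)) \<Rightarrow> ereal" where
  "lp_opnorm p A T = (SUP f \<in> {f. lp_norm p A f \<le> 1}. lp_norm p A (T f))"

end

theory Submission
  imports Defs "HOL-Library.Function_Algebras"
begin

text \<open>
  The kernel is a superposition of Gaussians: \<open>heat_has_integral\<close> gives
  \<open>c\<^sub>d / |m| ^ (d + 2) = \<integral> \<pi> t ^ (d/2) exp (- \<pi> t |m|\<^sup>2) dt\<close> over \<open>t > 0\<close>. The integral is cut at \<open>t = 1\<close>, and
  the two parts are treated by different means.

  The part \<open>t \<ge> 1\<close> has an absolutely summable kernel (\<open>tail_kernel\<close>). Its upper bound is Young's inequality,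
  which is sharp enough because the \<open>\<ell>\<^sup>1\<close> norm is dominated by the lattice points \<open>\<plusminus>e\<^sub>j\<close>, \<open>\<plusminus>e\<^sub>k\<close> with total mass
  \<open>4 c\<^sub>d\<close>, and by the \<open>8 (d - 2)\<close> points \<open>\<plusminus>e\<^sub>j \<plusminus> e\<^sub>l\<close>, \<open>\<plusminus>e\<^sub>k \<plusminus> e\<^sub>l\<close> with total mass \<open>4 c\<^sub>d (d - 2) / 2 ^ (d/2)\<close>. Points of
  squared norm at least \<open>3\<close> contribute at most \<open>c\<^sub>d 3 ^ (- d/2)\<close> times a lattice Gaussian sum that grows slower
  than \<open>(3/2) ^ (d/2)\<close> (\<open>tail_kernel_l1\<close>). The lower bound tests the operator on the character \<open>(-1) ^ n\<^sub>k\<close> times a slowly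
  decaying weight (\<open>tail_conv_lower_bound\<close>): the first two spheres then contribute with one sign, and the
  terms of opposite sign have total mass \<open>O (c\<^sub>d / 4 ^ (d/2))\<close> (\<open>neg_kernel_l1\<close>).

  The part \<open>t \<le> 1\<close> decays only like \<open>|m| ^ - d\<close> and is not absolutely summable, but a bound of the form
  \<open>C ^ d\<close> is enough for it, because \<open>c\<^sub>d\<close> grows faster than every exponential (\<open>riesz_const_growth\<close>). Such a
  bound follows from the Cotlar-Stein lemma (\<open>cotlar_stein\<close>) applied to the dyadic pieces
  \<open>t \<in> [4 ^ - (i + 1), 4 ^ - i]\<close>: the kernel is antisymmetric under exchange of the coordinates \<open>j\<close> and \<open>k\<close>, so a
  fine piece annihilates functions that do not depend on these coordinates, while a coarse piece is
  smooth, and the product of two pieces decays geometrically in the difference of their scales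
  (\<open>conv_piece_pair\<close>). Everything happens in physical space, on a Hilbert space of real functions with
  convolutions defined as series of translates; a limiting argument (\<open>conv_limit_bound\<close>) handles the
  infinite sum of pieces.

  Both bounds together determine the norm up to \<open>c\<^sub>d O (1 / 2 ^ (d/2))\<close>, which is smaller than the correction
  by a factor of order \<open>1 / d\<close>; this is the asymptotic statement.
\<close>

section \<open>The Cotlar-Stein lemma for symmetric operators\<close>

text \<open>
  Iterating \<open>\<parallel>S x\<parallel>\<^sup>2 = \<langle>S\<^sup>2 x, x\<rangle> \<le> \<parallel>S\<^sup>2 x\<parallel> \<parallel>x\<parallel>\<close> lets the norm of a symmetric operator be read off from
  bounds on its high powers; it replaces the spectral theorem.
\<close>

lemma symmetric_power_bound:
  fixes S :: "'a::real_inner \<Rightarrow> 'a"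
  assumes sym: "\<And>x y. S x \<bullet> y = x \<bullet> S y"
  shows "norm (S x) ^ (2 ^ n) \<le> norm ((S ^^ (2 ^ n)) x) * norm x ^ (2 ^ n - 1)"
proof (induction n)
  case 0
  show ?case by simp
next
  case (Suc n)
  let ?N = "2 ^ n :: nat"
  have sympow: "(S ^^ k) y \<bullet> z = y \<bullet> (S ^^ k) z" for k y z
    by (induction k arbitrary: y z) (simp_all add: sym funpow_swap1)
  have "(norm ((S ^^ ?N) x))\<^sup>2 = (S ^^ ?N) ((S ^^ ?N) x) \<bullet> x"
    by (simp add: sympow power2_norm_eq_inner)
  also have "\<dots> \<le> norm ((S ^^ (2 * ?N)) x) * norm x"
    using norm_cauchy_schwarz[of "(S ^^ ?N) ((S ^^ ?N) x)" x]
    by (simp add: mult_2 funpow_add)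
  finally have step: "(norm ((S ^^ ?N) x))\<^sup>2 \<le> norm ((S ^^ (2 * ?N)) x) * norm x" .
  have "norm (S x) ^ (2 ^ Suc n) = (norm (S x) ^ ?N)\<^sup>2"
    by (simp add: power_mult[symmetric] mult.commute)
  also have "\<dots> \<le> (norm ((S ^^ ?N) x) * norm x ^ (?N - 1))\<^sup>2"
    by (intro power_mono Suc) simp
  also have "\<dots> = (norm ((S ^^ ?N) x))\<^sup>2 * norm x ^ (2 * (?N - 1))"
    by (simp add: power_mult_distrib power_mult[symmetric] mult.commute)
  also have "\<dots> \<le> (norm ((S ^^ (2 * ?N)) x) * norm x) * norm x ^ (2 * (?N - 1))"
    by (intro mult_right_mono step) simp
  also have "\<dots> = norm ((S ^^ (2 * ?N)) x) * norm x ^ (Suc (2 * (?N - 1)))"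
    by simp
  also have "Suc (2 * (?N - 1)) = 2 ^ Suc n - 1"
  proof -
    have "?N \<ge> 1" by simp
    then have "Suc (2 * (?N - 1)) = 2 * ?N - 1" by arith
    then show ?thesis by simp
  qed
  finally show ?case by simp
qed

text \<open>
  Bound for a word of operators \<open>A i\<^sub>1 A i\<^sub>2 A i\<^sub>3 A i\<^sub>4 \<dots>\<close> whose letters are paired from the left; in a word of
  odd length the last letter is bounded on its own by \<open>B\<close>.
\<close>

fun bracket_bound :: "real \<Rightarrow> (nat \<Rightarrow> nat \<Rightarrow> real) \<Rightarrow> nat list \<Rightarrow> real" where
  "bracket_bound B w [] = 1"
| "bracket_bound B w [i] = B"
| "bracket_bound B w (i # j # is) = (w i j)\<^sup>2 * bracket_bound B w is"

fun chain_weight :: "(nat \<Rightarrow> nat \<Rightarrow> real) \<Rightarrow> nat list \<Rightarrow> real" where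
  "chain_weight w [] = 1"
| "chain_weight w [i] = 1"
| "chain_weight w (i # j # is) = w i j * chain_weight w (j # is)"

text \<open>
  The words \<open>i\<^sub>1 i\<^sub>2 i\<^sub>3 \<dots>\<close> and \<open>i\<^sub>2 i\<^sub>3 \<dots>\<close> are paired in complementary ways, so between them every neighbouring
  pair of letters is used exactly once. This is the heart of the Cotlar-Stein argument: the geometric
  mean of the two bracketings of one word sees all neighbours.
\<close>

lemma bracket_bound_mult:
  "bracket_bound B w (i # is) * bracket_bound B w is = B * (chain_weight w (i # is))\<^sup>2"
proof (induction "is" arbitrary: i)
  case (Cons j "is")
  then show ?case
    by (simp add: power_mult_distrib mult.assoc) (simp add: algebra_simps)
qed simp

lemma bracket_bound_nonneg: "0 \<le> B \<Longrightarrow> 0 \<le> bracket_bound B w is"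
  by (induction B w "is" rule: bracket_bound.induct) auto

lemma norm_foldr_le_bracket_bound:
  fixes A :: "nat \<Rightarrow> 'a::real_normed_vector \<Rightarrow> 'a"
  assumes ortho: "\<And>i j x. norm (A i (A j x)) \<le> (w i j)\<^sup>2 * norm x"
    and B: "\<And>i x. i < M \<Longrightarrow> norm (A i x) \<le> B * norm x"
  shows "set is \<subseteq> {..<M} \<Longrightarrow> norm (foldr A is x) \<le> bracket_bound B w is * norm x"
proof (induction "is" rule: induct_list012)
  case (3 i j "is")
  have "norm (foldr A (i # j # is) x) \<le> (w i j)\<^sup>2 * norm (foldr A is x)"
    using ortho[of i j "foldr A is x"] by simp
  also have "\<dots> \<le> (w i j)\<^sup>2 * (bracket_bound B w is * norm x)"
    using 3 by (intro mult_left_mono) auto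
  finally show ?case by (simp add: mult.assoc)
qed (use B in auto)

lemma norm_foldr_le_chain_weight:
  fixes A :: "nat \<Rightarrow> 'a::real_normed_vector \<Rightarrow> 'a"
  assumes ortho: "\<And>i j x. norm (A i (A j x)) \<le> (w i j)\<^sup>2 * norm x"
    and B: "\<And>i x. i < M \<Longrightarrow> norm (A i x) \<le> B * norm x"
    and nonneg: "0 \<le> B" "\<And>i j. 0 \<le> w i j"
    and "is": "set (i # is) \<subseteq> {..<M}"
  shows "norm (foldr A (i # is) x) \<le> B * chain_weight w (i # is) * norm x"
proof (rule power2_le_imp_le)
  note pair = norm_foldr_le_bracket_bound[where A = A, OF ortho B]
  let ?p = "norm (foldr A (i # is) x)"
  have "?p \<le> bracket_bound B w (i # is) * norm x"
    using "is" by (intro pair)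
  moreover have "?p \<le> B * (bracket_bound B w is * norm x)"
  proof -
    have "?p \<le> B * norm (foldr A is x)"
      using B[of i] "is" by simp
    also have "\<dots> \<le> B * (bracket_bound B w is * norm x)"
      using "is" nonneg by (intro mult_left_mono pair) auto
    finally show ?thesis .
  qed
  ultimately have "?p * ?p \<le> (bracket_bound B w (i # is) * norm x) * (B * (bracket_bound B w is * norm x))"
    by (intro mult_mono) (auto intro!: mult_nonneg_nonneg bracket_bound_nonneg nonneg)
  also have "\<dots> = B * (norm x)\<^sup>2 * (bracket_bound B w (i # is) * bracket_bound B w is)"
    by (simp add: power2_eq_square algebra_simps)
  also have "\<dots> = (B * chain_weight w (i # is) * norm x)\<^sup>2"
    by (simp only: bracket_bound_mult) (simp add: power_mult_distrib power2_eq_square)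
  finally show "?p\<^sup>2 \<le> (B * chain_weight w (i # is) * norm x)\<^sup>2"
    by (simp add: power2_eq_square)
  have "chain_weight w' l \<ge> 0" if "\<And>i j. 0 \<le> w' i j" for l w'
    using that by (induction w' l rule: chain_weight.induct) auto
  then show "0 \<le> B * chain_weight w (i # is) * norm x"
    using nonneg by (intro mult_nonneg_nonneg) auto
qed

definition words :: "nat \<Rightarrow> nat \<Rightarrow> nat list set" where
  "words M n = {is. set is \<subseteq> {..<M} \<and> length is = n}"

lemma sum_words_Suc:
  fixes f :: "nat list \<Rightarrow> 'a::comm_monoid_add"
  shows "(\<Sum>is\<in>words M (Suc n). f is)
    = (\<Sum>i<M. \<Sum>is\<in>words M n. f (i # is))"
proof -
  have "(\<Sum>is\<in>words M (Suc n). f is)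
      = (\<Sum>(i, is)\<in>{..<M} \<times> words M n. f (i # is))"
    by (rule sum.reindex_bij_witness[where i = "\<lambda>(i, is). i # is" and j = "\<lambda>is. (hd is, tl is)"])
       (auto simp: words_def length_Suc_conv)
  then show ?thesis
    by (simp add: sum.cartesian_product)
qed

text \<open>
  The indices are summed out one at a time, the last one first, at the cost of a factor \<open>C\<close> each.
\<close>

lemma sum_chain_weight_le:
  assumes nonneg: "\<And>i j. 0 \<le> w i j"
    and C: "\<And>i. i < M \<Longrightarrow> (\<Sum>j<M. w i j) \<le> C" and "i < M"
  shows "(\<Sum>is\<in>words M n. chain_weight w (i # is)) \<le> C ^ n"
  using \<open>i < M\<close>
proof (induction n arbitrary: i)
  case 0
  have "words M 0 = {[]}" by (auto simp: words_def)
  then show ?case by simp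
next
  case (Suc n)
  have C0: "0 \<le> C"
    using C[OF Suc.prems] nonneg by (meson sum_nonneg order_trans)
  have "(\<Sum>is\<in>words M (Suc n). chain_weight w (i # is))
     = (\<Sum>j<M. w i j * (\<Sum>is\<in>words M n. chain_weight w (j # is)))"
    by (simp add: sum_words_Suc sum_distrib_left)
  also have "\<dots> \<le> (\<Sum>j<M. w i j * C ^ n)"
    by (intro sum_mono mult_left_mono Suc.IH nonneg) auto
  also have "\<dots> = (\<Sum>j<M. w i j) * C ^ n"
    by (simp add: sum_distrib_right)
  also have "\<dots> \<le> C * C ^ n"
    using C0 C[OF Suc.prems] by (intro mult_right_mono) auto
  finally show ?case by simp
qed

lemma sum_operators_funpow:
  fixes A :: "nat \<Rightarrow> 'a::real_vector \<Rightarrow> 'a"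
  assumes lin: "\<And>i. linear (A i)"
  shows "((\<lambda>x. \<Sum>i<M. A i x) ^^ n) x = (\<Sum>is\<in>words M n. foldr A is x)"
proof (induction n)
  case 0
  have "words M 0 = {[]}" by (auto simp: words_def)
  then show ?case by simp
next
  case (Suc n)
  show ?case
    by (simp add: Suc sum_words_Suc linear_sum[OF lin])
qed

text \<open>
  The Cotlar-Stein lemma. If \<open>r = \<parallel>S x\<parallel> / \<parallel>x\<parallel>\<close> exceeded \<open>C\<close> for the sum \<open>S\<close>, then \<open>r ^ N \<le> M C ^ N\<close> would fail
  for large \<open>N = 2 ^ n\<close>: the left side is controlled by the norm of \<open>S ^ N\<close>, and expanding that power
  into words costs only one factor \<open>M\<close>, for the free first letter.
\<close>

theorem cotlar_stein:
  fixes A :: "nat \<Rightarrow> 'a::real_inner \<Rightarrow> 'a"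
  assumes lin: "\<And>i. linear (A i)"
    and sym: "\<And>i x y. A i x \<bullet> y = x \<bullet> A i y"
    and ortho: "\<And>i j x. norm (A i (A j x)) \<le> (w i j)\<^sup>2 * norm x"
    and nonneg: "\<And>i j. 0 \<le> w i j"
    and C: "\<And>i. i < M \<Longrightarrow> (\<Sum>j<M. w i j) \<le> C" "0 \<le> C"
  shows "norm (\<Sum>i<M. A i x) \<le> C * norm x"
proof (rule ccontr)
  assume contr: "\<not> ?thesis"
  define S where "S = (\<lambda>x. \<Sum>i<M. A i x)"
  have "x \<noteq> 0"
    using contr linear_0[OF lin] by auto
  then have nx: "norm x > 0" by simp
  have bound: "norm (A i y) \<le> C * norm y" if "i < M" for i y
  proof -
    have "w i i \<le> C"
      using C(1)[OF that] member_le_sum[of i "{..<M}" "w i"] that nonneg by auto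
    have "(norm (A i y))\<^sup>2 = A i (A i y) \<bullet> y"
      by (simp add: power2_norm_eq_inner sym)
    also have "\<dots> \<le> norm (A i (A i y)) * norm y"
      by (rule norm_cauchy_schwarz)
    also have "\<dots> \<le> ((w i i)\<^sup>2 * norm y) * norm y"
      by (intro mult_right_mono ortho) simp
    also have "\<dots> = (w i i * norm y)\<^sup>2"
      by (simp add: power2_eq_square)
    finally have "norm (A i y) \<le> w i i * norm y"
      by (rule power2_le_imp_le) (intro mult_nonneg_nonneg nonneg, simp)
    with \<open>w i i \<le> C\<close> show ?thesis
      by (meson mult_right_mono norm_ge_zero order_trans)
  qed
  have iter: "norm ((S ^^ Suc n) x) \<le> real M * C * C ^ n * norm x" for n
  proof -
    have "norm ((S ^^ Suc n) x)
        \<le> (\<Sum>i<M. \<Sum>is\<in>words M n. norm (foldr A (i # is) x))"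
      unfolding S_def sum_operators_funpow[OF lin] sum_words_Suc
      by (intro order_trans[OF norm_sum] sum_mono norm_sum)
    also have "\<dots> \<le> (\<Sum>i<M. \<Sum>is\<in>words M n. C * chain_weight w (i # is) * norm x)"
      using C by (intro sum_mono norm_foldr_le_chain_weight[where M = M] ortho bound nonneg) (auto simp: words_def)
    also have "\<dots> = (\<Sum>i<M. C * (\<Sum>is\<in>words M n. chain_weight w (i # is)) * norm x)"
      by (simp add: sum_distrib_left sum_distrib_right)
    also have "\<dots> \<le> (\<Sum>i<M. C * C ^ n * norm x)"
      using C nonneg by (intro sum_mono mult_right_mono mult_left_mono sum_chain_weight_le) auto
    finally show ?thesis by (simp add: mult.assoc)
  qed
  define r where "r = norm (S x) / norm x"
  have "C < r"
    using contr nx by (simp add: r_def S_def field_simps)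
  \<comment> \<open>A positive number between \<open>C\<close> and \<open>r\<close>, since \<open>C\<close> itself may vanish.\<close>
  define C1 where "C1 = (C + r) / 2"
  have C1: "C < C1" "C1 < r" "0 < C1"
    using \<open>C < r\<close> \<open>0 \<le> C\<close> by (auto simp: C1_def)
  have symS: "S u \<bullet> v = u \<bullet> S v" for u v
    by (simp add: S_def inner_sum_left inner_sum_right sym)
  have "(r / C1) ^ (2 ^ n) \<le> real M" for n
  proof -
    let ?N = "2 ^ n :: nat"
    obtain k where k: "?N = Suc k"
      using not0_implies_Suc[of ?N] by auto
    have "norm (S x) ^ ?N \<le> norm ((S ^^ ?N) x) * norm x ^ (?N - 1)"
      by (rule symmetric_power_bound[OF symS])
    also have "\<dots> \<le> (real M * C * C ^ k * norm x) * norm x ^ (?N - 1)"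
      unfolding k by (intro mult_right_mono iter) simp
    also have "\<dots> = real M * C ^ ?N * norm x ^ ?N"
      by (simp add: k)
    finally have "r ^ ?N \<le> real M * C ^ ?N"
      using nx by (simp add: r_def power_divide field_simps)
    also have "\<dots> \<le> real M * C1 ^ ?N"
      using C1 \<open>0 \<le> C\<close> by (intro mult_left_mono power_mono) auto
    finally show ?thesis
      using C1 by (simp add: power_divide field_simps)
  qed
  moreover obtain n where "real M < (r / C1) ^ n"
    using real_arch_pow[of "r / C1" "real M"] C1 by auto
  moreover have "(r / C1) ^ n \<le> (r / C1) ^ (2 ^ n)"
    using C1 by (intro power_increasing) (auto simp: less_imp_le)
  ultimately show False
    by (meson not_less order_trans)
qed

section \<open>The Hilbert space of square summable real functions\<close>

text \<open>
  Real functions suffice: the kernel is real, so the operator acts separately on the real and the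
  imaginary part of its argument.
\<close>

typedef 'g ell2 = "{f :: 'g \<Rightarrow> real. (\<lambda>n. (f n)\<^sup>2) summable_on UNIV}"
  morphisms ell2_apply Abs_ell2
  by (rule exI[of _ "\<lambda>_. 0"]) simp

lemma ell2_apply_summable: "(\<lambda>n. (ell2_apply x n)\<^sup>2) summable_on UNIV"
  using ell2_apply[of x] by simp

lemma ell2_apply_Abs: "(\<lambda>n. (f n)\<^sup>2) summable_on UNIV \<Longrightarrow> ell2_apply (Abs_ell2 f) = f"
  by (simp add: Abs_ell2_inverse)

lemma ell2_eqI: "(\<And>n. ell2_apply x n = ell2_apply y n) \<Longrightarrow> x = y"
  by (subst ell2_apply_inject[symmetric]) (rule ext)

lemma square_summable_mult:
  fixes f g :: "'g \<Rightarrow> real"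
  assumes "(\<lambda>n. (f n)\<^sup>2) summable_on A" "(\<lambda>n. (g n)\<^sup>2) summable_on A"
  shows "(\<lambda>n. f n * g n) summable_on A"
proof -
  have "(\<lambda>n. (f n)\<^sup>2 + (g n)\<^sup>2) summable_on A"
    by (intro summable_on_add assms)
  then have "(\<lambda>n. norm (f n * g n)) summable_on A"
  proof (rule summable_on_comparison_test)
    fix n
    show "norm (f n * g n) \<le> (f n)\<^sup>2 + (g n)\<^sup>2"
      using sum_squares_bound[of "\<bar>f n\<bar>" "\<bar>g n\<bar>"] mult_nonneg_nonneg[of "\<bar>f n\<bar>" "\<bar>g n\<bar>"]
      unfolding real_norm_def abs_mult power2_abs by linarith
  qed simp
  then show ?thesis
    by (rule abs_summable_summable)
qed

lemma square_summable_add: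
  fixes f g :: "'g \<Rightarrow> real"
  assumes "(\<lambda>n. (f n)\<^sup>2) summable_on A" "(\<lambda>n. (g n)\<^sup>2) summable_on A"
  shows "(\<lambda>n. (f n + g n)\<^sup>2) summable_on A"
proof -
  have "(\<lambda>n. (f n)\<^sup>2 + (g n)\<^sup>2 + 2 * (f n * g n)) summable_on A"
    by (intro summable_on_add summable_on_cmult_right square_summable_mult assms)
  then show ?thesis
    by (simp add: power2_sum mult.assoc)
qed

lemma square_summable_scale:
  fixes f :: "'g \<Rightarrow> real"
  assumes "(\<lambda>n. (f n)\<^sup>2) summable_on A"
  shows "(\<lambda>n. (c * f n)\<^sup>2) summable_on A"
  using assms by (simp add: power_mult_distrib summable_on_cmult_right)

instantiation ell2 :: (type) real_inner
begin

definition "0 = Abs_ell2 (\<lambda>_. 0)"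
definition "x + y = Abs_ell2 (\<lambda>n. ell2_apply x n + ell2_apply y n)"
definition "x - y = Abs_ell2 (\<lambda>n. ell2_apply x n - ell2_apply y n)"
definition "- x = Abs_ell2 (\<lambda>n. - ell2_apply x n)"
definition "c *\<^sub>R (x :: 'a ell2) = Abs_ell2 (\<lambda>n. c * ell2_apply x n)"
definition "inner (x :: 'a ell2) y = (\<Sum>\<^sub>\<infinity>n. ell2_apply x n * ell2_apply y n)"
definition "norm (x :: 'a ell2) = sqrt (x \<bullet> x)"
definition "dist (x :: 'a ell2) y = norm (x - y)"
definition "sgn (x :: 'a ell2) = inverse (norm x) *\<^sub>R x"
definition uniformity_ell2 where
  "(uniformity :: ('a ell2 \<times> 'a ell2) filter) = (INF e\<in>{0<..}. principal {(x, y). dist x y < e})"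
definition open_ell2 where
  "open (U :: 'a ell2 set) \<longleftrightarrow> (\<forall>x\<in>U. eventually (\<lambda>(x', y). x' = x \<longrightarrow> y \<in> U) uniformity)"

lemma ell2_apply_zero [simp]: "ell2_apply 0 n = 0"
  unfolding zero_ell2_def by (subst ell2_apply_Abs) auto

lemma ell2_apply_add [simp]: "ell2_apply (x + y) n = ell2_apply x n + ell2_apply y n"
  unfolding plus_ell2_def by (subst ell2_apply_Abs) (auto intro: square_summable_add ell2_apply_summable)

lemma ell2_apply_uminus [simp]: "ell2_apply (- x) n = - ell2_apply x n"
  unfolding uminus_ell2_def by (subst ell2_apply_Abs) (auto intro: ell2_apply_summable)

lemma ell2_apply_scaleR [simp]: "ell2_apply (c *\<^sub>R x) n = c * ell2_apply x n"
  unfolding scaleR_ell2_def by (subst ell2_apply_Abs) (auto intro: square_summable_scale ell2_apply_summable)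

lemma ell2_apply_diff [simp]: "ell2_apply (x - y) n = ell2_apply x n - ell2_apply y n"
proof -
  have "(\<lambda>n. (ell2_apply x n - ell2_apply y n)\<^sup>2) summable_on UNIV"
    using ell2_apply_summable[of "x + (- y)"] by simp
  then show ?thesis
    unfolding minus_ell2_def by (subst ell2_apply_Abs) auto
qed

instance
proof
  fix x y z :: "'a ell2" and r :: real
  have mult: "(\<lambda>n. ell2_apply u n * ell2_apply v n) summable_on UNIV" for u v :: "'a ell2"
    by (intro square_summable_mult ell2_apply_summable)
  show "(x + y) \<bullet> z = x \<bullet> z + y \<bullet> z"
    by (simp add: inner_ell2_def distrib_right infsum_add mult)
  show "(r *\<^sub>R x) \<bullet> y = r * (x \<bullet> y)"
    by (simp add: inner_ell2_def mult.assoc infsum_cmult_right mult)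
  show "x \<bullet> y = y \<bullet> x"
    by (simp add: inner_ell2_def mult.commute)
  show "0 \<le> x \<bullet> x"
    by (simp add: inner_ell2_def infsum_nonneg)
  show "x \<bullet> x = 0 \<longleftrightarrow> x = 0"
  proof
    assume 0: "x \<bullet> x = 0"
    show "x = 0"
    proof (rule ell2_eqI)
      fix n
      have "ell2_apply x n * ell2_apply x n = 0"
        using 0 by (intro nonneg_infsum_le_0D[where A = UNIV]) (auto simp: inner_ell2_def mult)
      then show "ell2_apply x n = ell2_apply 0 n" by simp
    qed
  qed (simp add: inner_ell2_def)
  show "a *\<^sub>R b *\<^sub>R x = (a * b) *\<^sub>R x" "(a + b) *\<^sub>R x = a *\<^sub>R x + b *\<^sub>R x"
    "a *\<^sub>R (x + y) = a *\<^sub>R x + a *\<^sub>R y" for a b :: real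
    by (rule ell2_eqI, simp add: algebra_simps)+
  show "x + y + z = x + (y + z)" "x + y = y + x" "0 + x = x" "- x + x = 0" "x - y = x + - y" "1 *\<^sub>R x = x"
    by (rule ell2_eqI, simp)+
qed (rule norm_ell2_def dist_ell2_def sgn_ell2_def uniformity_ell2_def open_ell2_def)+

end

lemma norm_ell2_power2: "(norm x)\<^sup>2 = (\<Sum>\<^sub>\<infinity>n. (ell2_apply x n)\<^sup>2)"
  unfolding power2_norm_eq_inner inner_ell2_def by (simp add: power2_eq_square)

lemma finite_sum_le_norm_ell2: "finite F \<Longrightarrow> (\<Sum>n\<in>F. (ell2_apply x n)\<^sup>2) \<le> (norm x)\<^sup>2"
  unfolding norm_ell2_power2 by (intro finite_sum_le_infsum ell2_apply_summable) auto

lemma abs_ell2_apply_le_norm: "\<bar>ell2_apply x n\<bar> \<le> norm x"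
  using finite_sum_le_norm_ell2[of "{n}" x] by (simp add: abs_le_square_iff[symmetric])

lemma ell2_of_bounded_sums:
  fixes f :: "'g \<Rightarrow> real"
  assumes "\<And>F. finite F \<Longrightarrow> (\<Sum>n\<in>F. (f n)\<^sup>2) \<le> c\<^sup>2" and "0 \<le> c"
  obtains x where "ell2_apply x = f" "norm x \<le> c"
proof -
  have s: "(\<lambda>n. (f n)\<^sup>2) summable_on UNIV"
    using assms(1) by (intro nonneg_bdd_above_summable_on bdd_aboveI2) auto
  have "(norm (Abs_ell2 f))\<^sup>2 \<le> c\<^sup>2"
    unfolding norm_ell2_power2 ell2_apply_Abs[OF s]
    by (rule infsum_le_finite_sums[OF s]) (use assms in auto)
  then have "norm (Abs_ell2 f) \<le> c"
    using \<open>0 \<le> c\<close> by (simp add: abs_le_square_iff[symmetric])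
  with ell2_apply_Abs[OF s] that show ?thesis by blast
qed

lemma bounded_linear_ell2_apply: "bounded_linear (\<lambda>x. ell2_apply x n)"
  by (rule bounded_linear_intro[where K = 1]) (auto simp: abs_ell2_apply_le_norm)

text \<open>
  Completeness is Fatou's lemma: a Cauchy sequence converges pointwise, and bounds on finite partial sums
  of squares survive the pointwise limit.
\<close>

instance ell2 :: (type) banach
proof
  fix X :: "nat \<Rightarrow> 'a ell2"
  assume X: "Cauchy X"
  have "\<exists>l. (\<lambda>k. ell2_apply (X k) n) \<longlonglongrightarrow> l" for n
    using bounded_linear.Cauchy[OF bounded_linear_ell2_apply X] Cauchy_convergent
    unfolding convergent_def by blast
  then obtain g where g: "\<And>n. (\<lambda>k. ell2_apply (X k) n) \<longlonglongrightarrow> g n"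
    by metis
  have key: "\<exists>y. ell2_apply y = (\<lambda>n. g n - ell2_apply (X k) n) \<and> norm y \<le> e"
    if e: "\<And>m. m \<ge> k \<Longrightarrow> norm (X m - X k) \<le> e" "0 \<le> e" for k e
  proof -
    have "(\<Sum>n\<in>F. (g n - ell2_apply (X k) n)\<^sup>2) \<le> e\<^sup>2" if "finite F" for F
    proof (rule LIMSEQ_le_const2)
      show "(\<lambda>m. \<Sum>n\<in>F. (ell2_apply (X m) n - ell2_apply (X k) n)\<^sup>2) \<longlonglongrightarrow> (\<Sum>n\<in>F. (g n - ell2_apply (X k) n)\<^sup>2)"
        by (intro tendsto_intros g)
      have "(\<Sum>n\<in>F. (ell2_apply (X m) n - ell2_apply (X k) n)\<^sup>2) \<le> e\<^sup>2" if "m \<ge> k" for m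
        using finite_sum_le_norm_ell2[OF \<open>finite F\<close>, of "X m - X k"] power_mono[OF e(1)[OF that], of 2]
        by simp
      then show "\<exists>N. \<forall>m\<ge>N. (\<Sum>n\<in>F. (ell2_apply (X m) n - ell2_apply (X k) n)\<^sup>2) \<le> e\<^sup>2"
        by blast
    qed
    then show ?thesis
      by (rule ell2_of_bounded_sums) (use e(2) in auto)
  qed
  have tail: "\<exists>k0. \<forall>k\<ge>k0. \<forall>m\<ge>k. norm (X m - X k) \<le> e" if "e > 0" for e
    using CauchyD[OF X that] by (meson less_imp_le order_trans)
  obtain k0 where "\<forall>m\<ge>k0. norm (X m - X k0) \<le> 1"
    using tail[of 1] by auto
  then obtain y where y: "ell2_apply y = (\<lambda>n. g n - ell2_apply (X k0) n)"
    using key[of k0 1] by auto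
  define L where "L = X k0 + y"
  have L: "ell2_apply L n = g n" for n
    by (simp add: L_def y)
  have "X \<longlonglongrightarrow> L"
  proof (rule LIMSEQ_I)
    fix r :: real assume "r > 0"
    then obtain k1 where k1: "\<forall>k\<ge>k1. \<forall>m\<ge>k. norm (X m - X k) \<le> r / 2"
      using tail[of "r / 2"] by auto
    have "norm (X k - L) < r" if "k \<ge> k1" for k
    proof -
      obtain y where "ell2_apply y = (\<lambda>n. g n - ell2_apply (X k) n)" "norm y \<le> r / 2"
        using key[of k "r / 2"] k1 \<open>k \<ge> k1\<close> \<open>r > 0\<close> by auto
      moreover from this have "y = L - X k"
        by (intro ell2_eqI) (simp add: L)
      ultimately show ?thesis
        using \<open>r > 0\<close> by (simp add: norm_minus_commute)
    qed
    then show "\<exists>no. \<forall>n\<ge>no. norm (X n - L) < r" by blast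
  qed
  then show "convergent X" by (auto simp: convergent_def)
qed

section \<open>Convolution with absolutely summable kernels\<close>

definition translate :: "'g::ab_group_add \<Rightarrow> 'g ell2 \<Rightarrow> 'g ell2" where
  "translate m x = Abs_ell2 (\<lambda>n. ell2_apply x (n - m))"

lemma bij_minus_const: "bij (\<lambda>n. n - m)" for m :: "'g::ab_group_add"
  by (rule bij_betw_byWitness[where f' = "\<lambda>n. n + m"]) auto

lemma ell2_apply_translate [simp]: "ell2_apply (translate m x) n = ell2_apply x (n - m)"
proof -
  have "(\<lambda>n. (ell2_apply x (n - m))\<^sup>2) summable_on UNIV"
    using summable_on_reindex_bij_betw[OF bij_minus_const, of "\<lambda>n. (ell2_apply x n)\<^sup>2" m]
      ell2_apply_summable[of x] by simp
  then show ?thesis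
    unfolding translate_def by (subst ell2_apply_Abs) auto
qed

lemma norm_translate [simp]: "norm (translate m x) = norm x"
proof -
  have "(norm (translate m x))\<^sup>2 = (norm x)\<^sup>2"
    unfolding norm_ell2_power2
    using infsum_reindex_bij_betw[OF bij_minus_const, of "\<lambda>n. (ell2_apply x n)\<^sup>2" m] by simp
  then show ?thesis by simp
qed

lemma bounded_linear_translate: "bounded_linear (translate m)"
  by (rule bounded_linear_intro[where K = 1]) (auto intro!: ell2_eqI)

lemma translate_translate: "translate m (translate n x) = translate (m + n) x"
  by (rule ell2_eqI) (simp add: algebra_simps)

lemma translate_zero [simp]: "translate 0 x = x"
  by (rule ell2_eqI) simp

lemma inner_translate: "translate m x \<bullet> y = x \<bullet> translate (- m) y"
proof -
  have "x \<bullet> translate (- m) y = (\<Sum>\<^sub>\<infinity>n. ell2_apply x (n - m) * ell2_apply (translate (- m) y) (n - m))"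
    unfolding inner_ell2_def
    by (rule infsum_reindex_bij_betw[OF bij_minus_const, symmetric])
  then show ?thesis
    by (simp add: inner_ell2_def)
qed

text \<open>
  The convolution is a series of translates that converges absolutely in the Hilbert space itself.
  Linearity, symmetry and commutation are then inherited from the translations by continuity, without
  interchanging any scalar sums.
\<close>

definition conv_op :: "('g::ab_group_add \<Rightarrow> real) \<Rightarrow> 'g ell2 \<Rightarrow> 'g ell2" where
  "conv_op a x = (\<Sum>\<^sub>\<infinity>m. a m *\<^sub>R translate m x)"

definition l1_norm :: "('g \<Rightarrow> real) \<Rightarrow> real" where
  "l1_norm a = (\<Sum>\<^sub>\<infinity>m. \<bar>a m\<bar>)"

definition in_l1 :: "('g \<Rightarrow> real) \<Rightarrow> bool" where
  "in_l1 a \<longleftrightarrow> (\<lambda>m. \<bar>a m\<bar>) summable_on UNIV"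

lemma l1_norm_nonneg: "0 \<le> l1_norm a"
  by (simp add: l1_norm_def infsum_nonneg)

lemma abs_summable_scaleR_bounded:
  fixes y :: "'g \<Rightarrow> 'b::banach"
  assumes "in_l1 a" "\<And>m. norm (y m) \<le> B"
  shows "(\<lambda>m. norm (a m *\<^sub>R y m)) summable_on UNIV"
proof (rule summable_on_comparison_test)
  show "(\<lambda>m. \<bar>a m\<bar> * B) summable_on UNIV"
    using assms(1) by (intro summable_on_cmult_left) (simp add: in_l1_def)
qed (use assms(2) in \<open>auto intro: mult_left_mono\<close>)

lemma summable_conv_op:
  assumes "in_l1 a"
  shows "(\<lambda>m. a m *\<^sub>R translate m x) summable_on UNIV"
  by (rule abs_summable_summable, rule abs_summable_scaleR_bounded[OF assms, of _ "norm x"]) simp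

lemma norm_conv_op_le:
  assumes "in_l1 a"
  shows "norm (conv_op a x) \<le> l1_norm a * norm x"
proof -
  have "norm (conv_op a x) \<le> (\<Sum>\<^sub>\<infinity>m. norm (a m *\<^sub>R translate m x))"
    unfolding conv_op_def
    by (rule norm_infsum_bound, rule abs_summable_scaleR_bounded[OF assms, of _ "norm x"]) simp
  also have "\<dots> = l1_norm a * norm x"
    using assms by (simp add: l1_norm_def infsum_cmult_left in_l1_def)
  finally show ?thesis .
qed

lemma bounded_linear_conv_op:
  assumes "in_l1 a"
  shows "bounded_linear (conv_op a)"
proof (rule bounded_linear_intro)
  interpret T: bounded_linear "translate m" for m :: 'a
    by (rule bounded_linear_translate)
  note s = summable_conv_op[OF assms]
  show "conv_op a (x + y) = conv_op a x + conv_op a y" for x y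
    by (simp add: conv_op_def T.add scaleR_right_distrib infsum_add s)
  show "conv_op a (c *\<^sub>R x) = c *\<^sub>R conv_op a x" for c x
    using infsum_scaleR_right[of c "\<lambda>m. a m *\<^sub>R translate m x" UNIV]
    by (simp add: conv_op_def T.scaleR mult.commute)
  show "norm (conv_op a x) \<le> norm x * l1_norm a" for x
    using norm_conv_op_le[OF assms] by (simp add: mult.commute)
qed

lemma translate_conv_op:
  assumes "in_l1 a"
  shows "translate n (conv_op a x) = conv_op a (translate n x)"
proof -
  interpret T: bounded_linear "translate n" by (rule bounded_linear_translate)
  have "translate n (conv_op a x) = (\<Sum>\<^sub>\<infinity>m. translate n (a m *\<^sub>R translate m x))"
    unfolding conv_op_def
    by (rule infsumI[symmetric], rule has_sum_bounded_linear[OF bounded_linear_translate],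
        rule has_sum_infsum, rule summable_conv_op[OF assms])
  then show ?thesis
    by (simp add: conv_op_def T.scaleR translate_translate add.commute)
qed

lemma ell2_apply_conv_op:
  assumes "in_l1 a"
  shows "((\<lambda>m. a m * ell2_apply x (n - m)) has_sum ell2_apply (conv_op a x) n) UNIV"
  using has_sum_bounded_linear[OF bounded_linear_ell2_apply[of n]
      has_sum_infsum[OF summable_conv_op[OF assms, of x]]]
  by (simp add: conv_op_def)

lemma conv_op_symmetric:
  assumes a: "in_l1 a" and even: "\<And>m. a (- m) = a m"
  shows "conv_op a x \<bullet> y = x \<bullet> conv_op a y"
proof -
  have "conv_op a x \<bullet> y = (\<Sum>\<^sub>\<infinity>m. (a m *\<^sub>R translate m x) \<bullet> y)"
    unfolding conv_op_def
    by (rule infsumI[symmetric], rule has_sum_bounded_linear[OF bounded_linear_inner_left],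
        rule has_sum_infsum, rule summable_conv_op[OF a])
  also have "\<dots> = (\<Sum>\<^sub>\<infinity>m. x \<bullet> (a (- m) *\<^sub>R translate (- m) y))"
    by (simp add: inner_translate even)
  also have "\<dots> = (\<Sum>\<^sub>\<infinity>m. x \<bullet> (a m *\<^sub>R translate m y))"
    using infsum_reindex_bij_betw[OF bij_uminus, of "\<lambda>m. x \<bullet> (a m *\<^sub>R translate m y)"] by simp
  also have "\<dots> = x \<bullet> conv_op a y"
    unfolding conv_op_def
    by (rule infsumI, rule has_sum_bounded_linear[OF bounded_linear_inner_right],
        rule has_sum_infsum, rule summable_conv_op[OF a])
  finally show ?thesis .
qed

lemma conv_op_commute:
  assumes "in_l1 a" "in_l1 b"
  shows "conv_op a (conv_op b x) = conv_op b (conv_op a x)"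
proof -
  interpret A: bounded_linear "conv_op a" by (rule bounded_linear_conv_op) fact
  have "conv_op a (conv_op b x) = (\<Sum>\<^sub>\<infinity>m. conv_op a (b m *\<^sub>R translate m x))"
    unfolding conv_op_def[of b]
    by (rule infsumI[symmetric], rule has_sum_bounded_linear[OF A.bounded_linear_axioms],
        rule has_sum_infsum, rule summable_conv_op[OF assms(2)])
  also have "\<dots> = conv_op b (conv_op a x)"
    by (simp add: A.scaleR conv_op_def[of b] translate_conv_op[OF assms(1)])
  finally show ?thesis .
qed

section \<open>Gaussian sums over the lattice\<close>

definition sq_norm :: "nat \<Rightarrow> (nat \<Rightarrow> int) \<Rightarrow> real" where
  "sq_norm d m = (\<Sum>i=1..d. (real_of_int (m i))\<^sup>2)"

lemma eucl_norm_eq_sqrt: "eucl_norm d m = sqrt (sq_norm d m)"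
  by (simp add: eucl_norm_def sq_norm_def)

lemma sq_norm_nonneg: "0 \<le> sq_norm d m"
  by (simp add: sq_norm_def sum_nonneg)

lemma sq_norm_of_int: "sq_norm d m = of_int (\<Sum>i=1..d. (m i)\<^sup>2)"
  by (simp add: sq_norm_def)

lemma lattice_product_sum:
  fixes h :: "nat \<Rightarrow> int \<Rightarrow> real"
  assumes nonneg: "\<And>i n. 0 \<le> h i n" and s: "\<And>i. h i summable_on UNIV"
  shows "((\<lambda>m. \<Prod>i=1..d. h i (m i)) has_sum (\<Prod>i=1..d. infsum (h i) UNIV)) (int_lattice d)"
proof -
  let ?P = "PiE {1..d} (\<lambda>_. UNIV) :: (nat \<Rightarrow> int) set"
  let ?f = "\<lambda>m :: nat \<Rightarrow> int. \<Prod>i=1..d. h i (m i)"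
  have inf: "infsum ?f ?P = (\<Prod>i=1..d. infsum (h i) UNIV)"
    using s nonneg by (intro infsum_prod_PiE_abs) auto
  \<comment> \<open>A nonzero value of \<open>infsum\<close> certifies summability; the value \<open>0\<close> forces a factor to vanish identically.\<close>
  have "?f summable_on ?P"
  proof (cases "infsum ?f ?P = 0")
    case False
    then show ?thesis using infsum_not_exists by blast
  next
    case True
    then obtain i where i: "i \<in> {1..d}" "infsum (h i) UNIV = 0"
      unfolding inf by auto
    have "h i n = 0" for n
      by (rule nonneg_infsum_le_0D[where A = UNIV]) (use i nonneg s in auto)
    then have "?f m = 0" for m
      using i(1) by (intro prod_zero bexI[of _ i]) auto
    then have "?f = (\<lambda>_. 0)" by (rule ext)
    then show ?thesis by (simp only: summable_on_0_simp)
  qed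
  then have "(?f has_sum (\<Prod>i=1..d. infsum (h i) UNIV)) ?P"
    using inf by (simp add: has_sum_iff)
  also have "?this \<longleftrightarrow> (?f has_sum (\<Prod>i=1..d. infsum (h i) UNIV)) (int_lattice d)"
    by (rule has_sum_reindex_bij_witness[where j = "\<lambda>m i. if i \<in> {1..d} then m i else 0"
          and i = "\<lambda>m i. if i \<in> {1..d} then m i else undefined"])
       (auto simp: int_lattice_def PiE_def extensional_def fun_eq_iff intro!: prod.cong)
  finally show ?thesis .
qed

lemma has_sum_int_geometric:
  fixes x :: real
  assumes "0 \<le> x" "x < 1"
  shows "((\<lambda>n::int. x ^ nat \<bar>n\<bar>) has_sum (1 + x) / (1 - x)) UNIV"
proof -
  have geo: "((\<lambda>n. x ^ n) has_sum 1 / (1 - x)) (UNIV :: nat set)"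
    using assms by (intro sums_nonneg_imp_has_sum geometric_sums) auto
  have pos: "((\<lambda>n::int. x ^ nat \<bar>n\<bar>) has_sum 1 / (1 - x)) {0..}"
    using geo
    by (subst has_sum_reindex_bij_witness[where j = nat and i = int and T = UNIV and h = "\<lambda>n. x ^ n"]) auto
  have "((\<lambda>n. x * x ^ n) has_sum x * (1 / (1 - x))) (UNIV :: nat set)"
    by (rule has_sum_cmult_right[OF geo])
  then have neg: "((\<lambda>n::int. x ^ nat \<bar>n\<bar>) has_sum x * (1 / (1 - x))) {..<0}"
    by (subst has_sum_reindex_bij_witness[where j = "\<lambda>n. nat (- n - 1)" and i = "\<lambda>n. - int n - 1"
          and T = UNIV and h = "\<lambda>n. x * x ^ n"])
       (auto simp flip: power_Suc simp: Suc_nat_eq_nat_zadd1)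
  have "((\<lambda>n::int. x ^ nat \<bar>n\<bar>) has_sum (1 / (1 - x) + x * (1 / (1 - x)))) ({0..} \<union> {..<0})"
    by (rule has_sum_Un_disjoint[OF pos neg]) auto
  also have "{0..} \<union> {..<0} = (UNIV :: int set)" by auto
  also have "1 / (1 - x) + x * (1 / (1 - x)) = (1 + x) / (1 - x)"
    by (simp add: add_divide_distrib)
  finally show ?thesis .
qed

definition gauss_sum :: "real \<Rightarrow> real" where
  "gauss_sum s = (\<Sum>\<^sub>\<infinity>n::int. exp (- s * (of_int n)\<^sup>2))"

lemma gauss_sum_dominated:
  assumes "\<And>n::int. exp (- s * (of_int n)\<^sup>2) \<le> c * x ^ nat \<bar>n\<bar>" "0 \<le> x" "x < 1"
  shows "(\<lambda>n::int. exp (- s * (of_int n)\<^sup>2)) summable_on UNIV"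
    and "gauss_sum s \<le> c * ((1 + x) / (1 - x))"
proof -
  have h: "((\<lambda>n::int. c * x ^ nat \<bar>n\<bar>) has_sum c * ((1 + x) / (1 - x))) UNIV"
    by (intro has_sum_cmult_right has_sum_int_geometric assms)
  show s: "(\<lambda>n::int. exp (- s * (of_int n)\<^sup>2)) summable_on UNIV"
    by (rule summable_on_comparison_test[OF has_sum_imp_summable[OF h]]) (use assms in auto)
  show "gauss_sum s \<le> c * ((1 + x) / (1 - x))"
    unfolding gauss_sum_def by (rule has_sum_mono[OF has_sum_infsum[OF s] h]) (use assms in auto)
qed

lemma exp_neg_sq_le_geometric:
  fixes s :: real and n :: int
  assumes "0 \<le> s"
  shows "exp (- s * (of_int n)\<^sup>2) \<le> 1 * exp (- s) ^ nat \<bar>n\<bar>"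
proof -
  have "\<bar>n\<bar> * 1 \<le> \<bar>n\<bar> * \<bar>n\<bar>"
    by (cases "n = 0") (auto intro!: mult_left_mono simp del: abs_mult_self_eq)
  then have "real_of_int \<bar>n\<bar> \<le> (of_int n)\<^sup>2"
    unfolding power2_eq_square by (metis abs_mult_self_eq mult.right_neutral of_int_le_iff of_int_mult)
  then have "s * real (nat \<bar>n\<bar>) \<le> s * (of_int n)\<^sup>2"
    using assms by (intro mult_left_mono) auto
  then show ?thesis
    by (simp add: exp_of_nat_mult[symmetric] mult.commute)
qed

lemma summable_gauss:
  fixes s :: real
  shows "0 < s \<Longrightarrow> (\<lambda>n::int. exp (- s * (of_int n)\<^sup>2)) summable_on UNIV"
  using gauss_sum_dominated(1)[of s 1 "exp (- s)"] exp_neg_sq_le_geometric[of s] by simp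

lemma gauss_sum_nonneg: "0 \<le> gauss_sum s"
  by (simp add: gauss_sum_def infsum_nonneg)

lemma gauss_sum_mono: "0 < s \<Longrightarrow> s \<le> t \<Longrightarrow> gauss_sum t \<le> gauss_sum s"
  unfolding gauss_sum_def
  by (intro infsum_mono summable_gauss) (auto intro: mult_right_mono)

text \<open>
  With \<open>u = sqrt s\<close>, completing the square in \<open>0 \<le> (u \<bar>n\<bar> - 1)\<^sup>2\<close> compares the Gaussian with a geometric
  sequence of ratio \<open>exp (- 2 u)\<close>, whose sum has the right order \<open>1 / u\<close>.
\<close>

lemma gauss_sum_le_small:
  assumes "0 < s" "s \<le> 1"
  shows "gauss_sum s \<le> 9 / sqrt s"
proof -
  define u where "u = sqrt s"
  have u: "0 < u" "u \<le> 1" "u\<^sup>2 = s"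
    using assms by (auto simp: u_def)
  have dom: "exp (- s * (of_int n)\<^sup>2) \<le> exp 1 * exp (- 2 * u) ^ nat \<bar>n\<bar>" for n :: int
  proof -
    have "0 \<le> (u * of_int \<bar>n\<bar> - 1)\<^sup>2" by simp
    also have "\<dots> = s * (of_int n)\<^sup>2 - 2 * u * of_int \<bar>n\<bar> + 1"
      using u(3) by (simp add: power2_diff power_mult_distrib)
    finally have "- s * (of_int n)\<^sup>2 \<le> 1 + real (nat \<bar>n\<bar>) * (- 2 * u)"
      by (simp add: algebra_simps)
    then show ?thesis
      by (simp only: exp_of_nat_mult[symmetric] exp_add[symmetric] exp_le_cancel_iff)
  qed
  let ?x = "exp (- 2 * u)"
  have x: "?x < 1" using u by simp
  have "gauss_sum s \<le> exp 1 * ((1 + ?x) / (1 - ?x))"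
    using gauss_sum_dominated(2)[OF dom] x by simp
  also have "(1 + ?x) / (1 - ?x) \<le> 3 / u"
  proof -
    have "1 + 2 * u \<le> exp (2 * u)" by (rule exp_ge_add_one_self)
    then have "?x * (1 + 2 * u) \<le> 1"
      by (simp add: exp_minus field_simps)
    then have "2 * u \<le> (1 - ?x) * (1 + 2 * u)" by (simp add: algebra_simps)
    also have "\<dots> \<le> (1 - ?x) * 3"
      using u x by (intro mult_left_mono) auto
    finally have "2 / (1 - ?x) \<le> 3 / u"
      using u x by (simp add: field_simps)
    moreover have "(1 + ?x) / (1 - ?x) \<le> 2 / (1 - ?x)"
      using x by (intro divide_right_mono) auto
    ultimately show ?thesis by linarith
  qed
  then have "exp 1 * ((1 + ?x) / (1 - ?x)) \<le> 3 * (3 / u)"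
    using exp_le x u by (intro mult_mono) auto
  finally show ?thesis by (simp add: u_def)
qed

text \<open>
  The numerical value matters: the \<open>d\<close>-th power of this bound has to lose against \<open>sqrt (3/2) ^ d\<close> in the
  upper bound for the operator norm and against \<open>(sqrt 5 / 2) ^ d\<close> in the lower bound.
\<close>

lemma gauss_sum_le_large:
  assumes "3 \<le> s"
  shows "gauss_sum s \<le> 1.11"
proof -
  let ?x = "exp (- 3 :: real)"
  \<comment> \<open>\<open>1.28 ^ 12 > 19.3\<close> gives a lower bound for \<open>exp 3\<close>.\<close>
  have "(1.28 :: real) \<le> exp (1 / 4)"
    using exp_lower_Taylor_quadratic[of "1 / 4"] by (simp add: power2_eq_square)
  then have "1.28 ^ 12 \<le> exp (1 / 4 :: real) ^ 12"
    by (intro power_mono) auto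
  then have "(1.28 :: real) ^ 12 \<le> exp 3"
    by (simp add: exp_of_nat_mult[symmetric])
  then have e3: "(19.3 :: real) \<le> exp 3"
    by (simp add: power_numeral_even power_numeral_odd)
  then have x: "?x \<le> 10 / 193" "0 \<le> ?x" "?x < 1"
    by (auto simp: exp_minus field_simps)
  have "gauss_sum s \<le> gauss_sum 3"
    using assms by (intro gauss_sum_mono) auto
  also have "\<dots> \<le> 1 * ((1 + ?x) / (1 - ?x))"
    by (rule gauss_sum_dominated(2)[OF exp_neg_sq_le_geometric]) auto
  also have "\<dots> \<le> 1.11"
    using x by (simp add: field_simps)
  finally show ?thesis .
qed

lemma gauss_sum_le_9: "1 \<le> s \<Longrightarrow> gauss_sum s \<le> 9"
  using gauss_sum_mono[of 1 s] gauss_sum_le_small[of 1] by simp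

lemma exp_sq_norm: "exp (- s * sq_norm d m) = (\<Prod>i=1..d. exp (- s * (of_int (m i))\<^sup>2))"
  by (simp add: sq_norm_def sum_distrib_left exp_sum)

lemma lattice_gauss_sum:
  assumes "0 < s"
  shows "((\<lambda>m. exp (- s * sq_norm d m)) has_sum gauss_sum s ^ d) (int_lattice d)"
  unfolding exp_sq_norm
  using lattice_product_sum[of "\<lambda>_ n. exp (- s * (of_int n)\<^sup>2)" d] summable_gauss[OF assms]
  by (simp add: gauss_sum_def)

lemma le_exp_self: "x \<le> exp (x :: real)"
  using exp_ge_add_one_self[of x] by linarith

text \<open>
  The quadratic weight is at most \<open>exp (m\<^sub>j\<^sup>2 + m\<^sub>k\<^sup>2)\<close>, so it costs one unit in the exponents of the coordinates
  \<open>j\<close> and \<open>k\<close> only. All other coordinates keep the factor close to \<open>1\<close>.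
\<close>

lemma lattice_weighted_gauss_sum:
  assumes jk: "j \<in> {1..d}" "k \<in> {1..d}" "j \<noteq> k"
  defines "f \<equiv> \<lambda>m. ((of_int (m j))\<^sup>2 + (of_int (m k))\<^sup>2) * exp (- pi * sq_norm d m)"
  shows "f summable_on int_lattice d" "infsum f (int_lattice d) \<le> 81 * 1.11 ^ d"
proof -
  let ?h = "\<lambda>i n. exp (- (if i \<in> {j, k} then pi - 1 else pi) * (of_int n)\<^sup>2) :: real"
  have s: "0 < (if i \<in> {j, k} then pi - 1 else pi)" for i
    using pi_gt3 by auto
  have hs: "((\<lambda>m. \<Prod>i=1..d. ?h i (m i)) has_sum
      (\<Prod>i=1..d. gauss_sum (if i \<in> {j, k} then pi - 1 else pi))) (int_lattice d)"
    using lattice_product_sum[of ?h d, OF _ summable_gauss[OF s]] by (simp add: gauss_sum_def)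
  have le: "f m \<le> (\<Prod>i=1..d. ?h i (m i))" for m
  proof -
    let ?w = "(of_int (m j))\<^sup>2 + (of_int (m k))\<^sup>2 :: real"
    have "f m \<le> exp ?w * exp (- pi * sq_norm d m)"
      unfolding f_def by (intro mult_right_mono le_exp_self) auto
    also have "\<dots> = exp (\<Sum>i=1..d. - (if i \<in> {j, k} then pi - 1 else pi) * (of_int (m i))\<^sup>2)"
    proof -
      have "(\<Sum>i=1..d. - (if i \<in> {j, k} then pi - 1 else pi) * (of_int (m i))\<^sup>2)
        = (\<Sum>i=1..d. (if i \<in> {j, k} then (of_int (m i))\<^sup>2 else 0) - pi * (of_int (m i))\<^sup>2)"
        by (intro sum.cong refl) (auto simp: algebra_simps)
      also have "\<dots> = (\<Sum>i=1..d. (if i \<in> {j, k} then (of_int (m i))\<^sup>2 else 0)) - pi * sq_norm d m"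
        by (simp only: sum_subtractf sq_norm_def sum_distrib_left)
      also have "(\<Sum>i=1..d. (if i \<in> {j, k} then (of_int (m i))\<^sup>2 else 0 :: real)) = (\<Sum>i\<in>{j, k}. (of_int (m i))\<^sup>2)"
        using jk by (subst sum.inter_restrict[symmetric]) (auto intro!: sum.cong)
      also have "\<dots> = ?w"
        using jk by simp
      finally show ?thesis by (simp add: exp_add[symmetric])
    qed
    finally show ?thesis by (simp add: exp_sum)
  qed
  show fs: "f summable_on int_lattice d"
    by (rule summable_on_comparison_test[OF has_sum_imp_summable[OF hs]])
       (rule le, simp add: f_def)
  have "infsum f (int_lattice d) \<le> (\<Prod>i=1..d. gauss_sum (if i \<in> {j, k} then pi - 1 else pi))"
    by (rule has_sum_mono[OF has_sum_infsum[OF fs] hs]) (rule le)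
  also have "\<dots> \<le> (\<Prod>i=1..d. (if i \<in> {j, k} then 9 else 1) * 1.11)"
  proof (intro prod_mono conjI)
    fix i
    have "gauss_sum (pi - 1) \<le> 9"
      by (rule gauss_sum_le_9) (use pi_gt3 in simp)
    moreover have "gauss_sum pi \<le> 1.11"
      by (rule gauss_sum_le_large) (use pi_gt3 in simp)
    ultimately show "gauss_sum (if i \<in> {j, k} then pi - 1 else pi) \<le> (if i \<in> {j, k} then 9 else 1) * 1.11"
      by auto
  qed (rule gauss_sum_nonneg)
  also have "\<dots> = (\<Prod>i\<in>{j, k}. 9) * 1.11 ^ d"
    using jk by (simp only: prod.distrib prod_constant card_atLeastAtMost)
       (subst prod.inter_restrict[symmetric], auto intro!: prod.cong)
  also have "(\<Prod>i\<in>{j, k}. 9) = (81 :: real)"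
    using jk by simp
  finally show "infsum f (int_lattice d) \<le> 81 * 1.11 ^ d" .
qed

lemma l1_boundI:
  fixes a b :: "'g \<Rightarrow> real"
  assumes "b summable_on G" "infsum b G \<le> B"
    and "\<And>m. m \<in> G \<Longrightarrow> \<bar>a m\<bar> \<le> b m" "\<And>m. m \<notin> G \<Longrightarrow> a m = 0"
  shows "in_l1 a" "l1_norm a \<le> B"
proof -
  have G: "(\<lambda>m. \<bar>a m\<bar>) summable_on G"
    by (rule summable_on_comparison_test[OF assms(1)]) (use assms in auto)
  also have "?this \<longleftrightarrow> in_l1 a"
    unfolding in_l1_def by (rule summable_on_cong_neutral) (use assms in auto)
  finally show "in_l1 a" .
  have "l1_norm a = (\<Sum>\<^sub>\<infinity>m\<in>G. \<bar>a m\<bar>)"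
    unfolding l1_norm_def by (rule infsum_cong_neutral) (use assms in auto)
  also have "\<dots> \<le> infsum b G"
    by (rule infsum_mono) (use G assms in auto)
  finally show "l1_norm a \<le> B" using assms(2) by simp
qed

lemma int_lattice_add: "m \<in> int_lattice d \<Longrightarrow> n \<in> int_lattice d \<Longrightarrow> m + n \<in> int_lattice d"
  and int_lattice_diff: "m \<in> int_lattice d \<Longrightarrow> n \<in> int_lattice d \<Longrightarrow> m - n \<in> int_lattice d"
  and int_lattice_uminus: "m \<in> int_lattice d \<Longrightarrow> - m \<in> int_lattice d"
  and int_lattice_0: "0 \<in> int_lattice d"
  by (auto simp: int_lattice_def)

section \<open>The kernel as a superposition of Gaussians\<close>

definition heat :: "nat \<Rightarrow> real \<Rightarrow> real \<Rightarrow> real" where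
  "heat d r t = pi * sqrt t ^ d * exp (- pi * t * r)"

lemma heat_nonneg: "0 \<le> t \<Longrightarrow> 0 \<le> heat d r t"
  by (simp add: heat_def)

lemma continuous_on_heat: "continuous_on S (heat d r)"
  unfolding heat_def by (intro continuous_intros)

lemma heat_integrable [intro]: "heat d r integrable_on {a..b}"
  by (intro integrable_continuous_interval continuous_on_heat)

lemma sqrt_power_eq_powr: "0 < r \<Longrightarrow> sqrt r ^ n = r powr (real n / 2)"
  by (simp add: powr_half_sqrt[symmetric] powr_realpow[symmetric] powr_powr)

text \<open>
  The Gamma integral, rescaled. The constant \<open>riesz_const d\<close> is exactly the one for which the Gaussian
  superposition has the dimension-free weight \<open>\<pi>\<close>.
\<close>

lemma heat_has_integral:
  assumes r: "0 < r"
  shows "(heat d r has_integral riesz_const d / sqrt r ^ (d + 2)) {0..}"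
proof -
  define f where "f = (\<lambda>t::real. t powr (real d / 2) / exp t)"
  have "(f has_integral Gamma (real d / 2 + 1)) {0..}"
    using Gamma_integral_real[of "real d / 2 + 1"] by (simp add: f_def)
  then have f: "f absolutely_integrable_on {0..}" "integral {0..} f = Gamma (real d / 2 + 1)"
    by (auto intro!: nonnegative_absolutely_integrable_1 simp: f_def integral_unique)
  have img: "(\<lambda>u. pi * r * u) ` {0..} = {0..}"
  proof safe
    fix x :: real assume "0 \<le> x"
    then show "x \<in> (\<lambda>u. pi * r * u) ` {0..}"
      using r by (intro image_eqI[of _ _ "x / (pi * r)"]) auto
  qed (use r in auto)
  have "(\<lambda>u. \<bar>pi * r\<bar> *\<^sub>R f (pi * r * u)) absolutely_integrable_on {0..} \<and>
      integral {0..} (\<lambda>u. \<bar>pi * r\<bar> *\<^sub>R f (pi * r * u)) = Gamma (real d / 2 + 1)"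
    by (subst has_absolute_integral_change_of_variables_real[where g = "\<lambda>u. pi * r * u"])
       (use f r in \<open>auto simp: img inj_on_def intro!: derivative_eq_intros\<close>)
  then have "((\<lambda>u. pi * r * f (pi * r * u)) has_integral Gamma (real d / 2 + 1)) {0..}"
    using r by (auto simp: has_integral_iff set_lebesgue_integral_eq_integral)
  then have "((\<lambda>u. (pi / (pi * r) powr (real d / 2 + 1)) * (pi * r * f (pi * r * u))) has_integral
      (pi / (pi * r) powr (real d / 2 + 1)) * Gamma (real d / 2 + 1)) {0..}"
    by (rule has_integral_mult_right)
  also have "(pi / (pi * r) powr (real d / 2 + 1)) * Gamma (real d / 2 + 1) = riesz_const d / sqrt r ^ (d + 2)"
  proof -
    have "sqrt r ^ (d + 2) = r powr (real (d + 2) / 2)"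
      using r by (rule sqrt_power_eq_powr)
    also have "real (d + 2) / 2 = real d / 2 + 1" by simp
    finally show ?thesis
      using r by (simp add: riesz_const_def powr_mult powr_add add_divide_distrib add.commute)
  qed
  finally show ?thesis
  proof (rule has_integral_spike[of "{0}", rotated 2])
    fix u :: real assume "u \<in> {0..} - {0}"
    then have u: "0 < u" by simp
    then have "sqrt u ^ d = u powr (real d / 2)"
      by (rule sqrt_power_eq_powr)
    moreover have "(pi * r) powr (real d / 2 + 1) = pi powr (real d / 2) * r powr (real d / 2) * (pi * r)"
      using r by (subst powr_add) (simp add: powr_mult)
    ultimately show "heat d r u = (pi / (pi * r) powr (real d / 2 + 1)) * (pi * r * f (pi * r * u))"
      using r u by (simp add: f_def heat_def powr_mult exp_minus divide_simps)
  qed simp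
qed

text \<open>
  The superposition is cut at \<open>t = 1\<close>. The part \<open>t \<ge> 1\<close> is absolutely summable and carries the main terms;
  the part \<open>t \<le> 1\<close> carries the singular behaviour at infinity but is only exponentially large in \<open>d\<close>.
\<close>

definition heat_tail :: "nat \<Rightarrow> real \<Rightarrow> real" where
  "heat_tail d r = integral {1..} (heat d r)"

definition heat_head :: "nat \<Rightarrow> real \<Rightarrow> real" where
  "heat_head d r = integral {0..1} (heat d r)"

lemma heat_integrable_tail: "0 < r \<Longrightarrow> heat d r integrable_on {1..}"
proof -
  assume "0 < r"
  then have "heat d r absolutely_integrable_on {0..}"
    by (intro nonnegative_absolutely_integrable_1 has_integral_integrable[OF heat_has_integral] heat_nonneg) auto
  then have "heat d r absolutely_integrable_on {1..}"
    by (rule set_integrable_subset) auto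
  then show ?thesis
    by (rule set_lebesgue_integral_eq_integral(1))
qed

lemma heat_head_tail:
  assumes "0 < r"
  shows "heat_head d r + heat_tail d r = riesz_const d / sqrt r ^ (d + 2)"
proof -
  have "(heat d r has_integral (heat_head d r + heat_tail d r)) ({0..1} \<union> {1..})"
    unfolding heat_head_def heat_tail_def
  proof (rule has_integral_Un)
    have "{0..1} \<inter> {1..} = {1::real}" by auto
    then show "negligible ({0..1} \<inter> {1..} :: real set)" by simp
  qed (use assms heat_integrable_tail in auto)
  also have "{0..1} \<union> {1..} = ({0..} :: real set)" by auto
  finally show ?thesis
    using heat_has_integral[OF assms] has_integral_unique by blast
qed

lemma heat_head_nonneg: "0 \<le> heat_head d r"
  unfolding heat_head_def by (intro integral_nonneg heat_integrable heat_nonneg) auto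

lemma heat_tail_nonneg: "0 < r \<Longrightarrow> 0 \<le> heat_tail d r"
  unfolding heat_tail_def by (intro integral_nonneg heat_integrable_tail heat_nonneg) auto

lemma heat_tail_le: "0 < r \<Longrightarrow> heat_tail d r \<le> riesz_const d / sqrt r ^ (d + 2)"
  using heat_head_tail[of r d] heat_head_nonneg[of d r] by simp

lemma heat_head_le: "0 \<le> r \<Longrightarrow> heat_head d r \<le> pi"
proof -
  assume r: "0 \<le> r"
  have "heat_head d r \<le> integral {0..1::real} (\<lambda>_. pi)"
    unfolding heat_head_def
  proof (rule integral_le)
    fix t :: real assume t: "t \<in> {0..1}"
    then have "sqrt t ^ d \<le> 1" by (intro power_le_one) auto
    moreover have "exp (- pi * t * r) \<le> 1" using t r by simp
    ultimately have "sqrt t ^ d * exp (- pi * t * r) \<le> 1 * 1"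
      using t by (intro mult_mono) auto
    then show "heat d r t \<le> pi"
      using mult_left_mono[of _ 1 pi] by (simp add: heat_def mult.assoc)
  qed auto
  then show ?thesis by simp
qed

lemma heat_tail_ge: "0 < r \<Longrightarrow> riesz_const d / sqrt r ^ (d + 2) - pi \<le> heat_tail d r"
  using heat_head_tail[of r d] heat_head_le[of r d] by simp

text \<open>
  For \<open>t \<ge> 1\<close> the factor \<open>exp (- \<pi> t (r - N))\<close> is at most its value at \<open>t = 1\<close>. Hence all lattice points
  beyond the sphere \<open>|m|\<^sup>2 = N\<close> together cost no more than the weight of that sphere times a convergent
  Gaussian sum.
\<close>

lemma heat_tail_decay:
  assumes "0 < N" "N \<le> r"
  shows "heat_tail d r \<le> exp (pi * N) * heat_tail d N * exp (- pi * r)"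
proof -
  have "heat_tail d r \<le> integral {1..} (\<lambda>t. exp (pi * N) * exp (- pi * r) * heat d N t)"
    unfolding heat_tail_def
  proof (rule integral_le)
    fix t :: real assume "t \<in> {1..}"
    then have t: "1 \<le> t" by simp
    have "1 * (r - N) \<le> t * (r - N)"
      using t assms by (intro mult_right_mono) auto
    then have "pi * (1 * (r - N)) \<le> pi * (t * (r - N))"
      by (intro mult_left_mono) auto
    then have "exp (- pi * t * r) \<le> exp (pi * N) * exp (- pi * r) * exp (- pi * t * N)"
      by (simp add: exp_add[symmetric] algebra_simps)
    then have "(pi * sqrt t ^ d) * exp (- pi * t * r) \<le> (pi * sqrt t ^ d) * (exp (pi * N) * exp (- pi * r) * exp (- pi * t * N))"
      using t by (intro mult_left_mono) auto
    then show "heat d r t \<le> exp (pi * N) * exp (- pi * r) * heat d N t"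
      by (simp add: heat_def mult_ac)
  qed (use assms in \<open>auto intro!: heat_integrable_tail integrable_on_mult_right\<close>)
  then show ?thesis
    by (simp add: heat_tail_def mult_ac)
qed

lemma riesz_const_pos: "0 < riesz_const d"
  by (simp add: riesz_const_def Gamma_real_pos)

text \<open>
  The constant outgrows every exponential: \<open>A\<close> is arbitrary. This makes every error of size \<open>C ^ d\<close>
  negligible against \<open>riesz_const d / 2 ^ d\<close>. Only the part \<open>[A, A + 1]\<close> of the integral is kept.
\<close>

lemma riesz_const_growth:
  assumes "0 \<le> A"
  shows "sqrt A ^ d * (pi * exp (- pi * (A + 1))) \<le> riesz_const d"
proof -
  have "sqrt A ^ d * (pi * exp (- pi * (A + 1))) = integral {A..A + 1} (\<lambda>_. sqrt A ^ d * (pi * exp (- pi * (A + 1))))"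
    by simp
  also have "\<dots> \<le> integral {A..A + 1} (heat d 1)"
  proof (rule integral_le)
    fix t assume t: "t \<in> {A..A + 1}"
    have "sqrt A ^ d * (pi * exp (- pi * (A + 1))) \<le> sqrt t ^ d * (pi * exp (- pi * t))"
      using t assms by (intro mult_mono power_mono) auto
    then show "sqrt A ^ d * (pi * exp (- pi * (A + 1))) \<le> heat d 1 t"
      by (simp add: heat_def mult_ac)
  qed auto
  also have "\<dots> \<le> integral {0..} (heat d 1)"
    using assms heat_has_integral[of 1 d]
    by (intro integral_subset_le) (auto intro: heat_nonneg)
  also have "\<dots> = riesz_const d"
    using heat_has_integral[of 1 d] by (simp add: integral_unique)
  finally show ?thesis .
qed

definition heat_piece :: "nat \<Rightarrow> real \<Rightarrow> real \<Rightarrow> real" where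
  "heat_piece d \<tau> r = integral {\<tau>..4 * \<tau>} (heat d r)"

text \<open>
  The length \<open>3 \<tau>\<close> of the interval \<open>[\<tau>, 4 \<tau>]\<close> times the largest value of \<open>\<pi> sqrt t ^ d\<close> on it.
\<close>

definition piece_scale :: "nat \<Rightarrow> real \<Rightarrow> real" where
  "piece_scale d \<tau> = 3 * pi * \<tau> * (2 * sqrt \<tau>) ^ d"

lemma piece_scale_nonneg: "0 \<le> \<tau> \<Longrightarrow> 0 \<le> piece_scale d \<tau>"
  by (simp add: piece_scale_def)

lemma sqrt_power_le_piece:
  assumes "0 < \<tau>" "t \<in> {\<tau>..4 * \<tau>}"
  shows "sqrt t ^ d \<le> (2 * sqrt \<tau>) ^ d"
proof -
  have "sqrt t \<le> sqrt (4 * \<tau>)" using assms by simp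
  then show ?thesis using assms by (intro power_mono) (auto simp: real_sqrt_mult)
qed

lemma heat_piece_nonneg: "0 < \<tau> \<Longrightarrow> 0 \<le> heat_piece d \<tau> r"
  unfolding heat_piece_def by (intro integral_nonneg heat_integrable heat_nonneg) auto

lemma heat_piece_le:
  assumes \<tau>: "0 < \<tau>" and r: "0 \<le> r"
  shows "heat_piece d \<tau> r \<le> piece_scale d \<tau> * exp (- pi * \<tau> * r)"
proof -
  have "heat_piece d \<tau> r \<le> integral {\<tau>..4 * \<tau>} (\<lambda>_. pi * (2 * sqrt \<tau>) ^ d * exp (- pi * \<tau> * r))"
    unfolding heat_piece_def
  proof (rule integral_le)
    fix t assume t: "t \<in> {\<tau>..4 * \<tau>}"
    have "pi * sqrt t ^ d * exp (- pi * t * r) \<le> pi * (2 * sqrt \<tau>) ^ d * exp (- pi * \<tau> * r)"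
      using t \<tau> r sqrt_power_le_piece[OF \<tau> t, of d] by (intro mult_mono) (auto intro: mult_right_mono)
    then show "heat d r t \<le> pi * (2 * sqrt \<tau>) ^ d * exp (- pi * \<tau> * r)"
      by (simp add: heat_def)
  qed auto
  then show ?thesis
    using \<tau> by (simp add: piece_scale_def mult_ac)
qed

lemma exp_neg_diff_le: "exp (- x) - exp (- y) \<le> \<bar>y - x\<bar> * exp (- x)" for x y :: real
proof -
  have "1 + (x - y) \<le> exp (x - y)" by (rule exp_ge_add_one_self)
  then have "exp (- x) * (1 - exp (x - y)) \<le> exp (- x) * \<bar>y - x\<bar>"
    by (intro mult_left_mono) (linarith, simp)
  also have "exp (- x) * (1 - exp (x - y)) = exp (- x) - exp (- y)"
    by (simp add: algebra_simps exp_add[symmetric])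
  finally show ?thesis by (simp add: mult.commute)
qed

lemma heat_piece_diff_le:
  assumes \<tau>: "0 < \<tau>" and r: "0 \<le> r" "0 \<le> r'"
  shows "\<bar>heat_piece d \<tau> r' - heat_piece d \<tau> r\<bar>
    \<le> 4 * pi * \<tau> * \<bar>r' - r\<bar> * piece_scale d \<tau> * (exp (- pi * \<tau> * r) + exp (- pi * \<tau> * r'))"
proof -
  let ?E = "exp (- pi * \<tau> * r) + exp (- pi * \<tau> * r')"
  let ?c = "pi * (2 * sqrt \<tau>) ^ d * (4 * pi * \<tau> * \<bar>r' - r\<bar> * ?E)"
  have "norm (integral {\<tau>..4 * \<tau>} (\<lambda>t. heat d r' t - heat d r t)) \<le> integral {\<tau>..4 * \<tau>} (\<lambda>_. ?c)"
  proof (rule integral_norm_bound_integral)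
    fix t assume t: "t \<in> {\<tau>..4 * \<tau>}"
    let ?a = "pi * t * r" and ?b = "pi * t * r'"
    have d: "\<bar>?b - ?a\<bar> \<le> 4 * pi * \<tau> * \<bar>r' - r\<bar>"
    proof -
      have "\<bar>?b - ?a\<bar> = pi * t * \<bar>r' - r\<bar>"
        using t \<tau> by (simp add: right_diff_distrib[symmetric] abs_mult)
      also have "\<dots> \<le> pi * (4 * \<tau>) * \<bar>r' - r\<bar>"
        using t by (intro mult_right_mono mult_left_mono) auto
      finally show ?thesis by (simp add: mult_ac)
    qed
    have mono: "exp (- (pi * t * s)) \<le> exp (- pi * \<tau> * s)" if "0 \<le> s" for s
      using t that by (auto intro: mult_right_mono)
    have e: "exp (- ?a) \<le> ?E" "exp (- ?b) \<le> ?E"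
      using mono[of r] mono[of r'] r by (auto intro: add_increasing add_increasing2)
    have "exp (- ?a) - exp (- ?b) \<le> 4 * pi * \<tau> * \<bar>r' - r\<bar> * ?E"
      using exp_neg_diff_le[of ?a ?b] mult_mono[OF d e(1)] \<tau> by fastforce
    moreover have "exp (- ?b) - exp (- ?a) \<le> 4 * pi * \<tau> * \<bar>r' - r\<bar> * ?E"
      using exp_neg_diff_le[of ?b ?a] mult_mono[OF d e(2)] \<tau> by (fastforce simp: abs_minus_commute)
    ultimately have "\<bar>exp (- ?b) - exp (- ?a)\<bar> \<le> 4 * pi * \<tau> * \<bar>r' - r\<bar> * ?E"
      by simp
    then have "pi * sqrt t ^ d * \<bar>exp (- ?b) - exp (- ?a)\<bar> \<le> ?c"
      using t \<tau> sqrt_power_le_piece[OF \<tau> t, of d] by (intro mult_mono) auto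
    moreover have "heat d r' t - heat d r t = pi * sqrt t ^ d * (exp (- ?b) - exp (- ?a))"
      by (simp add: heat_def algebra_simps)
    ultimately show "norm (heat d r' t - heat d r t) \<le> ?c"
      using t \<tau> by (simp add: abs_mult)
  qed (auto intro: integrable_diff)
  also have "integral {\<tau>..4 * \<tau>} (\<lambda>t. heat d r' t - heat d r t) = heat_piece d \<tau> r' - heat_piece d \<tau> r"
    unfolding heat_piece_def by (rule integral_diff) auto
  also have "integral {\<tau>..4 * \<tau>} (\<lambda>_. ?c) = 4 * pi * \<tau> * \<bar>r' - r\<bar> * piece_scale d \<tau> * ?E"
    using \<tau> by (simp add: piece_scale_def mult_ac)
  finally show ?thesis by simp
qed

lemma sum_heat_piece: "(\<Sum>i<M. heat_piece d ((1/4) ^ Suc i) r) = integral {(1/4) ^ M..1} (heat d r)"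
proof (induction M)
  case (Suc M)
  have "integral {(1/4) ^ Suc M..(1/4) ^ M} (heat d r) + integral {(1/4) ^ M..1} (heat d r)
      = integral {(1/4) ^ Suc M..1} (heat d r)"
    using Henstock_Kurzweil_Integration.integral_combine[of "(1/4) ^ Suc M" "(1/4) ^ M" 1 "heat d r"] by (auto simp: power_le_one)
  then show ?case
    using Suc by (simp add: heat_piece_def)
qed simp

lemma heat_piece_sums: "(\<lambda>M. \<Sum>i<M. heat_piece d ((1/4) ^ Suc i) r) \<longlonglongrightarrow> heat_head d r"
proof -
  have "continuous_on {0..1} (\<lambda>x. integral {x..1} (heat d r))"
    by (rule indefinite_integral_continuous_1') auto
  moreover have "(\<lambda>M. (1/4::real) ^ M) \<longlonglongrightarrow> 0"
    by (rule LIMSEQ_power_zero) auto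
  ultimately have "(\<lambda>M. integral {(1/4) ^ M..1} (heat d r)) \<longlonglongrightarrow> integral {0..1} (heat d r)"
    by (rule continuous_on_tendsto_compose) (auto simp: power_le_one)
  then show ?thesis
    by (simp only: sum_heat_piece heat_head_def)
qed

section \<open>Differences of translates\<close>

lemma conv_op_diff_kernel:
  assumes "in_l1 a" "in_l1 b" "in_l1 (\<lambda>m. a m - b m)"
  shows "conv_op (\<lambda>m. a m - b m) x = conv_op a x - conv_op b x"
proof (rule ell2_eqI)
  fix n
  have "((\<lambda>m. a m * ell2_apply x (n - m) + - (b m * ell2_apply x (n - m))) has_sum
      (ell2_apply (conv_op a x) n + - ell2_apply (conv_op b x) n)) UNIV"
    by (intro has_sum_add has_sum_uminusI ell2_apply_conv_op assms)
  then have "((\<lambda>m. (a m - b m) * ell2_apply x (n - m)) has_sum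
      ell2_apply (conv_op a x - conv_op b x) n) UNIV"
    by (simp add: algebra_simps)
  with ell2_apply_conv_op[OF assms(3), of x n]
  show "ell2_apply (conv_op (\<lambda>m. a m - b m) x) n = ell2_apply (conv_op a x - conv_op b x) n"
    using has_sum_unique by blast
qed

lemma in_l1_shift: "in_l1 a \<Longrightarrow> in_l1 (\<lambda>m. a (m - u))" for a :: "'g::ab_group_add \<Rightarrow> real"
  unfolding in_l1_def
  using summable_on_reindex_bij_betw[OF bij_minus_const, of "\<lambda>m. \<bar>a m\<bar>" u] by simp

lemma translate_conv_op_kernel:
  assumes "in_l1 a"
  shows "translate u (conv_op a x) = conv_op (\<lambda>m. a (m - u)) x"
proof (rule ell2_eqI)
  fix n
  have "((\<lambda>m. a m * ell2_apply x (n - u - m)) has_sum ell2_apply (conv_op a x) (n - u)) UNIV"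
    by (rule ell2_apply_conv_op[OF assms])
  also have "?this \<longleftrightarrow> ((\<lambda>m. a (m - u) * ell2_apply x (n - u - (m - u))) has_sum ell2_apply (conv_op a x) (n - u)) UNIV"
    by (rule has_sum_reindex_bij_betw[OF bij_minus_const, symmetric])
  finally have "((\<lambda>m. a (m - u) * ell2_apply x (n - m)) has_sum ell2_apply (conv_op a x) (n - u)) UNIV"
    by simp
  with ell2_apply_conv_op[OF in_l1_shift[OF assms], of u x n]
  show "ell2_apply (translate u (conv_op a x)) n = ell2_apply (conv_op (\<lambda>m. a (m - u)) x) n"
    using has_sum_unique by fastforce
qed

definition axis_vec :: "nat \<Rightarrow> int \<Rightarrow> nat \<Rightarrow> int" where
  "axis_vec j n = (\<lambda>i. if i = j then n else 0)"

lemma axis_vec_in_lattice: "j \<in> {1..d} \<Longrightarrow> axis_vec j n \<in> int_lattice d"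
  by (auto simp: axis_vec_def int_lattice_def)

lemma norm_translate_uminus_diff: "norm (translate (- u) y - y) = norm (translate u y - y)"
proof -
  interpret T: bounded_linear "translate u" by (rule bounded_linear_translate)
  have "norm (translate (- u) y - y) = norm (translate u (translate (- u) y - y))"
    by simp
  also have "\<dots> = norm (y - translate u y)"
    by (simp add: T.diff translate_translate)
  finally show ?thesis by (simp add: norm_minus_commute)
qed

lemma norm_translate_sum_diff:
  "norm (translate (u + v) y - y) \<le> norm (translate u y - y) + norm (translate v y - y)"
proof -
  interpret T: bounded_linear "translate u" by (rule bounded_linear_translate)
  have "translate (u + v) y - y = translate u (translate v y - y) + (translate u y - y)"
    by (simp add: T.diff translate_translate)
  then show ?thesis
    using norm_triangle_ineq[of "translate u (translate v y - y)" "translate u y - y"]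
    by (simp only: norm_translate)
qed

text \<open>
  A long step along an axis is a telescoping sum of unit steps, and translations are isometries.
\<close>

lemma norm_translate_axis_diff:
  "norm (translate (axis_vec j n) y - y) \<le> \<bar>of_int n\<bar> * norm (translate (axis_vec j 1) y - y)"
proof -
  have nat: "norm (translate (axis_vec j (int n)) y - y) \<le> real n * norm (translate (axis_vec j 1) y - y)" for n
  proof (induction n)
    case 0
    have "axis_vec j (int 0) = 0" by (rule ext) (simp add: axis_vec_def)
    then show ?case by (simp only: translate_zero) simp
  next
    case (Suc n)
    have "axis_vec j (int (Suc n)) = axis_vec j 1 + axis_vec j (int n)"
      by (auto simp: axis_vec_def)
    then have "norm (translate (axis_vec j (int (Suc n))) y - y)
        \<le> norm (translate (axis_vec j 1) y - y) + norm (translate (axis_vec j (int n)) y - y)"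
      by (simp only: norm_translate_sum_diff)
    with Suc show ?case
      by (simp add: distrib_right)
  qed
  show ?thesis
  proof (cases "0 \<le> n")
    case True
    then show ?thesis using nat[of "nat n"] by simp
  next
    case False
    have "axis_vec j n = - axis_vec j (int (nat (- n)))"
      using False by (auto simp: axis_vec_def)
    then show ?thesis
      using nat[of "nat (- n)"] False by (simp add: norm_translate_uminus_diff)
  qed
qed

section \<open>Almost orthogonality of the dyadic pieces\<close>

text \<open>
  The contribution of \<open>t \<in> [\<tau>, 4 \<tau>]\<close> to the kernel. It lives at distance about \<open>1 / sqrt \<tau>\<close> from the
  origin in each coordinate, has total mass bounded independently of \<open>\<tau>\<close>, and is smooth at that scale.
\<close>

definition piece_kernel :: "nat \<Rightarrow> nat \<Rightarrow> nat \<Rightarrow> real \<Rightarrow> (nat \<Rightarrow> int) \<Rightarrow> real" where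
  "piece_kernel d j k \<tau> m = (if m \<in> int_lattice d
     then ((of_int (m j))\<^sup>2 - (of_int (m k))\<^sup>2) * heat_piece d \<tau> (sq_norm d m) else 0)"

lemma sq_norm_minus_axis:
  assumes "j \<in> {1..d}"
  shows "sq_norm d (m - axis_vec j 1) = sq_norm d m - 2 * of_int (m j) + 1"
proof -
  have "sq_norm d v = (of_int (v j))\<^sup>2 + (\<Sum>i\<in>{1..d} - {j}. (of_int (v i))\<^sup>2)" for v
    unfolding sq_norm_def using assms by (subst sum.remove) auto
  then show ?thesis
    by (simp add: axis_vec_def power2_diff)
qed

lemma two_coordinates_le_sq_norm:
  assumes "j \<in> {1..d}" "k \<in> {1..d}" "j \<noteq> k"
  shows "(of_int (m j))\<^sup>2 + (of_int (m k))\<^sup>2 \<le> sq_norm d m"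
proof -
  have "(\<Sum>i\<in>{j, k}. (real_of_int (m i))\<^sup>2) \<le> sq_norm d m"
    unfolding sq_norm_def using assms by (intro sum_mono2) auto
  then show ?thesis using assms by simp
qed

lemma coordinate_le_sqrt_sq_norm:
  assumes "j \<in> {1..d}"
  shows "\<bar>real_of_int (m j)\<bar> \<le> sqrt (sq_norm d m)"
proof (rule real_le_rsqrt)
  have "(\<Sum>i\<in>{j}. (real_of_int (m i))\<^sup>2) \<le> sq_norm d m"
    unfolding sq_norm_def using assms by (intro sum_mono2) auto
  then show "\<bar>real_of_int (m j)\<bar>\<^sup>2 \<le> sq_norm d m" by simp
qed

lemma mult_exp_neg_le: "0 < \<tau> \<Longrightarrow> r * exp (- \<tau> * r) \<le> 1 / \<tau>" for r \<tau> :: real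
proof -
  assume "0 < \<tau>"
  have "\<tau> * r \<le> exp (\<tau> * r)" by (rule le_exp_self)
  then have "(\<tau> * r) * exp (- \<tau> * r) \<le> exp (\<tau> * r) * exp (- \<tau> * r)"
    by (intro mult_right_mono) auto
  then show ?thesis using \<open>0 < \<tau>\<close> by (simp add: exp_add[symmetric] field_simps)
qed

lemma sqrt_mult_exp_neg_le:
  assumes "0 < \<tau>" "0 \<le> r"
  shows "sqrt r * exp (- \<tau> * r) \<le> 1 / sqrt \<tau>"
proof -
  define y where "y = sqrt (\<tau> * r)"
  have y: "y\<^sup>2 = \<tau> * r" "0 \<le> y" using assms by (auto simp: y_def)
  have "0 \<le> (y - 1)\<^sup>2" by simp
  then have "2 * y \<le> 1 + y\<^sup>2" by (simp add: power2_diff)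
  also have "\<dots> \<le> exp (y\<^sup>2)" by (rule exp_ge_add_one_self)
  finally have "y \<le> exp (\<tau> * r)" using y by simp
  then have "y * exp (- \<tau> * r) \<le> exp (\<tau> * r) * exp (- \<tau> * r)"
    by (intro mult_right_mono) auto
  then have "y * exp (- \<tau> * r) \<le> 1" by (simp add: exp_add[symmetric])
  moreover have "y = sqrt \<tau> * sqrt r" by (simp add: y_def real_sqrt_mult)
  ultimately show ?thesis using assms by (simp add: field_simps)
qed

text \<open>
  Since \<open>\<pi> > 3\<close>, three copies of the weaker Gaussian are available: two absorb the polynomial factors
  of the kernel and its increments, and the third one remains to be summed over the lattice.
\<close>

lemma exp_pi_le_cube:
  assumes "0 < \<tau>" "0 \<le> r"
  shows "exp (- pi * \<tau> * r) \<le> exp (- \<tau> * r) * exp (- \<tau> * r) * exp (- \<tau> * r)"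
proof -
  have "3 * (\<tau> * r) \<le> pi * (\<tau> * r)"
    using pi_gt3 assms by (intro mult_right_mono) auto
  then show ?thesis by (simp add: exp_add[symmetric] mult_ac)
qed

lemma abs_diff_squares_le: "\<bar>a\<^sup>2 - b\<^sup>2\<bar> \<le> a\<^sup>2 + b\<^sup>2" for a b :: real
  by (simp add: abs_le_iff)

context
  fixes d j k :: nat and \<tau> :: real
  assumes jk: "j \<in> {1..d}" "k \<in> {1..d}" "j \<noteq> k" and \<tau>: "0 < \<tau>" "\<tau> \<le> 1"
begin

lemma sqrt_tau: "0 < sqrt \<tau>" "1 \<le> 1 / sqrt \<tau>" "1 / \<tau> = (1 / sqrt \<tau>) * (1 / sqrt \<tau>)" "1 \<le> 1 / \<tau>"
  using \<tau> by auto

lemma abs_piece_kernel_le: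
  "\<bar>piece_kernel d j k \<tau> m\<bar> \<le> piece_scale d \<tau> * (1 / \<tau>) * exp (- \<tau> * sq_norm d m)"
  "\<bar>piece_kernel d j k \<tau> m\<bar> * sqrt (sq_norm d m)
    \<le> piece_scale d \<tau> * (1 / \<tau>) * (1 / sqrt \<tau>) * exp (- \<tau> * sq_norm d m)"
proof -
  let ?r = "sq_norm d m" let ?E = "exp (- \<tau> * ?r)" let ?P = "piece_scale d \<tau>"
  note r = sq_norm_nonneg[of d m]
  have P: "0 \<le> ?P" using \<tau> by (simp add: piece_scale_nonneg)
  have E: "0 \<le> ?E" "?E \<le> 1" using \<tau> r by auto
  have "\<bar>piece_kernel d j k \<tau> m\<bar> \<le> \<bar>(of_int (m j))\<^sup>2 - (of_int (m k))\<^sup>2\<bar> * heat_piece d \<tau> ?r"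
    using heat_piece_nonneg[OF \<tau>(1), of d ?r] by (simp add: piece_kernel_def abs_mult)
  also have "\<dots> \<le> ?r * (?P * (?E * ?E * ?E))"
  proof (intro mult_mono)
    show "\<bar>(real_of_int (m j))\<^sup>2 - (of_int (m k))\<^sup>2\<bar> \<le> ?r"
      using abs_diff_squares_le two_coordinates_le_sq_norm[OF jk] by (meson order_trans)
    have "heat_piece d \<tau> ?r \<le> ?P * exp (- pi * \<tau> * ?r)"
      by (rule heat_piece_le[OF \<tau>(1) r])
    also have "\<dots> \<le> ?P * (?E * ?E * ?E)"
      by (intro mult_left_mono exp_pi_le_cube \<tau> r P)
    finally show "heat_piece d \<tau> ?r \<le> ?P * (?E * ?E * ?E)" .
  qed (use r heat_piece_nonneg[OF \<tau>(1)] in auto)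
  finally have main: "\<bar>piece_kernel d j k \<tau> m\<bar> \<le> ?P * (?r * ?E) * (?E * ?E)"
    by (simp add: mult_ac)
  have rE: "?r * ?E \<le> 1 / \<tau>" "sqrt ?r * ?E \<le> 1 / sqrt \<tau>"
    by (rule mult_exp_neg_le sqrt_mult_exp_neg_le; use \<tau> r in simp)+
  have "?P * (?r * ?E) * (?E * ?E) \<le> ?P * (1 / \<tau>) * (1 * ?E)"
    using P r E rE \<tau> by (intro mult_mono) auto
  with main show "\<bar>piece_kernel d j k \<tau> m\<bar> \<le> ?P * (1 / \<tau>) * ?E" by simp
  have "\<bar>piece_kernel d j k \<tau> m\<bar> * sqrt ?r \<le> ?P * (?r * ?E) * (?E * ?E) * sqrt ?r"
    using r by (intro mult_right_mono main) auto
  also have "\<dots> = ?P * (?r * ?E) * (sqrt ?r * ?E) * ?E"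
    by (simp add: mult_ac)
  also have "\<dots> \<le> ?P * (1 / \<tau>) * (1 / sqrt \<tau>) * ?E"
    using P r E rE \<tau> by (intro mult_mono) auto
  finally show "\<bar>piece_kernel d j k \<tau> m\<bar> * sqrt ?r \<le> ?P * (1 / \<tau>) * (1 / sqrt \<tau>) * ?E" .
qed

text \<open>
  Smoothness: a unit step changes the kernel by a factor \<open>sqrt \<tau>\<close> less than the size bound
  \<open>abs_piece_kernel_le\<close>. The increment splits into the change of \<open>m\<^sub>j\<^sup>2\<close> and the change of the Gaussian; the
  squared norm changes by at most \<open>2 |m| + 1\<close>. The constant comes from \<open>3 + 48 \<pi> < 200\<close>.
\<close>

lemma abs_piece_kernel_diff_le:
  defines "m' \<equiv> \<lambda>m. m - axis_vec j 1"
  shows "\<bar>piece_kernel d j k \<tau> (m' m) - piece_kernel d j k \<tau> m\<bar>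
    \<le> 200 * piece_scale d \<tau> * (1 / sqrt \<tau>) * (exp (- \<tau> * sq_norm d m) + exp (- \<tau> * sq_norm d (m' m)))"
proof (cases "m \<in> int_lattice d")
  case False
  then have "m' m \<notin> int_lattice d"
    using axis_vec_in_lattice[OF jk(1), of 1] int_lattice_add[of "m' m" d "axis_vec j 1"] by (auto simp: m'_def)
  with False show ?thesis
    using \<tau> by (simp add: piece_kernel_def piece_scale_nonneg)
next
  case True
  then have True': "m' m \<in> int_lattice d"
    using axis_vec_in_lattice[OF jk(1), of 1] by (simp add: m'_def int_lattice_diff)
  define r where "r = sq_norm d m"
  define r' where "r' = sq_norm d (m' m)"
  define a where "a = real_of_int (m j)"
  define b where "b = real_of_int (m k)"
  define g where "g = heat_piece d \<tau>"
  define P where "P = piece_scale d \<tau>"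
  define E where "E = exp (- \<tau> * r)"
  define E' where "E' = exp (- \<tau> * r')"
  define s where "s = 1 / sqrt \<tau>"
  have P: "0 \<le> P" using \<tau> by (simp add: P_def piece_scale_nonneg)
  have r: "0 \<le> r" "0 \<le> r'" by (auto simp: r_def r'_def sq_norm_nonneg)
  have s: "1 \<le> s" "0 \<le> s" "1 / \<tau> = s * s" "1 \<le> s * s" "\<tau> * (s * s) = 1"
    using sqrt_tau \<tau> by (auto simp: s_def)
  have E: "0 \<le> E" "E \<le> 1" "0 \<le> E'" "E' \<le> 1"
    using \<tau> r by (auto simp: E_def E'_def)
  have r'_eq: "r' = r - 2 * a + 1"
    unfolding r'_def r_def a_def m'_def by (rule sq_norm_minus_axis[OF jk(1)])
  have coord: "real_of_int (m' m j) = a - 1" "real_of_int (m' m k) = b"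
    using jk by (auto simp: m'_def axis_vec_def a_def b_def)
  have ab: "a\<^sup>2 + b\<^sup>2 \<le> r" "(a - 1)\<^sup>2 + b\<^sup>2 \<le> r'"
    using two_coordinates_le_sq_norm[OF jk, of m] two_coordinates_le_sq_norm[OF jk, of "m' m"]
    unfolding coord by (auto simp: r_def r'_def a_def b_def)
  have sqrts: "\<bar>a\<bar> \<le> sqrt r" "\<bar>a - 1\<bar> \<le> sqrt r'"
    using coordinate_le_sqrt_sq_norm[OF jk(1), of m] coordinate_le_sqrt_sq_norm[OF jk(1), of "m' m"]
    unfolding coord by (auto simp: r_def r'_def a_def)
  have g: "0 \<le> g r'" "g r' \<le> P * (E' * E' * E')"
    "\<bar>g r' - g r\<bar> \<le> 4 * pi * \<tau> * \<bar>r' - r\<bar> * P * (E * E * E + E' * E' * E')"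
  proof -
    have cube: "exp (- pi * \<tau> * r) \<le> E * E * E" "exp (- pi * \<tau> * r') \<le> E' * E' * E'"
      unfolding E_def E'_def by (rule exp_pi_le_cube[OF \<tau>(1)]; use r in simp)+
    show "0 \<le> g r'" unfolding g_def by (rule heat_piece_nonneg[OF \<tau>(1)])
    show "g r' \<le> P * (E' * E' * E')"
      using heat_piece_le[OF \<tau>(1) r(2), of d] mult_left_mono[OF cube(2) P]
      unfolding g_def P_def by linarith
    have "\<bar>g r' - g r\<bar> \<le> 4 * pi * \<tau> * \<bar>r' - r\<bar> * P * (exp (- pi * \<tau> * r) + exp (- pi * \<tau> * r'))"
      unfolding g_def P_def by (rule heat_piece_diff_le[OF \<tau>(1) r])
    also have "\<dots> \<le> 4 * pi * \<tau> * \<bar>r' - r\<bar> * P * (E * E * E + E' * E' * E')"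
      using \<tau> P by (intro mult_left_mono add_mono cube) auto
    finally show "\<bar>g r' - g r\<bar> \<le> 4 * pi * \<tau> * \<bar>r' - r\<bar> * P * (E * E * E + E' * E' * E')" .
  qed
  have rr: "\<bar>r' - r\<bar> \<le> 2 * sqrt r + 1" "\<bar>r' - r\<bar> \<le> 2 * sqrt r' + 1"
    using sqrts unfolding r'_eq by linarith+
  have absorb: "(2 * sqrt x + 1) * exp (- \<tau> * x) \<le> 3 * s" if "0 \<le> x" for x
  proof -
    have "exp (- \<tau> * x) \<le> 1" using \<tau> that by simp
    then have "exp (- \<tau> * x) \<le> s" using s by linarith
    moreover have "sqrt x * exp (- \<tau> * x) \<le> s"
      unfolding s_def by (rule sqrt_mult_exp_neg_le[OF \<tau>(1) that])
    ultimately show ?thesis by (simp add: algebra_simps)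
  qed
  have A: "\<bar>r' - r\<bar> * E \<le> 3 * s" "\<bar>r' - r\<bar> * E' \<le> 3 * s"
    using absorb[OF r(1)] absorb[OF r(2)] mult_right_mono[OF rr(1) E(1)] mult_right_mono[OF rr(2) E(3)]
    unfolding E_def E'_def by linarith+
  have D: "\<bar>a\<^sup>2 - b\<^sup>2\<bar> \<le> r" "\<bar>a\<^sup>2 - b\<^sup>2\<bar> \<le> 2 * r' + 2"
  proof -
    show "\<bar>a\<^sup>2 - b\<^sup>2\<bar> \<le> r" using abs_diff_squares_le ab(1) by (rule order_trans)
    have "0 \<le> (a - 2)\<^sup>2" "0 \<le> b\<^sup>2" by auto
    then have "a\<^sup>2 + b\<^sup>2 \<le> 2 * ((a - 1)\<^sup>2 + b\<^sup>2) + 2"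
      by (simp add: power2_diff)
    also have "\<dots> \<le> 2 * r' + 2"
      using ab(2) by (intro add_right_mono mult_left_mono) auto
    finally show "\<bar>a\<^sup>2 - b\<^sup>2\<bar> \<le> 2 * r' + 2"
      using abs_diff_squares_le[of a b] by (rule order_trans[rotated])
  qed
  have B: "\<bar>a\<^sup>2 - b\<^sup>2\<bar> * E \<le> s * s" "\<bar>a\<^sup>2 - b\<^sup>2\<bar> * E' \<le> 4 * (s * s)"
  proof -
    have "r * E \<le> s * s" "r' * E' \<le> s * s"
      unfolding E_def E'_def s(3)[symmetric] by (rule mult_exp_neg_le[OF \<tau>(1)])+
    moreover have "E' \<le> s * s" using E s by linarith
    ultimately show "\<bar>a\<^sup>2 - b\<^sup>2\<bar> * E \<le> s * s" "\<bar>a\<^sup>2 - b\<^sup>2\<bar> * E' \<le> 4 * (s * s)"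
      using mult_right_mono[OF D(1) E(1)] mult_right_mono[OF D(2) E(3)]
      by (auto simp: algebra_simps)
  qed
  have split: "piece_kernel d j k \<tau> (m' m) - piece_kernel d j k \<tau> m
      = ((a - 1)\<^sup>2 - a\<^sup>2) * g r' + (a\<^sup>2 - b\<^sup>2) * (g r' - g r)"
    using True True' by (simp add: piece_kernel_def coord r'_def[symmetric] r_def[symmetric]
        g_def[symmetric] a_def[symmetric] b_def[symmetric] algebra_simps)
  have "\<bar>(a - 1)\<^sup>2 - a\<^sup>2\<bar> * g r' \<le> \<bar>r' - r\<bar> * (P * (E' * E' * E'))"
  proof (rule mult_mono[OF _ g(2)])
    show "\<bar>(a - 1)\<^sup>2 - a\<^sup>2\<bar> \<le> \<bar>r' - r\<bar>" unfolding r'_eq by (simp add: power2_diff)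
  qed (use g in auto)
  also have "\<dots> = P * (\<bar>r' - r\<bar> * E') * (E' * E')" by (simp add: mult_ac)
  also have "\<dots> \<le> P * (3 * s) * (1 * E')"
    by (rule mult_mono[OF mult_left_mono[OF A(2) P] mult_right_mono[OF E(4) E(3)]]) (use P s E in auto)
  finally have T1: "\<bar>(a - 1)\<^sup>2 - a\<^sup>2\<bar> * g r' \<le> 3 * (P * s * E')" by (simp add: mult_ac)
  have "\<bar>a\<^sup>2 - b\<^sup>2\<bar> * \<bar>g r' - g r\<bar>
      \<le> \<bar>a\<^sup>2 - b\<^sup>2\<bar> * (4 * pi * \<tau> * \<bar>r' - r\<bar> * P * (E * E * E + E' * E' * E'))"
    by (intro mult_left_mono g) auto
  also have "\<dots> = 4 * pi * \<tau> * P * ((\<bar>a\<^sup>2 - b\<^sup>2\<bar> * E) * (\<bar>r' - r\<bar> * E) * E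
      + (\<bar>a\<^sup>2 - b\<^sup>2\<bar> * E') * (\<bar>r' - r\<bar> * E') * E')"
    by (simp add: algebra_simps)
  also have "\<dots> \<le> 4 * pi * \<tau> * P * ((s * s) * (3 * s) * E + (4 * (s * s)) * (3 * s) * E')"
  proof (intro mult_left_mono[OF add_mono])
    show "(\<bar>a\<^sup>2 - b\<^sup>2\<bar> * E) * (\<bar>r' - r\<bar> * E) * E \<le> (s * s) * (3 * s) * E"
      by (intro mult_right_mono[OF mult_mono[OF B(1) A(1)]]) (use s E in auto)
    show "(\<bar>a\<^sup>2 - b\<^sup>2\<bar> * E') * (\<bar>r' - r\<bar> * E') * E' \<le> (4 * (s * s)) * (3 * s) * E'"
      by (intro mult_right_mono[OF mult_mono[OF B(2) A(2)]]) (use s E in auto)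
  qed (use \<tau> P in auto)
  also have "\<dots> = pi * (12 * (P * s * E) + 48 * (P * s * E')) * (\<tau> * (s * s))"
    by (simp add: algebra_simps)
  also have "\<dots> \<le> 4 * (12 * (P * s * E) + 48 * (P * s * E'))"
    unfolding s(5) using pi_less_4 P s E unfolding mult_1_right by (intro mult_right_mono) auto
  finally have T2: "\<bar>a\<^sup>2 - b\<^sup>2\<bar> * \<bar>g r' - g r\<bar> \<le> 48 * (P * s * E) + 192 * (P * s * E')" by simp
  have "\<bar>piece_kernel d j k \<tau> (m' m) - piece_kernel d j k \<tau> m\<bar>
      \<le> \<bar>(a - 1)\<^sup>2 - a\<^sup>2\<bar> * g r' + \<bar>a\<^sup>2 - b\<^sup>2\<bar> * \<bar>g r' - g r\<bar>"
    unfolding split using g(1) abs_triangle_ineq[of "((a - 1)\<^sup>2 - a\<^sup>2) * g r'" "(a\<^sup>2 - b\<^sup>2) * (g r' - g r)"]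
    by (simp add: abs_mult)
  also have "\<dots> \<le> 48 * (P * s * E) + 195 * (P * s * E')"
    using T1 T2 by simp
  also have "\<dots> \<le> 200 * (P * s * E) + 200 * (P * s * E')"
    using P s E by (intro add_mono mult_right_mono) auto
  finally show ?thesis
    unfolding P_def s_def E_def E'_def r_def r'_def by (simp only: distrib_left mult.assoc)
qed


text \<open>
  The powers of \<open>sqrt \<tau>\<close> in the two factors cancel coordinate by coordinate, \<open>2 sqrt \<tau> \<cdot> 9 / sqrt \<tau> = 18\<close>, which is
  the origin of the exponential \<open>18 ^ d\<close> below.
\<close>

lemma piece_scale_gauss_sum:
  "piece_scale d \<tau> * gauss_sum \<tau> ^ d \<le> 12 * \<tau> * 18 ^ d"
proof -
  have "piece_scale d \<tau> * gauss_sum \<tau> ^ d \<le> piece_scale d \<tau> * (9 / sqrt \<tau>) ^ d"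
    using \<tau> by (intro mult_left_mono power_mono gauss_sum_le_small gauss_sum_nonneg piece_scale_nonneg) auto
  also have "\<dots> = 3 * pi * \<tau> * ((2 * sqrt \<tau>) * (9 / sqrt \<tau>)) ^ d"
    unfolding piece_scale_def by (simp only: power_mult_distrib mult.assoc)
  also have "(2 * sqrt \<tau>) * (9 / sqrt \<tau>) = 18"
    using \<tau> by simp
  also have "3 * pi * \<tau> * 18 ^ d \<le> 3 * 4 * \<tau> * 18 ^ d"
    using pi_less_4 \<tau> by (intro mult_right_mono mult_left_mono) auto
  finally show ?thesis by simp
qed

lemma summable_exp_sq_norm: "(\<lambda>m. c * exp (- \<tau> * sq_norm d m)) summable_on int_lattice d"
  by (intro summable_on_cmult_right has_sum_imp_summable[OF lattice_gauss_sum] \<tau>)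

lemma infsum_exp_sq_norm:
  "(\<Sum>\<^sub>\<infinity>m\<in>int_lattice d. c * exp (- \<tau> * sq_norm d m)) = c * gauss_sum \<tau> ^ d"
  by (rule infsumI, rule has_sum_cmult_right, rule lattice_gauss_sum, rule \<tau>)

lemma piece_kernel_l1: "in_l1 (piece_kernel d j k \<tau>)"
  by (rule l1_boundI(1)[OF summable_exp_sq_norm order_refl abs_piece_kernel_le(1)])
     (auto simp: piece_kernel_def)

lemma piece_kernel_moment:
  assumes l: "l \<in> {1..d}"
  shows "in_l1 (\<lambda>m. piece_kernel d j k \<tau> m * of_int (m l))"
    and "l1_norm (\<lambda>m. piece_kernel d j k \<tau> m * of_int (m l)) \<le> 12 * 18 ^ d * (1 / sqrt \<tau>)"
proof -
  let ?c = "piece_scale d \<tau> * (1 / \<tau>) * (1 / sqrt \<tau>)"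
  have "infsum (\<lambda>m. ?c * exp (- \<tau> * sq_norm d m)) (int_lattice d)
      = (1 / \<tau>) * (1 / sqrt \<tau>) * (piece_scale d \<tau> * gauss_sum \<tau> ^ d)"
    unfolding infsum_exp_sq_norm by (simp add: mult_ac)
  also have "\<dots> \<le> (1 / \<tau>) * (1 / sqrt \<tau>) * (12 * \<tau> * 18 ^ d)"
    using \<tau> by (intro mult_left_mono piece_scale_gauss_sum) auto
  also have "\<dots> = 12 * 18 ^ d * (1 / sqrt \<tau>)"
    using \<tau> by simp
  finally have le: "infsum (\<lambda>m. ?c * exp (- \<tau> * sq_norm d m)) (int_lattice d) \<le> 12 * 18 ^ d * (1 / sqrt \<tau>)" .
  have dom: "\<bar>piece_kernel d j k \<tau> m * of_int (m l)\<bar> \<le> ?c * exp (- \<tau> * sq_norm d m)" for m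
  proof -
    have "\<bar>piece_kernel d j k \<tau> m * of_int (m l)\<bar> \<le> \<bar>piece_kernel d j k \<tau> m\<bar> * sqrt (sq_norm d m)"
      unfolding abs_mult by (intro mult_left_mono coordinate_le_sqrt_sq_norm l) auto
    then show ?thesis using abs_piece_kernel_le(2)[of m] by linarith
  qed
  show "in_l1 (\<lambda>m. piece_kernel d j k \<tau> m * of_int (m l))"
    "l1_norm (\<lambda>m. piece_kernel d j k \<tau> m * of_int (m l)) \<le> 12 * 18 ^ d * (1 / sqrt \<tau>)"
    by (rule l1_boundI[OF summable_exp_sq_norm le dom]; simp add: piece_kernel_def)+
qed

lemma translate_conv_piece_first:
  "norm (translate (axis_vec j 1) (conv_op (piece_kernel d j k \<tau>) x) - conv_op (piece_kernel d j k \<tau>) x)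
    \<le> 4800 * 18 ^ d * sqrt \<tau> * norm x"
proof -
  let ?a = "piece_kernel d j k \<tau>" let ?u = "axis_vec j 1"
  let ?c = "200 * piece_scale d \<tau> * (1 / sqrt \<tau>)"
  let ?b = "\<lambda>m. ?c * exp (- \<tau> * sq_norm d m) + ?c * exp (- \<tau> * sq_norm d (m - ?u))"
  note u = axis_vec_in_lattice[OF jk(1), of 1]
  have h: "((\<lambda>m. ?c * exp (- \<tau> * sq_norm d m)) has_sum ?c * gauss_sum \<tau> ^ d) (int_lattice d)"
    by (intro has_sum_cmult_right lattice_gauss_sum \<tau>)
  have "bij_betw (\<lambda>m. m - ?u) (int_lattice d) (int_lattice d)"
    by (rule bij_betw_byWitness[where f' = "\<lambda>m. m + ?u"]) (auto simp: int_lattice_diff int_lattice_add u)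
  then have h': "((\<lambda>m. ?c * exp (- \<tau> * sq_norm d (m - ?u))) has_sum ?c * gauss_sum \<tau> ^ d) (int_lattice d)"
    by (rule iffD2[OF has_sum_reindex_bij_betw[where f = "\<lambda>m. ?c * exp (- \<tau> * sq_norm d m)"] h])
  have hb: "(?b has_sum (?c * gauss_sum \<tau> ^ d + ?c * gauss_sum \<tau> ^ d)) (int_lattice d)"
    by (intro has_sum_add h h')
  have "?c * gauss_sum \<tau> ^ d + ?c * gauss_sum \<tau> ^ d = 400 * (1 / sqrt \<tau>) * (piece_scale d \<tau> * gauss_sum \<tau> ^ d)"
    by simp
  also have "\<dots> \<le> 400 * (1 / sqrt \<tau>) * (12 * \<tau> * 18 ^ d)"
    using \<tau> by (intro mult_left_mono piece_scale_gauss_sum) auto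
  also have "\<dots> = 4800 * 18 ^ d * sqrt \<tau>"
    using \<tau> by (simp add: real_div_sqrt mult.assoc) (simp add: field_simps)
  finally have le: "infsum ?b (int_lattice d) \<le> 4800 * 18 ^ d * sqrt \<tau>"
    unfolding infsumI[OF hb] .
  have dom: "\<bar>?a (m - ?u) - ?a m\<bar> \<le> ?b m" for m
    using abs_piece_kernel_diff_le[of m] by (simp add: algebra_simps)
  have off: "?a (m - ?u) - ?a m = 0" if "m \<notin> int_lattice d" for m
    using that int_lattice_add[OF _ u, of "m - ?u"] by (auto simp: piece_kernel_def)
  note l1 = l1_boundI[OF has_sum_imp_summable[OF hb] le dom off]
  have "translate ?u (conv_op ?a x) - conv_op ?a x = conv_op (\<lambda>m. ?a (m - ?u) - ?a m) x"
    using conv_op_diff_kernel[OF in_l1_shift[OF piece_kernel_l1] piece_kernel_l1 l1(1)]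
    by (simp add: translate_conv_op_kernel[OF piece_kernel_l1])
  then have "norm (translate ?u (conv_op ?a x) - conv_op ?a x) \<le> l1_norm (\<lambda>m. ?a (m - ?u) - ?a m) * norm x"
    using norm_conv_op_le[OF l1(1)] by simp
  also have "\<dots> \<le> 4800 * 18 ^ d * sqrt \<tau> * norm x"
    by (intro mult_right_mono l1(2) norm_ge_zero)
  finally show ?thesis .
qed

end

lemma piece_kernel_antisym: "piece_kernel d k j \<tau> m = - piece_kernel d j k \<tau> m"
  by (simp add: piece_kernel_def algebra_simps)

lemma conv_op_uminus_kernel: "conv_op (\<lambda>m. - a m) x = - conv_op a x"
  by (simp add: conv_op_def infsum_uminus)

lemma translate_conv_piece:
  assumes jk: "j \<in> {1..d}" "k \<in> {1..d}" "j \<noteq> k" and \<tau>: "0 < \<tau>" "\<tau> \<le> 1" and l: "l \<in> {j, k}"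
  shows "norm (translate (axis_vec l 1) (conv_op (piece_kernel d j k \<tau>) x) - conv_op (piece_kernel d j k \<tau>) x)
    \<le> 4800 * 18 ^ d * sqrt \<tau> * norm x"
proof (cases "l = j")
  case True
  then show ?thesis using translate_conv_piece_first[OF jk \<tau>] by simp
next
  case False
  then have [simp]: "l = k" using l by simp
  have "piece_kernel d k j \<tau> = (\<lambda>m. - piece_kernel d j k \<tau> m)"
    by (rule ext) (rule piece_kernel_antisym)
  then have [simp]: "conv_op (piece_kernel d k j \<tau>) x = - conv_op (piece_kernel d j k \<tau>) x"
    by (simp add: conv_op_uminus_kernel)
  have "translate u (- y) - - y = - (translate u y - y)" for u and y :: "(nat \<Rightarrow> int) ell2"
    using bounded_linear.linear[OF bounded_linear_translate, of u] by (simp add: linear_neg)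
  then show ?thesis
    using translate_conv_piece_first[OF jk(2,1) jk(3)[symmetric] \<tau>, of x] by (simp add: norm_minus_commute)
qed

definition swap_coords :: "nat \<Rightarrow> nat \<Rightarrow> (nat \<Rightarrow> int) \<Rightarrow> (nat \<Rightarrow> int)" where
  "swap_coords j k m = m(j := m k, k := m j)"

lemma bij_swap_coords: "bij (swap_coords j k)"
  by (rule bij_betw_byWitness[where f' = "swap_coords j k"]) (auto simp: swap_coords_def fun_eq_iff)

lemma sq_norm_swap_coords:
  assumes "j \<in> {1..d}" "k \<in> {1..d}"
  shows "sq_norm d (swap_coords j k m) = sq_norm d m"
proof (cases "j = k")
  case False
  have split: "sq_norm d v = (\<Sum>i\<in>{1..d} - {j, k}. (of_int (v i))\<^sup>2) + (\<Sum>i\<in>{j, k}. (of_int (v i))\<^sup>2)" for v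
    unfolding sq_norm_def using assms by (intro sum.subset_diff) auto
  have "(\<Sum>i\<in>{1..d} - {j, k}. (of_int (swap_coords j k m i))\<^sup>2) = (\<Sum>i\<in>{1..d} - {j, k}. (real_of_int (m i))\<^sup>2)"
    by (rule sum.cong) (auto simp: swap_coords_def)
  then show ?thesis
    unfolding split using False by (simp add: swap_coords_def)
qed (simp add: swap_coords_def)

lemma piece_kernel_swap_coords:
  assumes "j \<in> {1..d}" "k \<in> {1..d}" "j \<noteq> k"
  shows "piece_kernel d j k \<tau> (swap_coords j k m) = - piece_kernel d j k \<tau> m"
proof -
  have "swap_coords j k m \<in> int_lattice d \<longleftrightarrow> m \<in> int_lattice d"
    using assms by (auto simp: swap_coords_def int_lattice_def)
  then show ?thesis
    using assms by (simp add: piece_kernel_def sq_norm_swap_coords) (simp add: swap_coords_def algebra_simps)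
qed

text \<open>
  Exchanging the coordinates \<open>j\<close> and \<open>k\<close> reverses the sign of the kernel and keeps the vector in which both
  coordinates are erased. The second translate therefore sums to zero, and subtracting it leaves a
  difference of translates that only moves in two coordinates.
\<close>

lemma conv_piece_cancellation:
  assumes jk: "j \<in> {1..d}" "k \<in> {1..d}" "j \<noteq> k" and \<tau>: "0 < \<tau>" "\<tau> \<le> 1"
  shows "conv_op (piece_kernel d j k \<tau>) y
    = (\<Sum>\<^sub>\<infinity>m. piece_kernel d j k \<tau> m *\<^sub>R (translate m y - translate (m(j := 0, k := 0)) y))"
proof -
  let ?a = "piece_kernel d j k \<tau>"
  let ?p = "\<lambda>m :: nat \<Rightarrow> int. m(j := 0, k := 0)"
  let ?Z = "\<Sum>\<^sub>\<infinity>m. ?a m *\<^sub>R translate (?p m) y"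
  note l1 = piece_kernel_l1[OF jk \<tau>]
  have s: "(\<lambda>m. ?a m *\<^sub>R translate (?p m) y) summable_on UNIV"
    by (rule abs_summable_summable, rule abs_summable_scaleR_bounded[OF l1, of _ "norm y"]) simp
  have "?Z
      = (\<Sum>\<^sub>\<infinity>m. ?a (swap_coords j k m) *\<^sub>R translate (?p (swap_coords j k m)) y)"
    by (rule infsum_reindex_bij_betw[OF bij_swap_coords, symmetric])
  also have "\<dots> = (\<Sum>\<^sub>\<infinity>m. - (?a m *\<^sub>R translate (?p m) y))"
  proof (rule infsum_cong)
    fix m
    have "?p (swap_coords j k m) = ?p m" by (auto simp: swap_coords_def fun_eq_iff)
    then show "?a (swap_coords j k m) *\<^sub>R translate (?p (swap_coords j k m)) y = - (?a m *\<^sub>R translate (?p m) y)"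
      by (simp only: piece_kernel_swap_coords[OF jk] scaleR_minus_left)
  qed
  also have "\<dots> = - ?Z"
    by (rule infsum_uminus)
  finally have "2 *\<^sub>R ?Z = 0"
    by (simp only: scaleR_2 eq_neg_iff_add_eq_0[symmetric])
  then have 0: "?Z = 0"
    by (simp only: scaleR_eq_0_iff) simp
  have "conv_op ?a y = (\<Sum>\<^sub>\<infinity>m. ?a m *\<^sub>R translate m y + - (?a m *\<^sub>R translate (?p m) y))"
    unfolding conv_op_def
  proof (rule infsumI[symmetric])
    have "((\<lambda>m. - (?a m *\<^sub>R translate (?p m) y)) has_sum 0) UNIV"
      using has_sum_infsum[OF s] by (simp only: has_sum_uminus 0 minus_zero)
    then have "((\<lambda>m. ?a m *\<^sub>R translate m y + - (?a m *\<^sub>R translate (?p m) y)) has_sum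
        ((\<Sum>\<^sub>\<infinity>m. ?a m *\<^sub>R translate m y) + 0)) UNIV"
      by (intro has_sum_add has_sum_infsum summable_conv_op l1)
    then show "((\<lambda>m. ?a m *\<^sub>R translate m y + - (?a m *\<^sub>R translate (?p m) y)) has_sum
        (\<Sum>\<^sub>\<infinity>m. ?a m *\<^sub>R translate m y)) UNIV"
      by (simp only: add_0_right)
  qed
  then show ?thesis
    by (simp add: scaleR_right_diff_distrib)
qed

text \<open>
  The kernel at \<open>\<sigma>\<close> supplies cancellation and first moments of order \<open>1 / sqrt \<sigma>\<close>, the kernel at \<open>\<tau>\<close> supplies
  increments of order \<open>sqrt \<tau>\<close> per unit step. This is a gain when \<open>\<tau>\<close> is the coarser scale, \<open>\<tau> < \<sigma>\<close>. The square \<open>340\<^sup>2 = 115600\<close> dominates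
  \<open>2 \<cdot> 12 \<cdot> 4800\<close>.
\<close>

lemma conv_piece_pair:
  assumes jk: "j \<in> {1..d}" "k \<in> {1..d}" "j \<noteq> k"
    and \<sigma>: "0 < \<sigma>" "\<sigma> \<le> 1" and \<tau>: "0 < \<tau>" "\<tau> \<le> 1"
  shows "norm (conv_op (piece_kernel d j k \<sigma>) (conv_op (piece_kernel d j k \<tau>) x))
    \<le> (340 * 18 ^ d)\<^sup>2 * (sqrt \<tau> / sqrt \<sigma>) * norm x"
proof -
  let ?a = "piece_kernel d j k \<sigma>"
  let ?p = "\<lambda>m :: nat \<Rightarrow> int. m(j := 0, k := 0)"
  define y where "y = conv_op (piece_kernel d j k \<tau>) x"
  define D where "D = 4800 * 18 ^ d * sqrt \<tau> * norm x"
  have step: "norm (translate (axis_vec l n) y - y) \<le> \<bar>of_int n\<bar> * D" if "l \<in> {j, k}" for l n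
    using norm_translate_axis_diff[of l n y] mult_left_mono[OF translate_conv_piece[OF jk \<tau> that, of x], of "\<bar>of_int n\<bar>"]
    by (simp add: y_def D_def)
  have diff: "norm (translate m y - translate (?p m) y) \<le> (\<bar>of_int (m j)\<bar> + \<bar>of_int (m k)\<bar>) * D" for m
  proof -
    interpret T: bounded_linear "translate (?p m)" by (rule bounded_linear_translate)
    have "m = ?p m + (axis_vec j (m j) + axis_vec k (m k))"
      using jk by (auto simp: axis_vec_def fun_eq_iff)
    then have "translate m y = translate (?p m) (translate (axis_vec j (m j) + axis_vec k (m k)) y)"
      by (metis translate_translate)
    then have "translate m y - translate (?p m) y
        = translate (?p m) (translate (axis_vec j (m j) + axis_vec k (m k)) y - y)"
      by (simp only: T.diff)
    then have "norm (translate m y - translate (?p m) y)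
        = norm (translate (axis_vec j (m j) + axis_vec k (m k)) y - y)"
      by (simp only: norm_translate)
    also have "\<dots> \<le> \<bar>of_int (m j)\<bar> * D + \<bar>of_int (m k)\<bar> * D"
      by (intro order_trans[OF norm_translate_sum_diff] add_mono step) auto
    finally show ?thesis by (simp add: distrib_right)
  qed
  let ?Mj = "\<lambda>m. ?a m * of_int (m j)" and ?Mk = "\<lambda>m. ?a m * of_int (m k)"
  note Mj = piece_kernel_moment[OF jk \<sigma> jk(1)] and Mk = piece_kernel_moment[OF jk \<sigma> jk(2)]
  have hs: "((\<lambda>m. \<bar>?Mj m\<bar> * D + \<bar>?Mk m\<bar> * D) has_sum (l1_norm ?Mj * D + l1_norm ?Mk * D)) UNIV"
    using Mj(1) Mk(1) unfolding l1_norm_def in_l1_def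
    by (intro has_sum_add has_sum_cmult_left has_sum_infsum)
  have le: "norm (?a m *\<^sub>R (translate m y - translate (?p m) y)) \<le> \<bar>?Mj m\<bar> * D + \<bar>?Mk m\<bar> * D" for m
  proof -
    have "norm (?a m *\<^sub>R (translate m y - translate (?p m) y)) \<le> \<bar>?a m\<bar> * ((\<bar>of_int (m j)\<bar> + \<bar>of_int (m k)\<bar>) * D)"
      unfolding norm_scaleR by (intro mult_left_mono diff) simp
    then show ?thesis by (simp only: abs_mult distrib_left distrib_right mult_ac)
  qed
  have abs: "(\<lambda>m. norm (?a m *\<^sub>R (translate m y - translate (?p m) y))) summable_on UNIV"
    by (rule summable_on_comparison_test[OF has_sum_imp_summable[OF hs]]) (use le in auto)
  have D: "0 \<le> D" using \<tau> by (simp add: D_def)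
  have "norm (conv_op ?a y) \<le> l1_norm ?Mj * D + l1_norm ?Mk * D"
    unfolding conv_piece_cancellation[OF jk \<sigma>]
    by (rule norm_infsum_le[OF has_sum_infsum[OF abs_summable_summable[OF abs]] hs le])
  also have "\<dots> \<le> (12 * 18 ^ d * (1 / sqrt \<sigma>)) * D + (12 * 18 ^ d * (1 / sqrt \<sigma>)) * D"
    using D by (intro add_mono mult_right_mono Mj Mk)
  also have "\<dots> = 115200 * ((18 ^ d)\<^sup>2 * (sqrt \<tau> / sqrt \<sigma>) * norm x)"
    by (simp add: D_def power2_eq_square)
  also have "\<dots> \<le> 115600 * ((18 ^ d)\<^sup>2 * (sqrt \<tau> / sqrt \<sigma>) * norm x)"
    using \<sigma> \<tau> by (intro mult_right_mono) auto
  also have "\<dots> = (340 * 18 ^ d)\<^sup>2 * (sqrt \<tau> / sqrt \<sigma>) * norm x"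
    by (simp add: power_mult_distrib)
  finally show ?thesis by (simp add: y_def)
qed

text \<open>
  A row sum for the Cotlar-Stein lemma, seen as part of the two-sided geometric series with ratio
  \<open>sqrt (1/2)\<close>.
\<close>

lemma sum_sqrt_half_abs_diff_le: "(\<Sum>j<M. sqrt (1/2) ^ nat \<bar>int i - int j\<bar>) \<le> 6"
proof -
  let ?x = "sqrt (1/2) :: real"
  have x: "?x \<le> 71 / 100"
    by (rule real_le_lsqrt) (simp_all add: power2_eq_square)
  then have "?x < 1" by linarith
  note x = x this
  have "(\<Sum>j<M. ?x ^ nat \<bar>int i - int j\<bar>) = (\<Sum>n\<in>(\<lambda>j. int i - int j) ` {..<M}. ?x ^ nat \<bar>n\<bar>)"
    by (subst sum.reindex) (auto simp: inj_on_def)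
  also have "\<dots> \<le> (1 + ?x) / (1 - ?x)"
    by (rule finite_sum_le_has_sum[OF has_sum_int_geometric]) (use x in auto)
  also have "\<dots> \<le> 6"
    using x by (simp add: field_simps)
  finally show ?thesis .
qed

lemma sq_norm_uminus: "sq_norm d (- m) = sq_norm d m"
  by (simp add: sq_norm_def)

text \<open>
  The bound is uniform in the number \<open>M\<close> of scales although each single piece has an \<open>\<ell>\<^sup>1\<close> norm that does not
  decay. For \<open>\<tau> = 4 ^ - (i + 1)\<close> the ratio of square roots in \<open>conv_piece_pair\<close> becomes \<open>2 ^ - \<bar>i - l\<bar>\<close>; pieces
  in the other order are commuted first.
\<close>

lemma conv_pieces_bound:
  assumes jk: "j \<in> {1..d}" "k \<in> {1..d}" "j \<noteq> k"
  shows "norm (\<Sum>i<M. conv_op (piece_kernel d j k ((1/4) ^ Suc i)) x) \<le> 2040 * 18 ^ d * norm x"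
proof (rule cotlar_stein[where w = "\<lambda>i j. 340 * 18 ^ d * sqrt (1/2) ^ nat \<bar>int i - int j\<bar>"])
  let ?t = "\<lambda>i. (1/4 :: real) ^ Suc i"
  let ?A = "\<lambda>i. conv_op (piece_kernel d j k (?t i))"
  have t: "0 < ?t i" "?t i \<le> 1" for i by (simp, rule power_le_one) auto
  note l1 = piece_kernel_l1[OF jk t]
  show "linear (?A i)" for i
    by (rule bounded_linear.linear[OF bounded_linear_conv_op[OF l1]])
  show "?A i x \<bullet> y = x \<bullet> ?A i y" for i x y
  proof (rule conv_op_symmetric[OF l1])
    fix m :: "nat \<Rightarrow> int"
    have "- m \<in> int_lattice d \<longleftrightarrow> m \<in> int_lattice d"
      using int_lattice_uminus[of m d] int_lattice_uminus[of "- m" d] by auto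
    then show "piece_kernel d j k (?t i) (- m) = piece_kernel d j k (?t i) m"
      by (simp add: piece_kernel_def sq_norm_uminus)
  qed
  show "norm (?A i (?A l x)) \<le> (340 * 18 ^ d * sqrt (1/2) ^ nat \<bar>int i - int l\<bar>)\<^sup>2 * norm x" for i l x
  proof -
    have st: "sqrt (?t i) = (1/2) ^ Suc i" for i
    proof (rule real_sqrt_unique)
      have "((1/2 :: real) ^ Suc i)\<^sup>2 = ((1/2)\<^sup>2) ^ Suc i"
        by (simp only: power_mult[symmetric] mult.commute)
      then show "((1/2 :: real) ^ Suc i)\<^sup>2 = ?t i" by (simp add: power2_eq_square)
    qed simp
    have main: "norm (?A i (?A l x)) \<le> (340 * 18 ^ d)\<^sup>2 * (1/2) ^ (l - i) * norm x" if "i \<le> l" for i l x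
    proof -
      have "sqrt (?t l) / sqrt (?t i) = (1/2) ^ (l - i)"
        unfolding st using that by (simp add: power_diff)
      then show ?thesis using conv_piece_pair[OF jk t t, of i l x] by (simp only:)
    qed
    have "norm (?A i (?A l x)) \<le> (340 * 18 ^ d)\<^sup>2 * (1/2) ^ nat \<bar>int i - int l\<bar> * norm x"
    proof (cases "i \<le> l")
      case True
      then have "nat \<bar>int i - int l\<bar> = l - i" by simp
      then show ?thesis using main[OF True, of x] by (simp only:)
    next
      case False
      then have "nat \<bar>int i - int l\<bar> = i - l" "l \<le> i" by auto
      then show ?thesis using main[of l i x] conv_op_commute[OF l1 l1, of i l x] by (simp only:)
    qed
    also have "(1/2 :: real) ^ n = (sqrt (1/2) ^ n)\<^sup>2" for n
    proof -
      have "(sqrt (1/2) ^ n)\<^sup>2 = ((sqrt (1/2))\<^sup>2) ^ n"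
        by (simp only: power_mult[symmetric] mult.commute)
      then show ?thesis by simp
    qed
    finally show ?thesis by (simp only: power_mult_distrib)
  qed
  show "(\<Sum>l<M. 340 * 18 ^ d * sqrt (1/2) ^ nat \<bar>int i - int l\<bar>) \<le> 2040 * 18 ^ d" for i
    using mult_left_mono[OF sum_sqrt_half_abs_diff_le[where M = M and i = i], of "340 * 18 ^ d"]
    by (simp add: sum_distrib_left mult_ac)
qed auto

section \<open>The singular part as a limit\<close>

lemma norm_ell2_mono:
  assumes "\<And>n. \<bar>ell2_apply x n\<bar> \<le> \<bar>ell2_apply y n\<bar>"
  shows "norm x \<le> norm y"
proof -
  have "(norm x)\<^sup>2 \<le> (norm y)\<^sup>2"
    unfolding norm_ell2_power2
    by (intro infsum_mono ell2_apply_summable) (use assms in \<open>simp add: abs_le_square_iff\<close>)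
  then show ?thesis by (simp add: abs_le_square_iff[symmetric])
qed

lemma bij_const_minus: "bij (\<lambda>m. n - m)" for n :: "'g::ab_group_add"
  by (rule bij_betw_byWitness[where f' = "\<lambda>m. n - m"]) auto

text \<open>
  A kernel that is only square summable may not act through \<open>conv_op\<close>. Fatou's lemma transfers the bound
  from approximating operators in two steps: for finitely supported arguments the limit in \<open>M\<close> is a
  limit of finite sums, and a general argument is exhausted by its finite restrictions.
\<close>

lemma conv_limit_bound:
  fixes a :: "'g::ab_group_add \<Rightarrow> real" and b :: "nat \<Rightarrow> 'g \<Rightarrow> real"
  assumes sq: "(\<lambda>m. (a m)\<^sup>2) summable_on UNIV"
    and lim: "\<And>m. (\<lambda>M. b M m) \<longlonglongrightarrow> a m"
    and T: "\<And>M x n. ((\<lambda>m. b M m * ell2_apply x (n - m)) has_sum ell2_apply (T M x) n) UNIV"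
    and bound: "\<And>M x. norm (T M x) \<le> B * norm x" and "0 \<le> B"
  obtains z where "norm z \<le> B * norm x"
    and "\<And>n. ((\<lambda>m. a m * ell2_apply x (n - m)) has_sum ell2_apply z n) UNIV"
proof -
  let ?sq = "\<lambda>F S c. \<Sum>n\<in>F. (\<Sum>l\<in>S. c (n - l) * ell2_apply x l)\<^sup>2"
  define g where "g = (\<lambda>n. \<Sum>\<^sub>\<infinity>m. a m * ell2_apply x (n - m))"
  have g: "((\<lambda>m. a m * ell2_apply x (n - m)) has_sum g n) UNIV" for n
    unfolding g_def
  proof (rule has_sum_infsum, rule square_summable_mult[OF sq])
    show "(\<lambda>m. (ell2_apply x (n - m))\<^sup>2) summable_on UNIV"
      using summable_on_reindex_bij_betw[OF bij_const_minus, of "\<lambda>m. (ell2_apply x m)\<^sup>2" n]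
        ell2_apply_summable[of x] by simp
  qed
  have g': "((\<lambda>l. a (n - l) * ell2_apply x l) has_sum g n) UNIV" for n
    using has_sum_reindex_bij_betw[OF bij_const_minus, of "\<lambda>m. a m * ell2_apply x (n - m)" n "g n"] g[of n]
    by simp
  have fin: "?sq F S a \<le> (B * norm x)\<^sup>2"
    if "finite F" "finite S" for F S
  proof -
    define xS where "xS = Abs_ell2 (\<lambda>l. if l \<in> S then ell2_apply x l else 0)"
    have "(\<lambda>l. (if l \<in> S then ell2_apply x l else 0)\<^sup>2) summable_on UNIV"
      by (rule finite_nonzero_values_imp_summable_on) (rule finite_subset[OF _ \<open>finite S\<close>], auto)
    then have xS: "ell2_apply xS l = (if l \<in> S then ell2_apply x l else 0)" for l
      unfolding xS_def by (subst ell2_apply_Abs) auto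
    have "norm xS \<le> norm x"
      by (rule norm_ell2_mono) (simp add: xS)
    then have nS: "norm (T M xS) \<le> B * norm x" for M
      using bound[of M xS] mult_left_mono[OF _ \<open>0 \<le> B\<close>] by (meson order_trans)
    have val: "ell2_apply (T M xS) n = (\<Sum>l\<in>S. b M (n - l) * ell2_apply x l)" for M n
    proof -
      have "((\<lambda>l. b M (n - l) * ell2_apply xS (n - (n - l))) has_sum ell2_apply (T M xS) n) UNIV"
        using has_sum_reindex_bij_betw[OF bij_const_minus, of "\<lambda>m. b M m * ell2_apply xS (n - m)"] T[of M xS n]
        by blast
      also have "?this \<longleftrightarrow> ((\<lambda>l. b M (n - l) * ell2_apply x l) has_sum ell2_apply (T M xS) n) S"
        by (rule has_sum_cong_neutral) (auto simp: xS)
      finally have "((\<lambda>l. b M (n - l) * ell2_apply x l) has_sum ell2_apply (T M xS) n) S" .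
      then show ?thesis
        using has_sum_finite[OF \<open>finite S\<close>] has_sum_unique by blast
    qed
    show ?thesis
    proof (rule LIMSEQ_le_const2)
      show "(\<lambda>M. ?sq F S (b M))
          \<longlonglongrightarrow> ?sq F S a"
        by (intro tendsto_intros lim)
      have "?sq F S (b M) \<le> (B * norm x)\<^sup>2" for M
        using finite_sum_le_norm_ell2[OF \<open>finite F\<close>, of "T M xS"] power_mono[OF nS[of M], of 2]
        by (simp add: val)
      then show "\<exists>N. \<forall>M\<ge>N. ?sq F S (b M) \<le> (B * norm x)\<^sup>2"
        by blast
    qed
  qed
  have "(\<Sum>n\<in>F. (g n)\<^sup>2) \<le> (B * norm x)\<^sup>2" if "finite F" for F
  proof (rule tendsto_upperbound)
    show "((\<lambda>S. ?sq F S a) \<longlongrightarrow> (\<Sum>n\<in>F. (g n)\<^sup>2)) (finite_subsets_at_top UNIV)"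
      using g' by (intro tendsto_intros) (simp add: has_sum_def)
    show "\<forall>\<^sub>F S in finite_subsets_at_top UNIV. ?sq F S a \<le> (B * norm x)\<^sup>2"
      using fin[OF that] by (auto intro: eventually_finite_subsets_at_top_weakI)
  qed simp
  then obtain z where "ell2_apply z = g" "norm z \<le> B * norm x"
    using ell2_of_bounded_sums[of g "B * norm x"] \<open>0 \<le> B\<close> by auto
  with that[of z] g show ?thesis by auto
qed

lemma sq_norm_ge_1:
  assumes "m \<in> int_lattice d" "m \<noteq> 0"
  shows "1 \<le> sq_norm d m"
proof -
  obtain i where i: "m i \<noteq> 0" using assms(2) by (auto simp: fun_eq_iff)
  then have "i \<in> {1..d}" using assms(1) by (auto simp: int_lattice_def)
  have "1 \<le> \<bar>real_of_int (m i)\<bar>" using i by linarith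
  then have "1 \<le> \<bar>real_of_int (m i)\<bar>\<^sup>2" by (rule one_le_power)
  also have "\<dots> \<le> (sqrt (sq_norm d m))\<^sup>2"
    by (intro power_mono coordinate_le_sqrt_sq_norm[OF \<open>i \<in> {1..d}\<close>]) simp
  finally show ?thesis by (simp add: sq_norm_nonneg)
qed

lemma sq_norm_0 [simp]: "sq_norm d 0 = 0"
  by (simp add: sq_norm_def)

lemma summable_inverse_one_plus_sq: "(\<lambda>n::int. 1 / (1 + (real_of_int n)\<^sup>2)) summable_on UNIV"
proof -
  let ?f = "\<lambda>n::int. 1 / (1 + (real_of_int n)\<^sup>2)"
  have nat: "(\<lambda>n. ?f (int n)) summable_on UNIV"
  proof (rule norm_summable_imp_summable_on)
    have "summable (\<lambda>n. inverse ((real (Suc n))\<^sup>2))"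
      using inverse_power_summable[of 2, where 'a = real] by (subst summable_Suc_iff) simp
    then have "summable (\<lambda>n. inverse ((real (Suc n))\<^sup>2) * 2)"
      by (rule summable_mult2)
    then show "summable (\<lambda>n. norm (?f (int n)))"
    proof (rule summable_comparison_test_ev[rotated], intro always_eventually allI)
      fix n
      have "(real (Suc n))\<^sup>2 \<le> 2 * (1 + (real n)\<^sup>2)"
        using zero_le_power2[of "real n - 1"] by (simp add: power2_eq_square algebra_simps)
      then show "norm (norm (?f (int n))) \<le> inverse ((real (Suc n))\<^sup>2) * 2"
        by (simp add: field_simps add_pos_nonneg)
    qed
  qed
  have "?f summable_on {0..}"
    using nat summable_on_reindex_bij_witness[of "{0..}" int nat UNIV "\<lambda>n. ?f (int n)" ?f] by auto
  moreover have "?f summable_on {..<0}"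
  proof -
    have "?f summable_on {..0}"
      using nat summable_on_reindex_bij_witness[of "{..0}" "\<lambda>n. - int n" "\<lambda>n. nat (- n)" UNIV "\<lambda>n. ?f (int n)" ?f] by auto
    then show ?thesis by (rule summable_on_subset) auto
  qed
  ultimately have "?f summable_on ({0..} \<union> {..<0})"
    by (rule summable_on_Un_disjoint) auto
  moreover have "{0..} \<union> {..<0} = (UNIV :: int set)" by auto
  ultimately show ?thesis by simp
qed

text \<open>
  For \<open>m \<noteq> 0\<close> both \<open>1\<close> and \<open>m\<^sub>i\<^sup>2\<close> are at most \<open>|m|\<^sup>2\<close>, so \<open>1 + m\<^sub>i\<^sup>2 \<le> 2 |m|\<^sup>2\<close>; multiplying over the coordinates
  dominates \<open>|m| ^ - 2d\<close> by a summable product function.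
\<close>

lemma summable_inverse_sq_norm_power:
  "(\<lambda>m. 1 / sq_norm d m ^ d) summable_on int_lattice d - {0}"
proof -
  have "(\<lambda>m. \<Prod>i=1..d. 1 / (1 + (real_of_int (m i))\<^sup>2)) summable_on int_lattice d"
    using has_sum_imp_summable[OF lattice_product_sum[of "\<lambda>_ n. 1 / (1 + (real_of_int n)\<^sup>2)" d]]
      summable_inverse_one_plus_sq by simp
  then have "(\<lambda>m. 2 ^ d * (\<Prod>i=1..d. 1 / (1 + (real_of_int (m i))\<^sup>2))) summable_on int_lattice d - {0}"
    by (intro summable_on_cmult_right) (rule summable_on_subset, auto)
  then show ?thesis
  proof (rule summable_on_comparison_test)
    fix m assume m: "m \<in> int_lattice d - {0}"
    then have r: "1 \<le> sq_norm d m" using sq_norm_ge_1 by auto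
    have "(\<Prod>i=1..d. 1 + (real_of_int (m i))\<^sup>2) \<le> (\<Prod>i=1..d. 2 * sq_norm d m)"
    proof (intro prod_mono conjI)
      fix i assume i: "i \<in> {1..d}"
      have "\<bar>real_of_int (m i)\<bar>\<^sup>2 \<le> (sqrt (sq_norm d m))\<^sup>2"
        by (intro power_mono coordinate_le_sqrt_sq_norm[OF i]) simp
      then show "1 + (real_of_int (m i))\<^sup>2 \<le> 2 * sq_norm d m" using r by simp
    qed simp
    also have "\<dots> = 2 ^ d * sq_norm d m ^ d"
      by (simp add: power_mult_distrib)
    finally have "(\<Prod>i=1..d. 1 + (real_of_int (m i))\<^sup>2) \<le> 2 ^ d * sq_norm d m ^ d" .
    moreover have "0 < (\<Prod>i=1..d. 1 + (real_of_int (m i))\<^sup>2)"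
      by (intro prod_pos) (simp add: add_pos_nonneg)
    ultimately show "1 / sq_norm d m ^ d \<le> 2 ^ d * (\<Prod>i=1..d. 1 / (1 + (real_of_int (m i))\<^sup>2))"
      using r by (simp add: prod_dividef field_simps)
    show "0 \<le> 1 / sq_norm d m ^ d" using r by simp
  qed
qed

definition riesz_kernel :: "nat \<Rightarrow> nat \<Rightarrow> (nat \<Rightarrow> int) \<Rightarrow> real" where
  "riesz_kernel d j m = (if m \<in> int_lattice d - {0} then (of_int (m j))\<^sup>2 / eucl_norm d m ^ (d + 2) else 0)"

lemma riesz_kernel_le:
  assumes "j \<in> {1..d}"
  shows "0 \<le> riesz_kernel d j m" "m \<in> int_lattice d - {0} \<Longrightarrow> (riesz_kernel d j m)\<^sup>2 \<le> 1 / sq_norm d m ^ d"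
proof -
  show "0 \<le> riesz_kernel d j m"
    by (simp add: riesz_kernel_def eucl_norm_eq_sqrt sq_norm_nonneg)
  assume m: "m \<in> int_lattice d - {0}"
  define s where "s = sqrt (sq_norm d m)"
  have r: "1 \<le> sq_norm d m" using sq_norm_ge_1 m by auto
  have s: "0 < s" "s\<^sup>2 = sq_norm d m" using r by (auto simp: s_def)
  have "(real_of_int (m j))\<^sup>2 = \<bar>real_of_int (m j)\<bar>\<^sup>2" by simp
  also have "\<dots> \<le> s\<^sup>2"
    unfolding s_def by (intro power_mono coordinate_le_sqrt_sq_norm assms) simp
  finally have "riesz_kernel d j m \<le> s\<^sup>2 / s ^ (d + 2)"
    using m s by (simp add: riesz_kernel_def eucl_norm_eq_sqrt s_def[symmetric] divide_right_mono)
  also have "\<dots> = 1 / s ^ d"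
    using s(1) by (simp only: power_add) simp
  finally have "(riesz_kernel d j m)\<^sup>2 \<le> (1 / s ^ d)\<^sup>2"
    using \<open>0 \<le> riesz_kernel d j m\<close> by (intro power_mono)
  also have "\<dots> = 1 / sq_norm d m ^ d"
    unfolding s(2)[symmetric] by (simp add: power_divide power_mult[symmetric] mult.commute)
  finally show "(riesz_kernel d j m)\<^sup>2 \<le> 1 / sq_norm d m ^ d" .
qed

text \<open>
  This makes the series in the definition of the operator converge absolutely on square summable
  functions, so that it can be split.
\<close>

lemma riesz_kernel_square_summable:
  assumes "j \<in> {1..d}"
  shows "(\<lambda>m. (riesz_kernel d j m)\<^sup>2) summable_on UNIV"
proof -
  have "(\<lambda>m. (riesz_kernel d j m)\<^sup>2) summable_on int_lattice d - {0}"
    by (rule summable_on_comparison_test[OF summable_inverse_sq_norm_power])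
       (auto intro: riesz_kernel_le(2)[OF assms])
  then show ?thesis
    by (subst summable_on_cong_neutral[where T = "int_lattice d - {0}" and g = "\<lambda>m. (riesz_kernel d j m)\<^sup>2"])
       (auto simp: riesz_kernel_def)
qed

text \<open>
  Common form of the two parts of the kernel, which differ only in their radial profile \<open>\<phi>\<close>, a function
  of the squared norm.
\<close>

definition split_kernel :: "(real \<Rightarrow> real) \<Rightarrow> nat \<Rightarrow> nat \<Rightarrow> nat \<Rightarrow> (nat \<Rightarrow> int) \<Rightarrow> real" where
  "split_kernel \<phi> d j k m = (if m \<in> int_lattice d
     then ((of_int (m j))\<^sup>2 - (of_int (m k))\<^sup>2) * \<phi> (sq_norm d m) else 0)"

abbreviation "head_kernel d \<equiv> split_kernel (heat_head d) d"
abbreviation "tail_kernel d \<equiv> split_kernel (heat_tail d) d"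

lemma riesz_kernel_diff_split:
  "riesz_const d * (riesz_kernel d j m - riesz_kernel d k m) = head_kernel d j k m + tail_kernel d j k m"
proof (cases "m \<in> int_lattice d - {0}")
  case True
  then have "0 < sq_norm d m" using sq_norm_ge_1[of m d] by auto
  from heat_head_tail[OF this] True show ?thesis
    by (simp add: riesz_kernel_def split_kernel_def eucl_norm_eq_sqrt distrib_left[symmetric]
        diff_divide_distrib[symmetric])
qed (auto simp: riesz_kernel_def split_kernel_def)

lemma abs_head_kernel_le:
  "\<bar>head_kernel d j k m\<bar> \<le> \<bar>riesz_const d * (riesz_kernel d j m - riesz_kernel d k m)\<bar>"
proof (cases "m \<in> int_lattice d - {0}")
  case True
  then have r: "0 < sq_norm d m" using sq_norm_ge_1[of m d] by auto
  let ?w = "(real_of_int (m j))\<^sup>2 - (of_int (m k))\<^sup>2"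
  have "\<bar>?w\<bar> * heat_head d (sq_norm d m) \<le> \<bar>?w\<bar> * (heat_head d (sq_norm d m) + heat_tail d (sq_norm d m))"
    using heat_tail_nonneg[OF r, of d] by (intro mult_left_mono) auto
  then show ?thesis
    unfolding riesz_kernel_diff_split using True heat_head_nonneg[of d] heat_tail_nonneg[OF r, of d]
    by (simp add: split_kernel_def distrib_left[symmetric] abs_mult)
qed (auto simp: split_kernel_def)

lemma head_kernel_square_summable:
  assumes "j \<in> {1..d}" "k \<in> {1..d}"
  shows "(\<lambda>m. (head_kernel d j k m)\<^sup>2) summable_on UNIV"
proof -
  have "(\<lambda>m. (riesz_const d * (riesz_kernel d j m + (- 1) * riesz_kernel d k m))\<^sup>2) summable_on UNIV"
    by (intro square_summable_scale square_summable_add riesz_kernel_square_summable assms)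
  then show ?thesis
  proof (rule summable_on_comparison_test)
    show "(head_kernel d j k m)\<^sup>2 \<le> (riesz_const d * (riesz_kernel d j m + (- 1) * riesz_kernel d k m))\<^sup>2" for m
      using abs_head_kernel_le[of d j k m] by (simp add: abs_le_square_iff)
  qed simp
qed

text \<open>
  The singular part is the limit of the sums of dyadic pieces, so it inherits the uniform bound of
  \<open>conv_pieces_bound\<close>.
\<close>

lemma head_kernel_op:
  assumes jk: "j \<in> {1..d}" "k \<in> {1..d}" "j \<noteq> k"
  obtains z where "norm z \<le> 2040 * 18 ^ d * norm x"
    and "\<And>n. ((\<lambda>m. head_kernel d j k m * ell2_apply x (n - m)) has_sum ell2_apply z n) UNIV"
proof (rule conv_limit_bound[OF head_kernel_square_summable[OF jk(1,2)]])
  let ?t = "\<lambda>i. (1/4 :: real) ^ Suc i"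
  have t: "0 < ?t i" "?t i \<le> 1" for i by (simp, rule power_le_one) auto
  show "(\<lambda>M. \<Sum>i<M. piece_kernel d j k (?t i) m) \<longlonglongrightarrow> head_kernel d j k m" for m
    using tendsto_mult_left[OF heat_piece_sums[of d "sq_norm d m"], of "(of_int (m j))\<^sup>2 - (of_int (m k))\<^sup>2"]
    by (simp add: split_kernel_def piece_kernel_def sum_distrib_left)
  show "((\<lambda>m. (\<Sum>i<M. piece_kernel d j k (?t i) m) * ell2_apply x (n - m)) has_sum
      ell2_apply (\<Sum>i<M. conv_op (piece_kernel d j k (?t i)) x) n) UNIV" for M x n
  proof (induction M)
    case (Suc M)
    show ?case
      using has_sum_add[OF Suc ell2_apply_conv_op[OF piece_kernel_l1[OF jk t], of M x n]]
      by (simp only: distrib_right sum.lessThan_Suc ell2_apply_add)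
  qed simp
  show "norm (\<Sum>i<M. conv_op (piece_kernel d j k (?t i)) x) \<le> 2040 * 18 ^ d * norm x" for M x
    by (rule conv_pieces_bound[OF jk])
  show "0 \<le> (2040 * 18 ^ d :: real)" by simp
qed (use that in blast)

section \<open>The absolutely summable part\<close>

text \<open>
  The lattice points of squared norm \<open>1\<close> and \<open>2\<close> at which the kernel does not vanish. The first sphere
  produces the main term \<open>4 c\<^sub>d\<close>, the second one the correction \<open>4 c\<^sub>d (d - 2) / 2 ^ (d/2)\<close>.
\<close>

definition near1 :: "nat \<Rightarrow> nat \<Rightarrow> (nat \<Rightarrow> int) set" where
  "near1 j k = (\<lambda>(i, s). axis_vec i s) ` ({j, k} \<times> {1, -1})"

definition near2 :: "nat \<Rightarrow> nat \<Rightarrow> nat \<Rightarrow> (nat \<Rightarrow> int) set" where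
  "near2 d j k = (\<lambda>(i, l, s, t). axis_vec i s + axis_vec l t) `
     ({j, k} \<times> ({1..d} - {j, k}) \<times> {1, -1} \<times> {1, -1})"

lemma axis_vec_apply: "axis_vec i s l = (if l = i then s else 0)"
  by (simp add: axis_vec_def)

lemma card_near1: "j \<noteq> k \<Longrightarrow> card (near1 j k) = 4"
proof -
  assume "j \<noteq> k"
  have "inj_on (\<lambda>(i, s). axis_vec i s) ({j, k} \<times> {1, -1})"
  proof (rule inj_onI, clarify)
    fix i s i' s' :: _
    assume *: "i \<in> {j, k}" "s \<in> {1, -1}" "i' \<in> {j, k}" "s' \<in> {1, -1}" "axis_vec i s = axis_vec i' s'"
    have s: "s = (if i = i' then s' else 0)"
      using fun_cong[OF *(5), of i] unfolding axis_vec_apply by simp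
    then have "i = i'" using *(2) by (cases "i = i'") auto
    with s show "i = i' \<and> s = s'" by simp
  qed
  then show ?thesis
    unfolding near1_def using \<open>j \<noteq> k\<close> by (subst card_image) (auto simp: card_cartesian_product)
qed

lemma card_near2:
  assumes "j \<in> {1..d}" "k \<in> {1..d}" "j \<noteq> k"
  shows "real (card (near2 d j k)) = 8 * (real d - 2)"
proof -
  let ?S = "{j, k} \<times> ({1..d} - {j, k}) \<times> {1, -1 :: int} \<times> {1, -1 :: int}"
  have "inj_on (\<lambda>(i, l, s, t). axis_vec i s + axis_vec l t) ?S"
  proof (rule inj_onI)
    fix p p' assume p: "p \<in> ?S" "p' \<in> ?S"
      "(\<lambda>(i, l, s, t). axis_vec i s + axis_vec l t) p = (\<lambda>(i, l, s, t). axis_vec i s + axis_vec l t) p'"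
    obtain i l s t where pe: "p = (i, l, s, t)" by (cases p)
    obtain i' l' s' t' where pe': "p' = (i', l', s', t')" by (cases p')
    have *: "i \<in> {j, k}" "l \<in> {1..d}" "l \<notin> {j, k}" "s \<in> {1, -1::int}" "t \<in> {1, -1::int}"
      "i' \<in> {j, k}" "l' \<in> {1..d}" "l' \<notin> {j, k}" "s' \<in> {1, -1::int}" "t' \<in> {1, -1::int}"
      using p(1,2) unfolding pe pe' by (simp_all only: mem_Sigma_iff Diff_iff simp_thms)
    have eq: "axis_vec i s + axis_vec l t = axis_vec i' s' + axis_vec l' t'"
      using p(3) unfolding pe pe' by simp
    have val: "(axis_vec i s + axis_vec l t) n = (if n = i then s else 0) + (if n = l then t else 0)"
      "(axis_vec i' s' + axis_vec l' t') n = (if n = i' then s' else 0) + (if n = l' then t' else 0)" for n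
      by (simp_all add: axis_vec_apply)
    have "i \<noteq> l" "i' \<noteq> l" "i \<noteq> l'" "i' \<noteq> l'" using * by auto
    then have st: "s = (if i = i' then s' else 0)" "t = (if l = l' then t' else 0)"
      using fun_cong[OF eq, of i] fun_cong[OF eq, of l] unfolding val by simp_all
    have "i = i'" using st(1) *(4) by (cases "i = i'") auto
    moreover have "l = l'" using st(2) *(5) by (cases "l = l'") auto
    ultimately show "p = p'" using st by (simp add: pe pe')
  qed
  then have "card (near2 d j k) = card ?S"
    unfolding near2_def by (rule card_image)
  also have "\<dots> = 8 * (d - 2)"
    using assms by (simp add: card_cartesian_product card_Diff_subset)
  also have "real (8 * (d - 2)) = 8 * (real d - 2)"
    using card_mono[of "{1..d}" "{j, k}"] assms by (simp add: of_nat_diff)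
  finally show ?thesis .
qed

lemma int_sum_squares_eq_1:
  fixes m :: "'a \<Rightarrow> int"
  assumes "finite A" "(\<Sum>i\<in>A. (m i)\<^sup>2) = 1"
  obtains l where "l \<in> A" "m l = 1 \<or> m l = -1" "\<And>i. i \<in> A \<Longrightarrow> i \<noteq> l \<Longrightarrow> m i = 0"
proof -
  obtain l where l: "l \<in> A" "m l \<noteq> 0"
  proof -
    have "\<not> (\<forall>l\<in>A. (m l)\<^sup>2 = 0)"
      using assms(2) sum.neutral[of A "\<lambda>l. (m l)\<^sup>2"] by force
    then show ?thesis using that by auto
  qed
  have rest: "(\<Sum>i\<in>A. (m i)\<^sup>2) = (m l)\<^sup>2 + (\<Sum>i\<in>A - {l}. (m i)\<^sup>2)"
    using assms(1) l(1) by (rule sum.remove)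
  have "0 < (m l)\<^sup>2" using l(2) by simp
  moreover have nn: "0 \<le> (\<Sum>i\<in>A - {l}. (m i)\<^sup>2)" by (intro sum_nonneg) simp
  ultimately have 1: "(m l)\<^sup>2 = 1" and 0: "(\<Sum>i\<in>A - {l}. (m i)\<^sup>2) = 0"
    using rest assms(2) by linarith+
  have "m i = 0" if "i \<in> A" "i \<noteq> l" for i
    using 0 assms(1) that by (subst (asm) sum_nonneg_eq_0_iff) auto
  moreover have "m l = 1 \<or> m l = -1" using 1 by (simp add: power2_eq_1_iff)
  ultimately show ?thesis using that l(1) by blast
qed

definition int_sq_norm :: "nat \<Rightarrow> (nat \<Rightarrow> int) \<Rightarrow> int" where
  "int_sq_norm d m = (\<Sum>i=1..d. (m i)\<^sup>2)"

lemma sq_norm_int: "sq_norm d m = of_int (int_sq_norm d m)"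
  by (simp add: sq_norm_of_int int_sq_norm_def)

lemma int_sq_norm_split:
  assumes "j \<in> {1..d}" "k \<in> {1..d}" "j \<noteq> k"
  shows "int_sq_norm d m = (m j)\<^sup>2 + (m k)\<^sup>2 + (\<Sum>i\<in>{1..d} - {j, k}. (m i)\<^sup>2)"
proof -
  have "int_sq_norm d m = (\<Sum>i\<in>{1..d} - {j, k}. (m i)\<^sup>2) + (\<Sum>i\<in>{j, k}. (m i)\<^sup>2)"
    unfolding int_sq_norm_def using assms by (intro sum.subset_diff) auto
  then show ?thesis using assms by simp
qed

lemma int_square_cases:
  fixes a :: int
  shows "a\<^sup>2 = 0 \<and> a = 0 \<or> a\<^sup>2 = 1 \<and> (a = 1 \<or> a = -1) \<or> a\<^sup>2 = 4 \<and> (a = 2 \<or> a = -2) \<or> 9 \<le> a\<^sup>2"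
proof (cases "\<bar>a\<bar> \<le> 2")
  case True
  then have "a \<in> {-2, -1, 0, 1, 2}" by auto
  then show ?thesis by auto
next
  case False
  then have "3\<^sup>2 \<le> \<bar>a\<bar>\<^sup>2" by (intro power_mono) auto
  then show ?thesis by simp
qed

context
  fixes d j k :: nat
  assumes jk: "j \<in> {1..d}" "k \<in> {1..d}" "j \<noteq> k"
begin

lemma near1_props:
  assumes "m \<in> near1 j k"
  shows "m \<in> int_lattice d" "int_sq_norm d m = 1"
    "(m j)\<^sup>2 = 1 \<and> m k = 0 \<or> m j = 0 \<and> (m k = 1 \<or> m k = -1)"
proof -
  obtain i s where m: "m = axis_vec i s" and i: "i \<in> {j, k}" "s \<in> {1, -1}"
    using assms unfolding near1_def by (elim imageE SigmaE) auto
  show "m \<in> int_lattice d" unfolding m by (rule axis_vec_in_lattice) (use i jk in auto)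
  have "(\<Sum>i\<in>{1..d} - {j, k}. (m i)\<^sup>2) = 0"
    by (rule sum.neutral) (use i in \<open>auto simp: m axis_vec_apply\<close>)
  then show "int_sq_norm d m = 1"
    unfolding int_sq_norm_split[OF jk] using i jk by (auto simp: m axis_vec_apply)
  show "(m j)\<^sup>2 = 1 \<and> m k = 0 \<or> m j = 0 \<and> (m k = 1 \<or> m k = -1)"
    using i jk by (auto simp: m axis_vec_apply)
qed

lemma near2_props:
  assumes "m \<in> near2 d j k"
  shows "m \<in> int_lattice d" "int_sq_norm d m = 2"
    "(m j)\<^sup>2 = 1 \<and> m k = 0 \<or> m j = 0 \<and> (m k = 1 \<or> m k = -1)"
proof -
  obtain i l s t where m: "m = axis_vec i s + axis_vec l t"
    and i: "i \<in> {j, k}" "l \<in> {1..d} - {j, k}" "s \<in> {1, -1}" "t \<in> {1, -1}"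
  proof -
    obtain p where p: "m = (\<lambda>(i, l, s, t). axis_vec i s + axis_vec l t) p"
      "p \<in> {j, k} \<times> ({1..d} - {j, k}) \<times> {1, -1} \<times> {1, -1}"
      using assms unfolding near2_def by (rule imageE)
    obtain i l s t where pe: "p = (i, l, s, t)" by (cases p)
    have "i \<in> {j, k}" "l \<in> {1..d} - {j, k}" "s \<in> {1, -1}" "t \<in> {1, -1}"
      using p(2) unfolding pe by (simp_all only: mem_Sigma_iff)
    moreover have "m = axis_vec i s + axis_vec l t" using p(1) unfolding pe by simp
    ultimately show ?thesis by (rule that[rotated])
  qed
  have val: "m n = (if n = i then s else 0) + (if n = l then t else 0)" for n
    by (simp add: m axis_vec_apply)
  show "m \<in> int_lattice d"
    unfolding m by (rule int_lattice_add; rule axis_vec_in_lattice; use i jk in blast)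
  have "(\<Sum>n\<in>{1..d} - {j, k}. (m n)\<^sup>2) = (\<Sum>n\<in>{1..d} - {j, k}. if n = l then t\<^sup>2 else 0)"
    by (rule sum.cong) (use i in \<open>auto simp: val\<close>)
  also have "\<dots> = 1" using i by auto
  finally have rest: "(\<Sum>n\<in>{1..d} - {j, k}. (m n)\<^sup>2) = 1" .
  show *: "(m j)\<^sup>2 = 1 \<and> m k = 0 \<or> m j = 0 \<and> (m k = 1 \<or> m k = -1)"
    using i jk by (auto simp: val)
  then show "int_sq_norm d m = 2"
    unfolding int_sq_norm_split[OF jk] rest by auto
qed

lemma rest_nonneg: "0 \<le> (\<Sum>i\<in>{1..d} - {j, k}. (m i)\<^sup>2)" for m :: "nat \<Rightarrow> int"
  by (intro sum_nonneg) simp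

lemma lattice_eq_axis:
  assumes "m \<in> int_lattice d" "(\<Sum>i\<in>{1..d} - {j, k}. (m i)\<^sup>2) = 0"
  shows "m = axis_vec j (m j) + axis_vec k (m k)"
proof
  fix i
  have "m i = 0" if "i \<in> {1..d} - {j, k}"
    using assms(2) that by (subst (asm) sum_nonneg_eq_0_iff) auto
  moreover have "m i = 0" if "i \<notin> {1..d}"
    using assms(1) that by (auto simp: int_lattice_def)
  ultimately have "m i = (if i = j then m j else 0) + (if i = k then m k else 0)"
    using jk by (cases "i \<in> {j, k}") auto
  then show "m i = (axis_vec j (m j) + axis_vec k (m k)) i"
    by (simp add: axis_vec_apply)
qed

lemma axis_vec_0: "axis_vec i 0 = 0"
  by (rule ext) (simp add: axis_vec_apply)

lemma near1_I:
  assumes m: "m \<in> int_lattice d" "int_sq_norm d m = 1" "(m j)\<^sup>2 \<noteq> (m k)\<^sup>2"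
  shows "m \<in> near1 j k"
proof -
  have *: "(m j)\<^sup>2 + (m k)\<^sup>2 + (\<Sum>i\<in>{1..d} - {j, k}. (m i)\<^sup>2) = 1"
    using m(2) int_sq_norm_split[OF jk] by simp
  have cases: "m j = 0 \<and> m k \<in> {1, -1} \<or> m k = 0 \<and> m j \<in> {1, -1}"
    using int_square_cases[of "m j"] int_square_cases[of "m k"] * m(3) rest_nonneg[of m] by auto
  then have "(\<Sum>i\<in>{1..d} - {j, k}. (m i)\<^sup>2) = 0" using * by auto
  then have "m = axis_vec j (m j) + axis_vec k (m k)"
    by (rule lattice_eq_axis[OF m(1)])
  with cases have "m = axis_vec k (m k) \<and> m k \<in> {1, -1} \<or> m = axis_vec j (m j) \<and> m j \<in> {1, -1}"
    by (metis axis_vec_0 add_0 add_0_right)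
  then show ?thesis
  proof (elim disjE conjE)
    assume "m = axis_vec k (m k)" "m k \<in> {1, -1}"
    then show ?thesis unfolding near1_def by (intro image_eqI[of _ _ "(k, m k)"]) auto
  next
    assume "m = axis_vec j (m j)" "m j \<in> {1, -1}"
    then show ?thesis unfolding near1_def by (intro image_eqI[of _ _ "(j, m j)"]) auto
  qed
qed

lemma near2_I:
  assumes m: "m \<in> int_lattice d" "int_sq_norm d m = 2" "(m j)\<^sup>2 \<noteq> (m k)\<^sup>2"
  shows "m \<in> near2 d j k"
proof -
  have *: "(m j)\<^sup>2 + (m k)\<^sup>2 + (\<Sum>i\<in>{1..d} - {j, k}. (m i)\<^sup>2) = 2"
    using m(2) int_sq_norm_split[OF jk] by simp
  have cases: "m j = 0 \<and> m k \<in> {1, -1} \<or> m k = 0 \<and> m j \<in> {1, -1}"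
    using int_square_cases[of "m j"] int_square_cases[of "m k"] * m(3) rest_nonneg[of m] by auto
  then have "(\<Sum>i\<in>{1..d} - {j, k}. (m i)\<^sup>2) = 1" using * by auto
  then obtain l where l: "l \<in> {1..d} - {j, k}" "m l \<in> {1, -1}"
    and rest: "\<And>i. i \<in> {1..d} - {j, k} \<Longrightarrow> i \<noteq> l \<Longrightarrow> m i = 0"
    using int_sum_squares_eq_1[of "{1..d} - {j, k}" m] by auto
  obtain i where i: "i \<in> {j, k}" "m i \<in> {1, -1}" and other: "\<And>n. n \<in> {j, k} \<Longrightarrow> n \<noteq> i \<Longrightarrow> m n = 0"
    using cases by auto
  have "m = axis_vec i (m i) + axis_vec l (m l)"
  proof
    fix n
    have "m n = (if n = i then m i else 0) + (if n = l then m l else 0)"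
      using rest[of n] other[of n] l(1) i(1) m(1) by (auto simp: int_lattice_def)
    then show "m n = (axis_vec i (m i) + axis_vec l (m l)) n"
      by (simp add: axis_vec_apply)
  qed
  then show ?thesis
    unfolding near2_def using i l by (intro image_eqI[of _ _ "(i, l, m i, m l)"]) auto
qed

lemma has_sum_finite_indicator:
  assumes "finite F" "F \<subseteq> G"
  shows "((\<lambda>m. if m \<in> F then c else 0 :: real) has_sum (real (card F) * c)) G"
proof -
  have "((\<lambda>m. c) has_sum (real (card F) * c)) F"
    using has_sum_finite[OF assms(1), of "\<lambda>_. c"] by simp
  also have "?this \<longleftrightarrow> ?thesis"
    by (rule has_sum_cong_neutral) (use assms in auto)
  finally show ?thesis .
qed

lemma finite_near: "finite (near1 j k)" "finite (near2 d j k)"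
  by (auto simp: near1_def near2_def)

text \<open>
  Majorant of the kernel beyond the sphere of squared norm \<open>N\<close>, from \<open>heat_tail_decay\<close>.
\<close>

definition gauss_bound :: "real \<Rightarrow> (nat \<Rightarrow> int) \<Rightarrow> real" where
  "gauss_bound N m = exp (pi * N) * heat_tail d N *
     (((of_int (m j))\<^sup>2 + (of_int (m k))\<^sup>2) * exp (- pi * sq_norm d m))"

lemma gauss_bound_nonneg: "0 < N \<Longrightarrow> 0 \<le> gauss_bound N m"
  by (simp add: gauss_bound_def heat_tail_nonneg)

lemma abs_tail_kernel_le_gauss_bound:
  assumes "0 < N" "N \<le> sq_norm d m"
  shows "\<bar>tail_kernel d j k m\<bar> \<le> gauss_bound N m"
proof (cases "m \<in> int_lattice d")
  case True
  have "\<bar>tail_kernel d j k m\<bar> = \<bar>(real_of_int (m j))\<^sup>2 - (of_int (m k))\<^sup>2\<bar> * heat_tail d (sq_norm d m)"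
    using True assms heat_tail_nonneg[of "sq_norm d m" d] by (simp add: split_kernel_def abs_mult)
  also have "\<dots> \<le> ((of_int (m j))\<^sup>2 + (of_int (m k))\<^sup>2) * (exp (pi * N) * heat_tail d N * exp (- pi * sq_norm d m))"
    using assms heat_tail_nonneg[of "sq_norm d m" d]
    by (intro mult_mono abs_diff_squares_le heat_tail_decay) auto
  finally show ?thesis by (simp add: gauss_bound_def mult_ac)
qed (use gauss_bound_nonneg[OF assms(1)] in \<open>simp add: split_kernel_def\<close>)

lemma gauss_bound_sum:
  assumes "0 < N"
  shows "gauss_bound N summable_on int_lattice d"
    "infsum (gauss_bound N) (int_lattice d) \<le> 81 * exp (pi * N) * 1.11 ^ d * (riesz_const d / sqrt N ^ (d + 2))"
proof -
  note W = lattice_weighted_gauss_sum[OF jk]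
  show "gauss_bound N summable_on int_lattice d"
    unfolding gauss_bound_def by (intro summable_on_cmult_right W)
  have "infsum (gauss_bound N) (int_lattice d) \<le> (exp (pi * N) * heat_tail d N) * (81 * 1.11 ^ d)"
    unfolding gauss_bound_def using W heat_tail_nonneg[OF assms, of d]
    by (subst infsum_cmult_right) (auto intro!: mult_left_mono)
  also have "\<dots> = (81 * exp (pi * N) * 1.11 ^ d) * heat_tail d N" by (simp add: mult_ac)
  also have "\<dots> \<le> (81 * exp (pi * N) * 1.11 ^ d) * (riesz_const d / sqrt N ^ (d + 2))"
    by (intro mult_left_mono heat_tail_le assms) auto
  finally show "infsum (gauss_bound N) (int_lattice d) \<le> 81 * exp (pi * N) * 1.11 ^ d * (riesz_const d / sqrt N ^ (d + 2))" .
qed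

lemma int_sq_norm_0_imp:
  assumes "m \<in> int_lattice d" "int_sq_norm d m \<le> 0" shows "m = 0"
  using sq_norm_ge_1[OF assms(1)] assms(2) by (auto simp: sq_norm_int)

text \<open>
  The first two spheres are counted exactly and everything else is estimated by \<open>gauss_bound 3\<close>, whose
  sum is, up to a constant, smaller than the weight \<open>c\<^sub>d / sqrt 2 ^ d\<close> by the factor \<open>(1.11 sqrt (2/3)) ^ d\<close>.
\<close>

lemma tail_kernel_l1:
  shows "in_l1 (tail_kernel d j k)"
    and "l1_norm (tail_kernel d j k) \<le> 4 * riesz_const d + 8 * (real d - 2) * (riesz_const d / sqrt 2 ^ (d + 2))
      + 81 * exp (pi * 3) * 1.11 ^ d * (riesz_const d / sqrt 3 ^ (d + 2))" (is "_ \<le> ?B")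
proof -
  let ?b = "\<lambda>m. (if m \<in> near1 j k then heat_tail d 1 else 0) + (if m \<in> near2 d j k then heat_tail d 2 else 0)
    + gauss_bound 3 m"
  note G = gauss_bound_sum[of 3]
  have hs: "(?b has_sum (real (card (near1 j k)) * heat_tail d 1 + real (card (near2 d j k)) * heat_tail d 2
      + infsum (gauss_bound 3) (int_lattice d))) (int_lattice d)"
    by (intro has_sum_add has_sum_finite_indicator finite_near has_sum_infsum G)
       (auto intro: near1_props near2_props)
  have "real (card (near1 j k)) * heat_tail d 1 + real (card (near2 d j k)) * heat_tail d 2
      + infsum (gauss_bound 3) (int_lattice d)
    \<le> 4 * (riesz_const d / sqrt 1 ^ (d + 2)) + 8 * (real d - 2) * (riesz_const d / sqrt 2 ^ (d + 2))
      + 81 * exp (pi * 3) * 1.11 ^ d * (riesz_const d / sqrt 3 ^ (d + 2))"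
    unfolding card_near1[OF jk(3)] card_near2[OF jk] using card_near2[OF jk]
    by (intro add_mono mult_mono heat_tail_le G heat_tail_nonneg) auto
  then have le: "infsum ?b (int_lattice d) \<le> ?B"
    unfolding infsumI[OF hs] by simp
  have H: "0 \<le> heat_tail d 1" "0 \<le> heat_tail d 2" by (auto intro: heat_tail_nonneg)
  have dom: "\<bar>tail_kernel d j k m\<bar> \<le> ?b m" if m: "m \<in> int_lattice d" for m
  proof -
    note g = gauss_bound_nonneg[of 3 m]
    have b0: "0 \<le> ?b m" using H g by auto
    show ?thesis
    proof (cases "(m j)\<^sup>2 = (m k)\<^sup>2")
      case True
      then have "tail_kernel d j k m = 0" by (simp add: split_kernel_def flip: of_int_power)
      then show ?thesis using b0 by simp
    next
      case False
      then have "m \<noteq> 0" by auto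
      then consider "int_sq_norm d m = 1" | "int_sq_norm d m = 2" | "3 \<le> int_sq_norm d m"
        using int_sq_norm_0_imp[OF m] by linarith
      then show ?thesis
      proof cases
        case 1
        then have n: "m \<in> near1 j k" using near1_I[OF m] False by simp
        have "\<bar>tail_kernel d j k m\<bar> = heat_tail d 1"
          using near1_props(3)[OF n] m H 1 by (auto simp: split_kernel_def sq_norm_int simp flip: of_int_power)
        then show ?thesis using n g H by auto
      next
        case 2
        then have n: "m \<in> near2 d j k" using near2_I[OF m] False by simp
        have "\<bar>tail_kernel d j k m\<bar> = heat_tail d 2"
          using near2_props(3)[OF n] m H 2 by (auto simp: split_kernel_def sq_norm_int simp flip: of_int_power)
        then show ?thesis using n g H by auto
      next
        case 3
        then have "\<bar>tail_kernel d j k m\<bar> \<le> gauss_bound 3 m"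
          by (intro abs_tail_kernel_le_gauss_bound) (auto simp: sq_norm_int)
        then show ?thesis using H by auto
      qed
    qed
  qed
  have off: "m \<notin> int_lattice d \<Longrightarrow> tail_kernel d j k m = 0" for m
    by (simp add: split_kernel_def)
  show "in_l1 (tail_kernel d j k)"
    and "l1_norm (tail_kernel d j k) \<le> ?B"
    using l1_boundI[OF has_sum_imp_summable[OF hs] le dom off] by blast+
qed

text \<open>
  The character at the frequency that vanishes except for the coordinate \<open>1/2\<close> in direction \<open>k\<close>. There all
  terms of the first two spheres have the same sign.
\<close>

definition parity_char :: "(nat \<Rightarrow> int) \<Rightarrow> real" where
  "parity_char m = (if even (m k) then 1 else -1)"

lemma parity_char_mult: "parity_char (n - m) = parity_char n * parity_char m"
  by (auto simp: parity_char_def)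

lemma parity_char_sq: "parity_char m * parity_char m = 1" "\<bar>parity_char m\<bar> = 1"
  by (auto simp: parity_char_def)

definition pos_kernel :: "(nat \<Rightarrow> int) \<Rightarrow> real" where
  "pos_kernel m = max 0 (tail_kernel d j k m * parity_char m)"

definition neg_kernel :: "(nat \<Rightarrow> int) \<Rightarrow> real" where
  "neg_kernel m = max 0 (- (tail_kernel d j k m * parity_char m))"

lemma pos_kernel_l1: "in_l1 pos_kernel"
  unfolding in_l1_def
  by (rule summable_on_comparison_test[OF tail_kernel_l1(1)[unfolded in_l1_def]])
     (auto simp: pos_kernel_def abs_mult parity_char_def)

text \<open>
  A point with \<open>|m|\<^sup>2 \<le> 4\<close> contributes negatively only if \<open>m\<^sub>k\<close> is even and \<open>\<bar>m\<^sub>k\<bar> > \<bar>m\<^sub>j\<bar>\<close>, or \<open>m\<^sub>k\<close> is odd and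
  \<open>\<bar>m\<^sub>j\<bar> > \<bar>m\<^sub>k\<bar>\<close>. The latter needs \<open>|m|\<^sup>2 \<ge> 5\<close>, and the former leaves \<open>m = \<plusminus> 2 e\<^sub>k\<close>. The threshold \<open>5\<close> matters,
  as \<open>1.11 / sqrt 5 < 1/2\<close> makes the remainder \<open>O (c\<^sub>d / 2 ^ d)\<close>.
\<close>

lemma neg_kernel_l1:
  shows "in_l1 neg_kernel"
    and "l1_norm neg_kernel \<le> 8 * (riesz_const d / 2 ^ (d + 2))
      + 81 * exp (pi * 5) * 1.11 ^ d * (riesz_const d / sqrt 5 ^ (d + 2))" (is "_ \<le> ?B")
proof -
  let ?F = "{axis_vec k 2, axis_vec k (-2)}"
  let ?b = "\<lambda>m. (if m \<in> ?F then 4 * heat_tail d 4 else 0) + gauss_bound 5 m"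
  note G = gauss_bound_sum[of 5]
  have hs: "(?b has_sum (real (card ?F) * (4 * heat_tail d 4) + infsum (gauss_bound 5) (int_lattice d))) (int_lattice d)"
    by (intro has_sum_add has_sum_finite_indicator has_sum_infsum G) (use axis_vec_in_lattice[OF jk(2)] in auto)
  have H: "0 \<le> heat_tail d 4" by (auto intro: heat_tail_nonneg)
  have "real (card ?F) * (4 * heat_tail d 4) \<le> 2 * (4 * (riesz_const d / sqrt 4 ^ (d + 2)))"
    by (intro mult_mono heat_tail_le) (use H in \<open>auto simp: card_insert_if\<close>)
  then have le: "infsum ?b (int_lattice d) \<le> ?B"
    unfolding infsumI[OF hs] using G(2) by simp
  have dom: "\<bar>neg_kernel m\<bar> \<le> ?b m" if m: "m \<in> int_lattice d" for m
  proof (cases "5 \<le> int_sq_norm d m")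
    case True
    then have "\<bar>tail_kernel d j k m\<bar> \<le> gauss_bound 5 m"
      by (intro abs_tail_kernel_le_gauss_bound) (auto simp: sq_norm_int)
    then show ?thesis using H by (auto simp: neg_kernel_def parity_char_def)
  next
    case False
    have b0: "0 \<le> ?b m" using H gauss_bound_nonneg[of 5 m] by auto
    show ?thesis
    proof (cases "m = 0")
      case True
      then show ?thesis using b0 by (simp add: neg_kernel_def split_kernel_def)
    next
      case nz: False
      let ?w = "((of_int (m j))\<^sup>2 - (of_int (m k))\<^sup>2) * parity_char m"
      have Hm: "0 \<le> heat_tail d (sq_norm d m)"
        using sq_norm_ge_1[OF m nz] by (intro heat_tail_nonneg) simp
      have eq: "tail_kernel d j k m * parity_char m = ?w * heat_tail d (sq_norm d m)"
        using m by (simp add: split_kernel_def)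
      have le4: "(m j)\<^sup>2 + (m k)\<^sup>2 + (\<Sum>i\<in>{1..d} - {j, k}. (m i)\<^sup>2) \<le> 4"
        using False int_sq_norm_split[OF jk] by simp
      note nn = rest_nonneg[of m]
      show ?thesis
      proof (cases "(m k)\<^sup>2 = 4")
        case True
        then have "(m j)\<^sup>2 = 0" "(\<Sum>i\<in>{1..d} - {j, k}. (m i)\<^sup>2) = 0"
          using le4 nn zero_le_power2[of "m j"] by linarith+
        then have m0: "m j = 0" "m = axis_vec j (m j) + axis_vec k (m k)" "int_sq_norm d m = 4"
          using lattice_eq_axis[OF m] int_sq_norm_split[OF jk, of m] True by auto
        have mk: "m k = 2 \<or> m k = -2" using True int_square_cases[of "m k"] by auto
        have "m = axis_vec k (m k)" using m0(1,2) by (simp only: axis_vec_0 add_0)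
        then have F: "m \<in> ?F" using mk by (metis insertI1 insertI2)
        have "?w = - 4" using m0(1) mk by (auto simp: parity_char_def)
        then have "\<bar>neg_kernel m\<bar> = 4 * heat_tail d 4"
          unfolding neg_kernel_def eq using H m0(3) by (simp add: sq_norm_int)
        then show ?thesis using F gauss_bound_nonneg[of 5 m] by simp
      next
        case False
        have "0 \<le> ((m j)\<^sup>2 - (m k)\<^sup>2) * (if even (m k) then 1 else -1)"
          using int_square_cases[of "m j"] int_square_cases[of "m k"] le4 nn False by auto
        then have "0 \<le> real_of_int (((m j)\<^sup>2 - (m k)\<^sup>2) * (if even (m k) then 1 else -1))"
          by (rule of_int_0_le_iff[THEN iffD2])
        then have "0 \<le> ?w" by (simp add: parity_char_def split: if_splits)
        then have "neg_kernel m = 0"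
          unfolding neg_kernel_def eq using mult_nonneg_nonneg[OF _ Hm] by simp
        then show ?thesis using b0 by simp
      qed
    qed
  qed
  have off: "m \<notin> int_lattice d \<Longrightarrow> neg_kernel m = 0" for m
    by (simp add: neg_kernel_def split_kernel_def)
  show "in_l1 neg_kernel" and "l1_norm neg_kernel \<le> ?B"
    using l1_boundI[OF has_sum_imp_summable[OF hs] le dom off] by blast+
qed

lemma pos_kernel_near:
  shows "m \<in> near1 j k \<Longrightarrow> pos_kernel m = heat_tail d 1"
    and "m \<in> near2 d j k \<Longrightarrow> pos_kernel m = heat_tail d 2"
proof -
  have H: "0 \<le> heat_tail d 1" "0 \<le> heat_tail d 2" by (auto intro: heat_tail_nonneg)
  have main: "pos_kernel m = heat_tail d N" if "m \<in> int_lattice d" "sq_norm d m = N" "0 \<le> heat_tail d N"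
    "(m j)\<^sup>2 = 1 \<and> m k = 0 \<or> m j = 0 \<and> (m k = 1 \<or> m k = -1)" for N
    using that by (auto simp: pos_kernel_def split_kernel_def parity_char_def simp flip: of_int_power)
  show "pos_kernel m = heat_tail d 1" if "m \<in> near1 j k"
    using near1_props[OF that] H by (intro main) (auto simp: sq_norm_int)
  show "pos_kernel m = heat_tail d 2" if "m \<in> near2 d j k"
    using near2_props[OF that] H by (intro main) (auto simp: sq_norm_int)
qed

definition l1_length :: "(nat \<Rightarrow> int) \<Rightarrow> nat" where
  "l1_length m = (\<Sum>i=1..d. nat \<bar>m i\<bar>)"

lemma l1_length_diff: "l1_length (n - m) \<le> l1_length n + l1_length m"
  unfolding l1_length_def sum.distrib[symmetric] by (intro sum_mono) auto

lemma l1_length_le_sq_norm: "int (l1_length m) \<le> int_sq_norm d m"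
proof -
  have "\<bar>m i\<bar> \<le> (m i)\<^sup>2" for i
  proof (cases "m i = 0")
    case False
    then have "\<bar>m i\<bar> * 1 \<le> \<bar>m i\<bar> * \<bar>m i\<bar>" by (intro mult_left_mono) auto
    then show ?thesis by (simp add: power2_eq_square)
  qed simp
  then show ?thesis
    unfolding l1_length_def int_sq_norm_def by (simp add: sum_mono)
qed

text \<open>
  Exponential weights are nearly invariant under short translations as \<open>q\<close> tends to \<open>1\<close>, so that times a
  character they are approximate eigenfunctions of convolutions.
\<close>

definition decay :: "real \<Rightarrow> (nat \<Rightarrow> int) \<Rightarrow> real" where
  "decay q n = (if n \<in> int_lattice d then q ^ l1_length n else 0)"

lemma decay_square_summable:
  assumes "0 < q" "q < 1"
  shows "(\<lambda>n. (decay q n)\<^sup>2) summable_on UNIV"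
proof -
  have q2: "q\<^sup>2 < 1" using assms by (simp add: power_less_one_iff abs_square_less_1)
  have "(\<lambda>n. \<Prod>i=1..d. (q\<^sup>2) ^ nat \<bar>n i\<bar>) summable_on int_lattice d"
    using has_sum_imp_summable[OF has_sum_int_geometric[of "q\<^sup>2"]] q2
    by (intro has_sum_imp_summable[OF lattice_product_sum]) auto
  also have "(\<lambda>n. \<Prod>i=1..d. (q\<^sup>2) ^ nat \<bar>n i\<bar>) = (\<lambda>n. (q ^ l1_length n)\<^sup>2)"
  proof
    fix n
    have "(\<Prod>i=1..d. (q\<^sup>2) ^ nat \<bar>n i\<bar>) = (q\<^sup>2) ^ l1_length n"
      by (simp only: power_sum l1_length_def)
    also have "\<dots> = (q ^ l1_length n)\<^sup>2"
      by (simp only: power_mult[symmetric] mult.commute)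
    finally show "(\<Prod>i=1..d. (q\<^sup>2) ^ nat \<bar>n i\<bar>) = (q ^ l1_length n)\<^sup>2" .
  qed
  finally have "(\<lambda>n. (q ^ l1_length n)\<^sup>2) summable_on int_lattice d" .
  also have "?this \<longleftrightarrow> ?thesis"
    by (rule summable_on_cong_neutral) (auto simp: decay_def)
  finally show ?thesis .
qed

text \<open>
  Multiplication with the character turns the kernel into the difference of its nonnegative parts
  \<open>pos_kernel\<close> and \<open>neg_kernel\<close>. On the positive weight, \<open>pos_kernel\<close> is bounded below pointwise by its terms
  on the first two spheres alone, where a translation costs at most \<open>q\<^sup>2\<close>; \<open>neg_kernel\<close> is bounded by its
  \<open>\<ell>\<^sup>1\<close> norm.
\<close>

lemma tail_conv_lower_bound:
  assumes q: "0 < q" "q < 1"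
  obtains x where "0 < norm x" "\<And>n. n \<notin> int_lattice d \<Longrightarrow> ell2_apply x n = 0"
    "(q\<^sup>2 * (4 * heat_tail d 1 + 8 * (real d - 2) * heat_tail d 2) - l1_norm neg_kernel) * norm x
      \<le> norm (conv_op (tail_kernel d j k) x)"
proof -
  let ?s = "4 * heat_tail d 1 + 8 * (real d - 2) * heat_tail d 2"
  define y where "y = Abs_ell2 (decay q)"
  have y: "ell2_apply y = decay q"
    unfolding y_def by (rule ell2_apply_Abs[OF decay_square_summable[OF q]])
  define x where "x = Abs_ell2 (\<lambda>n. parity_char n * decay q n)"
  have "(\<lambda>n. (parity_char n * decay q n)\<^sup>2) summable_on UNIV"
    using decay_square_summable[OF q] by (simp add: power_mult_distrib power2_eq_square[of "parity_char _"] parity_char_sq)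
  then have x: "ell2_apply x = (\<lambda>n. parity_char n * decay q n)"
    unfolding x_def by (rule ell2_apply_Abs)
  have nxy: "norm x = norm y"
    by (intro antisym norm_ell2_mono) (auto simp: x y abs_mult parity_char_sq)
  have "ell2_apply y 0 = 1" by (simp add: y decay_def int_lattice_0 l1_length_def)
  then have "y \<noteq> 0" by auto
  then have pos: "0 < norm x" by (simp add: nxy)
  have off: "ell2_apply x n = 0" if "n \<notin> int_lattice d" for n
    using that by (simp add: x decay_def)
  have q01: "0 \<le> decay q n" for n using q by (simp add: decay_def)
  have dec: "q\<^sup>2 * decay q n \<le> decay q (n - m)" if m: "m \<in> int_lattice d" "int_sq_norm d m \<le> 2" for n m
  proof (cases "n \<in> int_lattice d")
    case True
    have "l1_length m \<le> 2" using l1_length_le_sq_norm[of m] m(2) by linarith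
    then have "l1_length (n - m) \<le> l1_length n + 2" using l1_length_diff[of n m] by linarith
    then have "q ^ (l1_length n + 2) \<le> q ^ l1_length (n - m)"
      using q by (intro power_decreasing) auto
    then show ?thesis
      using True int_lattice_diff[OF True m(1)] by (simp only: decay_def if_True power_add mult.commute)
  qed (use q01 in \<open>simp add: decay_def\<close>)
  have low: "(q\<^sup>2 * ?s) * decay q n \<le> ell2_apply (conv_op pos_kernel y) n" for n
  proof -
    have disj: "near1 j k \<inter> near2 d j k = {}"
      using near1_props(2) near2_props(2) by fastforce
    have "(q\<^sup>2 * ?s) * decay q n = (\<Sum>m\<in>near1 j k. heat_tail d 1 * (q\<^sup>2 * decay q n))
        + (\<Sum>m\<in>near2 d j k. heat_tail d 2 * (q\<^sup>2 * decay q n))"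
      by (simp add: card_near1[OF jk(3)] card_near2[OF jk] algebra_simps)
    also have "\<dots> \<le> (\<Sum>m\<in>near1 j k. pos_kernel m * decay q (n - m)) + (\<Sum>m\<in>near2 d j k. pos_kernel m * decay q (n - m))"
      by (intro add_mono sum_mono)
         (auto simp: pos_kernel_near heat_tail_nonneg near1_props near2_props intro!: mult_left_mono dec)
    also have "\<dots> = (\<Sum>m\<in>near1 j k \<union> near2 d j k. pos_kernel m * ell2_apply y (n - m))"
      by (simp add: sum.union_disjoint[OF finite_near disj] y)
    also have "\<dots> \<le> ell2_apply (conv_op pos_kernel y) n"
      by (rule finite_sum_le_has_sum[OF ell2_apply_conv_op[OF pos_kernel_l1]])
         (use finite_near q01 in \<open>auto simp: y pos_kernel_def\<close>)
    finally show ?thesis .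
  qed
  have s: "0 \<le> q\<^sup>2 * ?s"
    using card_near2[OF jk] by (intro mult_nonneg_nonneg add_nonneg_nonneg heat_tail_nonneg) auto
  have P: "(q\<^sup>2 * ?s) * norm y \<le> norm (conv_op pos_kernel y)"
  proof -
    have "norm ((q\<^sup>2 * ?s) *\<^sub>R y) \<le> norm (conv_op pos_kernel y)"
    proof (rule norm_ell2_mono)
      fix n
      have "0 \<le> (q\<^sup>2 * ?s) * decay q n" using s q01 by simp
      with low[of n] show "\<bar>ell2_apply ((q\<^sup>2 * ?s) *\<^sub>R y) n\<bar> \<le> \<bar>ell2_apply (conv_op pos_kernel y) n\<bar>"
        unfolding ell2_apply_scaleR y by linarith
    qed
    then show ?thesis using s by simp
  qed
  have val: "ell2_apply (conv_op (tail_kernel d j k) x) n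
      = parity_char n * ell2_apply (conv_op pos_kernel y - conv_op neg_kernel y) n" for n
  proof -
    have "((\<lambda>m. pos_kernel m * ell2_apply y (n - m) + - (neg_kernel m * ell2_apply y (n - m))) has_sum
        (ell2_apply (conv_op pos_kernel y) n + - ell2_apply (conv_op neg_kernel y) n)) UNIV"
      by (intro has_sum_add has_sum_uminusI ell2_apply_conv_op pos_kernel_l1 neg_kernel_l1)
    then have "((\<lambda>m. parity_char n * (pos_kernel m * ell2_apply y (n - m) + - (neg_kernel m * ell2_apply y (n - m)))) has_sum
        (parity_char n * (ell2_apply (conv_op pos_kernel y) n + - ell2_apply (conv_op neg_kernel y) n))) UNIV"
      by (rule has_sum_cmult_right)
    also have "(\<lambda>m. parity_char n * (pos_kernel m * ell2_apply y (n - m) + - (neg_kernel m * ell2_apply y (n - m))))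
        = (\<lambda>m. tail_kernel d j k m * ell2_apply x (n - m))"
    proof
      fix m
      have "pos_kernel m - neg_kernel m = tail_kernel d j k m * parity_char m"
        by (simp add: pos_kernel_def neg_kernel_def)
      then have "pos_kernel m * ell2_apply y (n - m) + - (neg_kernel m * ell2_apply y (n - m))
          = tail_kernel d j k m * parity_char m * ell2_apply y (n - m)"
        by (metis add_uminus_conv_diff left_diff_distrib)
      then show "parity_char n * (pos_kernel m * ell2_apply y (n - m) + - (neg_kernel m * ell2_apply y (n - m)))
          = tail_kernel d j k m * ell2_apply x (n - m)"
        by (simp only: x y parity_char_mult mult_ac)
    qed
    finally show ?thesis
      using ell2_apply_conv_op[OF tail_kernel_l1(1), of x n] has_sum_unique by fastforce
  qed
  have "norm (conv_op pos_kernel y - conv_op neg_kernel y) \<le> norm (conv_op (tail_kernel d j k) x)"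
    by (rule norm_ell2_mono) (simp only: val abs_mult parity_char_sq mult_1 order_refl)
  moreover have "norm (conv_op pos_kernel y) - norm (conv_op neg_kernel y) \<le> norm (conv_op pos_kernel y - conv_op neg_kernel y)"
    by (rule norm_triangle_ineq2)
  moreover have "norm (conv_op neg_kernel y) \<le> l1_norm neg_kernel * norm y"
    by (rule norm_conv_op_le[OF neg_kernel_l1(1)])
  ultimately have "(q\<^sup>2 * ?s - l1_norm neg_kernel) * norm x \<le> norm (conv_op (tail_kernel d j k) x)"
    using P unfolding nxy left_diff_distrib by linarith
  with that[of x] pos off show ?thesis by blast
qed

end

section \<open>The operator norm\<close>

lemma lp_norm_2:
  assumes "(\<lambda>n. (norm (f n))\<^sup>2) summable_on A"
  shows "lp_norm 2 A f = ereal (sqrt (\<Sum>\<^sub>\<infinity>n\<in>A. (norm (f n))\<^sup>2))"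
proof -
  have "norm (f n) powr 2 = (norm (f n))\<^sup>2" for n
    by (cases "f n = 0") auto
  then show ?thesis
    using assms by (simp add: lp_norm_def powr_half_sqrt infsum_nonneg)
qed

lemma lp_norm_2_finite:
  assumes "lp_norm 2 A f \<le> 1"
  shows "(\<lambda>n. (norm (f n))\<^sup>2) summable_on A" "(\<Sum>\<^sub>\<infinity>n\<in>A. (norm (f n))\<^sup>2) \<le> 1"
proof -
  have p: "norm (f n) powr 2 = (norm (f n))\<^sup>2" for n
    by (cases "f n = 0") auto
  show s: "(\<lambda>n. (norm (f n))\<^sup>2) summable_on A"
    using assms by (auto simp: lp_norm_def p split: if_splits)
  show "(\<Sum>\<^sub>\<infinity>n\<in>A. (norm (f n))\<^sup>2) \<le> 1"
    using assms unfolding lp_norm_2[OF s] by simp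
qed

lemma ell2_restrict:
  fixes g :: "'g \<Rightarrow> real"
  assumes "(\<lambda>n. (g n)\<^sup>2) summable_on A"
  obtains x where "\<And>n. n \<in> A \<Longrightarrow> ell2_apply x n = g n" "\<And>n. n \<notin> A \<Longrightarrow> ell2_apply x n = 0"
    "(norm x)\<^sup>2 = (\<Sum>\<^sub>\<infinity>n\<in>A. (g n)\<^sup>2)"
proof -
  define x where "x = Abs_ell2 (\<lambda>n. if n \<in> A then g n else 0)"
  have "(\<lambda>n. (if n \<in> A then g n else 0)\<^sup>2) summable_on UNIV \<longleftrightarrow> (\<lambda>n. (g n)\<^sup>2) summable_on A"
    by (rule summable_on_cong_neutral) auto
  then have x: "ell2_apply x = (\<lambda>n. if n \<in> A then g n else 0)"
    unfolding x_def using assms by (intro ell2_apply_Abs) simp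
  have "(norm x)\<^sup>2 = (\<Sum>\<^sub>\<infinity>n\<in>A. (g n)\<^sup>2)"
    unfolding norm_ell2_power2 x by (rule infsum_cong_neutral) auto
  with that[of x] x show ?thesis by simp
qed

abbreviation riesz_conv :: "nat \<Rightarrow> nat \<Rightarrow> (nat \<Rightarrow> int) ell2 \<Rightarrow> (nat \<Rightarrow> int) \<Rightarrow> real" where
  "riesz_conv d i x n \<equiv> (\<Sum>\<^sub>\<infinity>m. riesz_kernel d i m * ell2_apply x (n - m))"

context
  fixes d j k :: nat
  assumes jk: "j \<in> {1..d}" "k \<in> {1..d}" "j \<noteq> k"
begin

lemma riesz_kernel_conv_summable:
  assumes "i \<in> {1..d}"
  shows "(\<lambda>m. riesz_kernel d i m * ell2_apply x (n - m)) summable_on UNIV"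
proof (rule square_summable_mult[OF riesz_kernel_square_summable[OF assms]])
  show "(\<lambda>m. (ell2_apply x (n - m))\<^sup>2) summable_on UNIV"
    using summable_on_reindex_bij_betw[OF bij_const_minus, of "\<lambda>m. (ell2_apply x m)\<^sup>2" n]
      ell2_apply_summable[of x] by (simp only:)
qed

text \<open>
  The kernel is real, so the complex operator reduces to convolutions in the real Hilbert space.
\<close>

lemma R_dis_complex_parts:
  assumes i: "i \<in> {1..d}" and n: "n \<in> int_lattice d"
    and f: "\<And>n. n \<in> int_lattice d \<Longrightarrow> f n = of_real (ell2_apply x n) + \<i> * of_real (ell2_apply y n)"
  shows "R_dis d i i f n = of_real (riesz_const d) *
    (of_real (riesz_conv d i x n) +
     \<i> * of_real (riesz_conv d i y n))"
    (is "_ = _ * ?S")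
proof -
  have real: "((\<lambda>m. complex_of_real (riesz_kernel d i m * ell2_apply z (n - m))) has_sum
      of_real (riesz_conv d i z n)) (int_lattice d - {0})" for z
  proof (rule has_sum_of_real)
    have "((\<lambda>m. riesz_kernel d i m * ell2_apply z (n - m)) has_sum
      riesz_conv d i z n) UNIV"
      by (intro has_sum_infsum riesz_kernel_conv_summable i)
    also have "?this \<longleftrightarrow> ((\<lambda>m. riesz_kernel d i m * ell2_apply z (n - m)) has_sum
      riesz_conv d i z n) (int_lattice d - {0})"
      by (rule has_sum_cong_neutral) (auto simp: riesz_kernel_def)
    finally show "((\<lambda>m. riesz_kernel d i m * ell2_apply z (n - m)) has_sum
      riesz_conv d i z n) (int_lattice d - {0})" .
  qed
  have "((\<lambda>m. of_real (riesz_kernel d i m * ell2_apply x (n - m)) +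
        \<i> * of_real (riesz_kernel d i m * ell2_apply y (n - m))) has_sum ?S) (int_lattice d - {0})"
    by (intro has_sum_add has_sum_cmult_right real)
  also have "?this \<longleftrightarrow> ((\<lambda>m. of_real (real_of_int (m i * m i) / eucl_norm d m ^ (d + 2)) * f (\<lambda>l. n l - m l)) has_sum ?S) (int_lattice d - {0})"
  proof (rule has_sum_cong)
    fix m assume m: "m \<in> int_lattice d - {0}"
    have nm: "(\<lambda>l. n l - m l) = n - m" by (simp add: fun_diff_def)
    have "n - m \<in> int_lattice d" using n m by (intro int_lattice_diff) auto
    from f[OF this] m show "of_real (riesz_kernel d i m * ell2_apply x (n - m)) +
        \<i> * of_real (riesz_kernel d i m * ell2_apply y (n - m))
      = of_real (real_of_int (m i * m i) / eucl_norm d m ^ (d + 2)) * f (\<lambda>l. n l - m l)"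
      unfolding nm by (simp only: riesz_kernel_def if_True of_int_mult power2_eq_square of_real_mult)
        (simp only: distrib_left distrib_right mult_ac)
  qed
  finally have *: "((\<lambda>m. of_real (real_of_int (m i * m i) / eucl_norm d m ^ (d + 2)) * f (\<lambda>l. n l - m l)) has_sum ?S) (int_lattice d - {0})" .
  have "{\<lambda>_. 0} = {0 :: nat \<Rightarrow> int}" by (simp add: zero_fun_def)
  then show ?thesis
    unfolding R_dis_def using infsumI[OF *] by (simp only:)
qed

lemma riesz_diff_op:
  obtains X where "norm (X - conv_op (tail_kernel d j k) x) \<le> 2040 * 18 ^ d * norm x"
    "\<And>n. ell2_apply X n = riesz_const d * (riesz_conv d j x n - riesz_conv d k x n)"
proof -
  obtain z where z: "norm z \<le> 2040 * 18 ^ d * norm x"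
    "\<And>n. ((\<lambda>m. head_kernel d j k m * ell2_apply x (n - m)) has_sum ell2_apply z n) UNIV"
    using head_kernel_op[OF jk] by blast
  let ?X = "z + conv_op (tail_kernel d j k) x"
  have "ell2_apply ?X n = riesz_const d * (riesz_conv d j x n - riesz_conv d k x n)" for n
  proof -
    let ?K = "\<lambda>i m. riesz_kernel d i m * ell2_apply x (n - m)"
    let ?H = "\<lambda>m. head_kernel d j k m * ell2_apply x (n - m) + tail_kernel d j k m * ell2_apply x (n - m)"
    have H: "(?H has_sum ell2_apply ?X n) UNIV"
      unfolding ell2_apply_add by (intro has_sum_add z ell2_apply_conv_op tail_kernel_l1 jk)
    have "((\<lambda>m. riesz_const d * (?K j m + - ?K k m)) has_sum
        (riesz_const d * (riesz_conv d j x n + - riesz_conv d k x n))) UNIV"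
      by (intro has_sum_cmult_right has_sum_add has_sum_uminusI has_sum_infsum riesz_kernel_conv_summable jk)
    also have "(\<lambda>m. riesz_const d * (?K j m + - ?K k m)) = ?H"
    proof
      fix m
      have "riesz_const d * (riesz_kernel d j m * t + - (riesz_kernel d k m * t))
        = (riesz_const d * (riesz_kernel d j m - riesz_kernel d k m)) * t" for t
        by (simp add: algebra_simps)
      then show "riesz_const d * (?K j m + - ?K k m) = ?H m"
        by (simp only: riesz_kernel_diff_split distrib_right)
    qed
    finally show ?thesis
      using has_sum_unique[OF H] by (simp only: add_uminus_conv_diff)
  qed
  moreover have "norm (?X - conv_op (tail_kernel d j k) x) \<le> 2040 * 18 ^ d * norm x"
    using z(1) by simp
  ultimately show ?thesis using that by blast
qed

definition op_bound :: real where
  "op_bound = l1_norm (tail_kernel d j k) + 2040 * 18 ^ d"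

lemma riesz_diff_op_bound:
  assumes "norm (X - conv_op (tail_kernel d j k) x) \<le> 2040 * 18 ^ d * norm x"
  shows "norm X \<le> op_bound * norm x"
  using assms norm_conv_op_le[OF tail_kernel_l1(1)[OF jk], of x]
    norm_triangle_ineq[of "X - conv_op (tail_kernel d j k) x" "conv_op (tail_kernel d j k) x"]
  by (simp add: op_bound_def distrib_right)

lemma opnorm_upper: "lp_opnorm 2 (int_lattice d) (R_dis_diff d j k) \<le> ereal op_bound"
  unfolding lp_opnorm_def
proof (rule SUP_least, clarify)
  fix f :: "(nat \<Rightarrow> int) \<Rightarrow> complex"
  let ?G = "int_lattice d"
  assume "lp_norm 2 ?G f \<le> 1"
  note f = lp_norm_2_finite[OF this]
  have sq: "(norm z)\<^sup>2 = (Re z)\<^sup>2 + (Im z)\<^sup>2" for z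
    by (simp add: cmod_power2)
  have ReIm: "(\<lambda>n. (Re (f n))\<^sup>2) summable_on ?G" "(\<lambda>n. (Im (f n))\<^sup>2) summable_on ?G"
    by (rule summable_on_comparison_test[OF f(1)]; simp add: sq)+
  obtain x where x: "\<And>n. n \<in> ?G \<Longrightarrow> ell2_apply x n = Re (f n)" "(norm x)\<^sup>2 = (\<Sum>\<^sub>\<infinity>n\<in>?G. (Re (f n))\<^sup>2)"
    using ell2_restrict[OF ReIm(1)] by metis
  obtain y where y: "\<And>n. n \<in> ?G \<Longrightarrow> ell2_apply y n = Im (f n)" "(norm y)\<^sup>2 = (\<Sum>\<^sub>\<infinity>n\<in>?G. (Im (f n))\<^sup>2)"
    using ell2_restrict[OF ReIm(2)] by metis
  have fxy: "f n = of_real (ell2_apply x n) + \<i> * of_real (ell2_apply y n)" if "n \<in> ?G" for n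
    using x(1)[OF that] y(1)[OF that] by (simp add: complex_eq_iff)
  have "(norm x)\<^sup>2 + (norm y)\<^sup>2 = (\<Sum>\<^sub>\<infinity>n\<in>?G. (norm (f n))\<^sup>2)"
    unfolding x(2) y(2) sq by (rule infsum_add[symmetric]) (rule ReIm)+
  then have nxy: "(norm x)\<^sup>2 + (norm y)\<^sup>2 \<le> 1" using f(2) by simp
  obtain X where X: "norm (X - conv_op (tail_kernel d j k) x) \<le> 2040 * 18 ^ d * norm x"
    "\<And>n. ell2_apply X n = riesz_const d * (riesz_conv d j x n - riesz_conv d k x n)"
    using riesz_diff_op by blast
  obtain Y where Y: "norm (Y - conv_op (tail_kernel d j k) y) \<le> 2040 * 18 ^ d * norm y"
    "\<And>n. ell2_apply Y n = riesz_const d * (riesz_conv d j y n - riesz_conv d k y n)"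
    using riesz_diff_op by blast
  have parts: "of_real c * (of_real a + \<i> * of_real b) - of_real c * (of_real a' + \<i> * of_real b')
      = of_real (c * (a - a')) + \<i> * of_real (c * (b - b'))" for a a' b b' c :: real
    by (simp add: algebra_simps)
  have val: "R_dis_diff d j k f n = of_real (ell2_apply X n) + \<i> * of_real (ell2_apply Y n)" if "n \<in> ?G" for n
  proof -
    note R = R_dis_complex_parts[OF _ that, where f = f and x = x and y = y]
    have "R_dis_diff d j k f n = of_real (riesz_const d) *
        (of_real (riesz_conv d j x n) +
         \<i> * of_real (riesz_conv d j y n)) -
      of_real (riesz_const d) *
        (of_real (riesz_conv d k x n) +
         \<i> * of_real (riesz_conv d k y n))"
      unfolding R_dis_diff_def by (rule arg_cong2[where f = minus]; rule R; (rule jk | rule fxy))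
    then show ?thesis
      unfolding X(2) Y(2) parts .
  qed
  have nsq: "(norm (R_dis_diff d j k f n))\<^sup>2 = (ell2_apply X n)\<^sup>2 + (ell2_apply Y n)\<^sup>2" if "n \<in> ?G" for n
    unfolding val[OF that] sq by simp
  have XY: "(\<lambda>n. (ell2_apply X n)\<^sup>2 + (ell2_apply Y n)\<^sup>2) summable_on ?G"
    by (intro summable_on_add summable_on_subset[OF ell2_apply_summable]) auto
  then have s: "(\<lambda>n. (norm (R_dis_diff d j k f n))\<^sup>2) summable_on ?G"
    by (rule summable_on_cong[THEN iffD2, rotated]) (rule nsq)
  have B0: "0 \<le> op_bound" by (simp add: op_bound_def l1_norm_nonneg)
  have "(\<Sum>\<^sub>\<infinity>n\<in>?G. (norm (R_dis_diff d j k f n))\<^sup>2) \<le> op_bound\<^sup>2"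
  proof (rule infsum_le_finite_sums[OF s])
    fix F assume F: "finite F" "F \<subseteq> ?G"
    have "(\<Sum>n\<in>F. (norm (R_dis_diff d j k f n))\<^sup>2) = (\<Sum>n\<in>F. (ell2_apply X n)\<^sup>2) + (\<Sum>n\<in>F. (ell2_apply Y n)\<^sup>2)"
      unfolding sum.distrib[symmetric] by (rule sum.cong) (use F nsq in auto)
    also have "\<dots> \<le> (norm X)\<^sup>2 + (norm Y)\<^sup>2"
      by (intro add_mono finite_sum_le_norm_ell2 F)
    also have "\<dots> \<le> (op_bound * norm x)\<^sup>2 + (op_bound * norm y)\<^sup>2"
      by (intro add_mono power_mono riesz_diff_op_bound X Y) auto
    also have "\<dots> = op_bound\<^sup>2 * ((norm x)\<^sup>2 + (norm y)\<^sup>2)"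
      by (simp add: power_mult_distrib distrib_left)
    also have "\<dots> \<le> op_bound\<^sup>2 * 1"
      by (intro mult_left_mono nxy) simp
    finally show "(\<Sum>n\<in>F. (norm (R_dis_diff d j k f n))\<^sup>2) \<le> op_bound\<^sup>2" by simp
  qed
  then have "sqrt (\<Sum>\<^sub>\<infinity>n\<in>?G. (norm (R_dis_diff d j k f n))\<^sup>2) \<le> op_bound"
    using B0 by (intro real_le_lsqrt) auto
  then show "lp_norm 2 ?G (R_dis_diff d j k f) \<le> ereal op_bound"
    unfolding lp_norm_2[OF s] by simp
qed

text \<open>
  The singular part can lower the norm by at most its own bound \<open>2040 \<cdot> 18 ^ d\<close>.
\<close>

lemma opnorm_lower:
  assumes x: "0 < norm x" "\<And>n. n \<notin> int_lattice d \<Longrightarrow> ell2_apply x n = 0"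
    and c: "c * norm x \<le> norm (conv_op (tail_kernel d j k) x)"
  shows "ereal (c - 2040 * 18 ^ d) \<le> lp_opnorm 2 (int_lattice d) (R_dis_diff d j k)"
proof -
  let ?G = "int_lattice d"
  define u where "u = (1 / norm x) *\<^sub>R x"
  have u: "norm u = 1" "\<And>n. n \<notin> ?G \<Longrightarrow> ell2_apply u n = 0"
    using x by (auto simp: u_def)
  interpret T: bounded_linear "conv_op (tail_kernel d j k)"
    by (rule bounded_linear_conv_op[OF tail_kernel_l1(1)[OF jk]])
  have cu: "c \<le> norm (conv_op (tail_kernel d j k) u)"
    using c x(1) unfolding u_def T.scaleR by (simp add: field_simps)
  define f where "f = (\<lambda>n. complex_of_real (ell2_apply u n))"
  have fu: "f n = of_real (ell2_apply u n) + \<i> * of_real (ell2_apply 0 n)" for n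
    by (simp add: f_def)
  have restrict: "(\<lambda>n. (ell2_apply v n)\<^sup>2) summable_on ?G" "(\<Sum>\<^sub>\<infinity>n\<in>?G. (ell2_apply v n)\<^sup>2) = (norm v)\<^sup>2"
    if "\<And>n. n \<notin> ?G \<Longrightarrow> ell2_apply v n = 0" for v
  proof -
    show "(\<lambda>n. (ell2_apply v n)\<^sup>2) summable_on ?G"
      by (rule summable_on_subset[OF ell2_apply_summable]) auto
    show "(\<Sum>\<^sub>\<infinity>n\<in>?G. (ell2_apply v n)\<^sup>2) = (norm v)\<^sup>2"
      unfolding norm_ell2_power2 by (rule infsum_cong_neutral) (use that in auto)
  qed
  have nf: "(norm (f n))\<^sup>2 = (ell2_apply u n)\<^sup>2" for n
    by (simp add: f_def)
  have su: "(\<lambda>n. (norm (f n))\<^sup>2) summable_on ?G"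
    unfolding nf by (rule restrict(1)) (rule u(2))
  have "lp_norm 2 ?G f = ereal (sqrt ((norm u)\<^sup>2))"
  proof -
    have "(\<Sum>\<^sub>\<infinity>n\<in>?G. (ell2_apply u n)\<^sup>2) = (norm u)\<^sup>2" by (rule restrict(2)) (rule u(2))
    then show ?thesis unfolding lp_norm_2[OF su] nf by (simp only:)
  qed
  then have f1: "lp_norm 2 ?G f \<le> 1" using u(1) by (simp add: one_ereal_def)
  obtain X where X: "norm (X - conv_op (tail_kernel d j k) u) \<le> 2040 * 18 ^ d * norm u"
    "\<And>n. ell2_apply X n = riesz_const d * (riesz_conv d j u n - riesz_conv d k u n)"
    using riesz_diff_op by blast
  have val: "R_dis_diff d j k f n = of_real (ell2_apply X n)" if "n \<in> ?G" for n
    unfolding R_dis_diff_def R_dis_complex_parts[OF jk(1) that fu] R_dis_complex_parts[OF jk(2) that fu] X(2)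
    by (simp only: ell2_apply_zero mult_zero_right infsum_0_simp of_real_0 add_0_right of_real_mult of_real_diff right_diff_distrib)
  have off: "ell2_apply X n = 0" if n: "n \<notin> ?G" for n
  proof -
    have "riesz_kernel d i m * ell2_apply u (n - m) = 0" for i m
    proof (cases "m \<in> ?G")
      case True
      then have "n - m \<notin> ?G" using int_lattice_add[of "n - m" d m] n by auto
      then have "ell2_apply u (n - m) = 0" by (rule u(2))
      then show ?thesis by (simp only: mult_zero_right)
    qed (simp add: riesz_kernel_def)
    then show ?thesis unfolding X(2) by (simp only: infsum_0_simp diff_self mult_zero_right)
  qed
  have nR: "(norm (R_dis_diff d j k f n))\<^sup>2 = (ell2_apply X n)\<^sup>2" if "n \<in> ?G" for n
    unfolding val[OF that] by simp
  have s: "(\<lambda>n. (norm (R_dis_diff d j k f n))\<^sup>2) summable_on ?G"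
    by (rule summable_on_cong[THEN iffD2, OF nR restrict(1)]) (assumption, rule off)
  have "lp_norm 2 ?G (R_dis_diff d j k f) = ereal (norm X)"
  proof -
    have "(\<Sum>\<^sub>\<infinity>n\<in>?G. (norm (R_dis_diff d j k f n))\<^sup>2) = (\<Sum>\<^sub>\<infinity>n\<in>?G. (ell2_apply X n)\<^sup>2)"
      by (rule infsum_cong) (rule nR)
    also have "\<dots> = (norm X)\<^sup>2" by (rule restrict(2)) (rule off)
    finally show ?thesis unfolding lp_norm_2[OF s] by simp
  qed
  moreover have "c - 2040 * 18 ^ d \<le> norm X"
    using cu X(1) u(1) norm_triangle_ineq2[of "conv_op (tail_kernel d j k) u" X]
    by (simp add: norm_minus_commute)
  ultimately have "ereal (c - 2040 * 18 ^ d) \<le> lp_norm 2 ?G (R_dis_diff d j k f)" by simp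
  then show ?thesis
    unfolding lp_opnorm_def using f1 by (intro SUP_upper2[of f]) auto
qed

lemma opnorm_real_bounds:
  obtains N where "lp_opnorm 2 (int_lattice d) (R_dis_diff d j k) = ereal N"
    "N \<le> op_bound"
    "4 * heat_tail d 1 + 8 * (real d - 2) * heat_tail d 2 - l1_norm (neg_kernel d j k) - 2040 * 18 ^ d \<le> N"
proof -
  let ?n = "lp_opnorm 2 (int_lattice d) (R_dis_diff d j k)"
  let ?s = "4 * heat_tail d 1 + 8 * (real d - 2) * heat_tail d 2"
  have low: "ereal (q\<^sup>2 * ?s - l1_norm (neg_kernel d j k) - 2040 * 18 ^ d) \<le> ?n" if q: "0 < q" "q < 1" for q
    using tail_conv_lower_bound[OF jk q] opnorm_lower by metis
  have "\<bar>?n\<bar> \<noteq> \<infinity>"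
    using opnorm_upper low[of "1/2"] by (cases ?n) auto
  then obtain N where N: "?n = ereal N" by auto
  have "?s \<le> N + l1_norm (neg_kernel d j k) + 2040 * 18 ^ d"
  proof (rule field_le_mult_one_interval)
    fix z :: real assume z: "0 < z" "z < 1"
    then show "z * ?s \<le> N + l1_norm (neg_kernel d j k) + 2040 * 18 ^ d"
      using low[of "sqrt z"] by (simp add: N)
  qed
  then show ?thesis
    using that[of N] N opnorm_upper by simp
qed

end

text \<open>
  The choice \<open>A = 36\<^sup>2\<close> in \<open>riesz_const_growth\<close>, because \<open>18 \<cdot> 2 = 36\<close>.
\<close>

lemma const_powers_le_riesz_const: "\<exists>K>0. \<forall>d. 2100 * 18 ^ d \<le> K * (riesz_const d / 2 ^ d)"
proof (intro exI conjI allI)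
  let ?E = "pi * exp (- pi * (1296 + 1))"
  let ?K = "2100 / ?E"
  show "0 < ?K" by simp
  fix d
  have "36 ^ d * ?E \<le> riesz_const d"
    using riesz_const_growth[of 1296 d] by simp
  then have "2100 * 36 ^ d \<le> ?K * riesz_const d"
    by (simp add: field_simps)
  also have "(36 :: real) ^ d = 18 ^ d * 2 ^ d"
    by (simp flip: power_mult_distrib)
  finally show "2100 * 18 ^ d \<le> ?K * (riesz_const d / 2 ^ d)"
    by (simp add: field_simps)
qed

text \<open>
  All constants are collected here. In the upper bound the points with \<open>|m|\<^sup>2 \<ge> 3\<close> and the singular part
  are both \<open>O (c\<^sub>d / 2 ^ (d/2))\<close>; in the lower bound all errors are \<open>O (c\<^sub>d / 2 ^ d)\<close>. The margin
  between \<open>2040\<close> and \<open>2100\<close> pays for replacing the weights of the two spheres by their full values.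
\<close>

lemma opnorm_two_sided:
  obtains \<rho> K where "0 < \<rho>" "0 < K"
    "\<And>d j k. \<lbrakk>2 \<le> d; j \<in> {1..d}; k \<in> {1..d}; j \<noteq> k\<rbrakk> \<Longrightarrow>
      \<exists>N. lp_opnorm 2 (int_lattice d) (R_dis_diff d j k) = ereal N \<and>
        4 * riesz_const d * (1 + (real d - 2) / sqrt 2 ^ d - \<rho> / 2 ^ d) \<le> N \<and>
        N \<le> 4 * riesz_const d * (1 + (real d - 2) / sqrt 2 ^ d + K / sqrt 2 ^ d)"
proof -
  obtain K where K: "0 < K" "\<And>d. 2100 * 18 ^ d \<le> K * (riesz_const d / 2 ^ d)"
    using const_powers_le_riesz_const by blast
  let ?E5 = "17 * exp (pi * 5)" and ?E3 = "27 * exp (pi * 3)"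
  let ?\<rho> = "(2 + ?E5 + K) / 4" and ?K = "(?E3 + K) / 4"
  show ?thesis
  proof (rule that[of ?\<rho> ?K])
    show "0 < ?\<rho>" "0 < ?K" using K(1) by (auto intro!: add_pos_pos divide_pos_pos)
    fix d j k :: nat
    assume d: "2 \<le> d" and jk: "j \<in> {1..d}" "k \<in> {1..d}" "j \<noteq> k"
    let ?c = "riesz_const d"
    have c: "0 < ?c" by (rule riesz_const_pos)
    obtain N where N: "lp_opnorm 2 (int_lattice d) (R_dis_diff d j k) = ereal N"
      "N \<le> op_bound d j k"
      "4 * heat_tail d 1 + 8 * (real d - 2) * heat_tail d 2 - l1_norm (neg_kernel d j k) - 2040 * 18 ^ d \<le> N"
      using opnorm_real_bounds[OF jk] by blast
    have pows: "sqrt 2 ^ (d + 2) = 2 * sqrt 2 ^ d" "sqrt 3 ^ (d + 2) = 3 * sqrt 3 ^ d" "sqrt 5 ^ (d + 2) = 5 * sqrt 5 ^ d"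
      by (simp_all only: power_add) simp_all
    have s2: "0 < sqrt 2 ^ d" by simp
    have s22: "sqrt 2 ^ d \<le> 2 ^ d"
      by (intro power_mono) (auto intro: real_le_lsqrt)
    have r3: "1.11 ^ d / sqrt 3 ^ d \<le> 1 / sqrt 2 ^ d"
    proof -
      have "1.11 * sqrt 2 \<le> sqrt 3"
        by (rule real_le_rsqrt) (simp add: power_mult_distrib power2_eq_square)
      then have "(1.11 * sqrt 2) ^ d \<le> sqrt 3 ^ d" by (intro power_mono) auto
      then have "1.11 ^ d * sqrt 2 ^ d \<le> sqrt 3 ^ d" by (simp only: power_mult_distrib)
      then show ?thesis by (simp add: pos_le_divide_eq pos_divide_le_eq mult.commute)
    qed
    have r5: "1.11 ^ d / sqrt 5 ^ d \<le> 1 / 2 ^ d"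
    proof -
      have "1.11 * 2 \<le> sqrt 5"
        by (rule real_le_rsqrt) (simp add: power2_eq_square)
      then have "(1.11 * 2) ^ d \<le> sqrt 5 ^ d" by (intro power_mono) auto
      then have "1.11 ^ d * 2 ^ d \<le> sqrt 5 ^ d" by (simp only: power_mult_distrib)
      then show ?thesis by (simp add: pos_le_divide_eq pos_divide_le_eq mult.commute)
    qed
    have K2: "2040 * 18 ^ d + 60 * 18 ^ d \<le> K * (?c / 2 ^ d)"
      using K(2)[of d] by simp
    have "N \<le> 4 * ?c + 8 * (real d - 2) * (?c / sqrt 2 ^ (d + 2))
      + 81 * exp (pi * 3) * 1.11 ^ d * (?c / sqrt 3 ^ (d + 2)) + 2040 * 18 ^ d"
      using N(2) tail_kernel_l1(2)[OF jk] by (simp add: op_bound_def[OF jk])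
    also have "8 * (real d - 2) * (?c / sqrt 2 ^ (d + 2)) = 4 * (real d - 2) * ?c / sqrt 2 ^ d"
      unfolding pows using s2 by (simp add: field_simps)
    also have "81 * exp (pi * 3) * 1.11 ^ d * (?c / sqrt 3 ^ (d + 2)) = ?E3 * ?c * (1.11 ^ d / sqrt 3 ^ d)"
      unfolding pows by simp
    also have "\<dots> \<le> ?E3 * ?c * (1 / sqrt 2 ^ d)"
      using c by (intro mult_left_mono r3) auto
    also have "2040 * 18 ^ d \<le> K * (?c / sqrt 2 ^ d)"
    proof -
      have "K * (?c / 2 ^ d) \<le> K * (?c / sqrt 2 ^ d)"
        using K(1) c s22 by (intro mult_left_mono divide_left_mono) auto
      moreover have "0 \<le> (60 :: real) * 18 ^ d" by simp
      ultimately show ?thesis using K2 by linarith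
    qed
    also have "4 * ?c + 4 * (real d - 2) * ?c / sqrt 2 ^ d + ?E3 * ?c * (1 / sqrt 2 ^ d) + K * (?c / sqrt 2 ^ d)
      = 4 * ?c * (1 + (real d - 2) / sqrt 2 ^ d + ?K / sqrt 2 ^ d)"
      using s2 by (simp add: field_simps)
    finally have upper: "N \<le> 4 * ?c * (1 + (real d - 2) / sqrt 2 ^ d + ?K / sqrt 2 ^ d)" by simp
    have "4 * (?c / sqrt 1 ^ (d + 2) - pi) + 8 * (real d - 2) * (?c / sqrt 2 ^ (d + 2) - pi)
        \<le> 4 * heat_tail d 1 + 8 * (real d - 2) * heat_tail d 2"
      using d by (intro add_mono mult_left_mono heat_tail_ge) auto
    moreover have "8 * (real d - 2) * (?c / sqrt 2 ^ (d + 2)) = 4 * (real d - 2) * ?c / sqrt 2 ^ d"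
      unfolding pows using s2 by (simp add: field_simps)
    moreover have "l1_norm (neg_kernel d j k) \<le> 2 * (?c / 2 ^ d) + ?E5 * (?c / 2 ^ d)"
    proof -
      have "81 * exp (pi * 5) * 1.11 ^ d * (?c / sqrt 5 ^ (d + 2)) = (81 / 5) * exp (pi * 5) * ?c * (1.11 ^ d / sqrt 5 ^ d)"
        unfolding pows by simp
      also have "\<dots> \<le> ?E5 * ?c * (1 / 2 ^ d)"
        using c by (intro mult_mono r5) auto
      finally show ?thesis
        using neg_kernel_l1(2)[OF jk] by (simp add: power_add)
    qed
    moreover have "4 * pi + 8 * (real d - 2) * pi \<le> 60 * 18 ^ d"
    proof -
      have "real d \<le> 18 ^ d" using of_nat_less_two_power[where 'a = real, of d] power_mono[of 2 "18::real" d] by linarith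
      moreover have "4 * pi + 8 * (real d - 2) * pi \<le> 4 * 4 + 8 * (real d - 2) * 4"
        using d pi_less_4 by (intro add_mono mult_left_mono) auto
      moreover have "0 \<le> real d" by simp
      ultimately show ?thesis by argo
    qed
    ultimately have "4 * ?c + 4 * (real d - 2) * ?c / sqrt 2 ^ d - (2 * (?c / 2 ^ d) + ?E5 * (?c / 2 ^ d)) - K * (?c / 2 ^ d) \<le> N"
      using N(3) K2 by (simp add: right_diff_distrib)
    moreover have "4 * ?c + 4 * (real d - 2) * ?c / sqrt 2 ^ d - (2 * (?c / 2 ^ d) + ?E5 * (?c / 2 ^ d)) - K * (?c / 2 ^ d)
      = 4 * ?c * (1 + (real d - 2) / sqrt 2 ^ d - ?\<rho> / 2 ^ d)"
      using s2 by (simp add: field_simps)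
    ultimately have "4 * ?c * (1 + (real d - 2) / sqrt 2 ^ d - ?\<rho> / 2 ^ d) \<le> N" by simp
    with N(1) upper show "\<exists>N. lp_opnorm 2 (int_lattice d) (R_dis_diff d j k) = ereal N \<and>
        4 * ?c * (1 + (real d - 2) / sqrt 2 ^ d - ?\<rho> / 2 ^ d) \<le> N \<and>
        N \<le> 4 * ?c * (1 + (real d - 2) / sqrt 2 ^ d + ?K / sqrt 2 ^ d)" by blast
  qed
qed

theorem theorem1p4:
  "(\<exists>\<rho>::real. \<exists>\<mu>::real. \<rho> > 0 \<and> \<mu> > 0 \<and>
      (\<forall>d::nat. \<forall>j k::nat. d \<ge> 2 \<and> j \<in> {1..d} \<and> k \<in> {1..d} \<and> j \<noteq> k \<longrightarrow>
         ereal (4 * riesz_const d *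
           (1 + (real d - 2) / 2 powr (real d / 2) - \<rho> / 4 powr (real d / 2)))
           \<le> lp_opnorm 2 (int_lattice d) (R_dis_diff d j k) \<and>
         lp_opnorm 2 (int_lattice d) (R_dis_diff d j k)
           \<le> ereal (4 * riesz_const d * (1 + \<mu> * real d / 2 powr (real d / 2)))))
   \<and>
   (\<exists>\<epsilon>::nat \<Rightarrow> nat \<Rightarrow> nat \<Rightarrow> real.
      (\<forall>\<delta>>0. \<forall>\<^sub>F d in sequentially.
         \<forall>j\<in>{1..d}. \<forall>k\<in>{1..d}. j \<noteq> k \<longrightarrow> \<bar>\<epsilon> d j k\<bar> < \<delta>) \<and>
      (\<forall>d::nat. \<forall>j k::nat. d \<ge> 2 \<and> j \<in> {1..d} \<and> k \<in> {1..d} \<and> j \<noteq> k \<longrightarrow>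
         lp_opnorm 2 (int_lattice d) (R_dis_diff d j k)
           = ereal (4 * riesz_const d *
               (1 + (1 + \<epsilon> d j k) * (real d / 2 powr (real d / 2))))))"
proof -
  obtain \<rho> K where pos: "0 < \<rho>" "0 < K" and bounds: "\<And>d j k. \<lbrakk>2 \<le> d; j \<in> {1..d}; k \<in> {1..d}; j \<noteq> k\<rbrakk> \<Longrightarrow>
      \<exists>N. lp_opnorm 2 (int_lattice d) (R_dis_diff d j k) = ereal N \<and>
        4 * riesz_const d * (1 + (real d - 2) / sqrt 2 ^ d - \<rho> / 2 ^ d) \<le> N \<and>
        N \<le> 4 * riesz_const d * (1 + (real d - 2) / sqrt 2 ^ d + K / sqrt 2 ^ d)"
    using opnorm_two_sided by metis
  have p2: "2 powr (real d / 2) = sqrt 2 ^ d" for d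
    by (rule sqrt_power_eq_powr[symmetric]) simp
  have p4: "4 powr (real d / 2) = 2 ^ d" for d
    using sqrt_power_eq_powr[of 4 d] by simp
  have first: "ereal (4 * riesz_const d * (1 + (real d - 2) / 2 powr (real d / 2) - \<rho> / 4 powr (real d / 2)))
           \<le> lp_opnorm 2 (int_lattice d) (R_dis_diff d j k) \<and>
         lp_opnorm 2 (int_lattice d) (R_dis_diff d j k)
           \<le> ereal (4 * riesz_const d * (1 + (1 + K) * real d / 2 powr (real d / 2)))"
    if h: "2 \<le> d" "j \<in> {1..d}" "k \<in> {1..d}" "j \<noteq> k" for d j k
  proof -
    obtain N where N: "lp_opnorm 2 (int_lattice d) (R_dis_diff d j k) = ereal N"
        "4 * riesz_const d * (1 + (real d - 2) / sqrt 2 ^ d - \<rho> / 2 ^ d) \<le> N"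
        "N \<le> 4 * riesz_const d * (1 + (real d - 2) / sqrt 2 ^ d + K / sqrt 2 ^ d)"
      using bounds[OF h] by blast
    have "K \<le> K * real d" using h(1) pos by simp
    then have "(real d - 2) + K \<le> (1 + K) * real d" by (simp add: distrib_right)
    then have "(real d - 2) / sqrt 2 ^ d + K / sqrt 2 ^ d \<le> (1 + K) * real d / sqrt 2 ^ d"
      unfolding add_divide_distrib[symmetric] by (intro divide_right_mono) auto
    then have "4 * riesz_const d * (1 + (real d - 2) / sqrt 2 ^ d + K / sqrt 2 ^ d)
        \<le> 4 * riesz_const d * (1 + (1 + K) * real d / sqrt 2 ^ d)"
      using riesz_const_pos[of d] by (intro mult_left_mono) auto
    then show ?thesis
      using N unfolding p2 p4 by simp
  qed
  \<comment> \<open>The relative error is solved for; the two-sided bound shows that it is \<open>O (1 / d)\<close>.\<close>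
  define \<epsilon> where "\<epsilon> = (\<lambda>d j k. (real_of_ereal (lp_opnorm 2 (int_lattice d) (R_dis_diff d j k))
      / (4 * riesz_const d) - 1) * (sqrt 2 ^ d / real d) - 1)"
  have eq: "lp_opnorm 2 (int_lattice d) (R_dis_diff d j k)
           = ereal (4 * riesz_const d * (1 + (1 + \<epsilon> d j k) * (real d / 2 powr (real d / 2))))"
    and small: "\<bar>\<epsilon> d j k\<bar> \<le> (2 + \<rho> + K) / real d"
    if h: "2 \<le> d" "j \<in> {1..d}" "k \<in> {1..d}" "j \<noteq> k" for d j k
  proof -
    obtain N where N: "lp_opnorm 2 (int_lattice d) (R_dis_diff d j k) = ereal N"
        "4 * riesz_const d * (1 + (real d - 2) / sqrt 2 ^ d - \<rho> / 2 ^ d) \<le> N"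
        "N \<le> 4 * riesz_const d * (1 + (real d - 2) / sqrt 2 ^ d + K / sqrt 2 ^ d)"
      using bounds[OF h] by blast
    define s where "s = sqrt 2 ^ d"
    have s: "0 < s" by (simp add: s_def)
    have ss: "2 ^ d = s * s" by (simp add: s_def flip: power_mult_distrib)
    have s1: "1 \<le> s" by (simp add: s_def one_le_power)
    have c: "0 < riesz_const d" by (rule riesz_const_pos)
    define t where "t = N / (4 * riesz_const d) - 1"
    have Nt: "N = 4 * riesz_const d * (1 + t)" using c by (simp add: t_def)
    have \<epsilon>: "\<epsilon> d j k = t * (s / real d) - 1"
      by (simp add: \<epsilon>_def N(1) t_def s_def)
    have "(1 + \<epsilon> d j k) * (real d / s) = t"
      using s h(1) by (simp add: \<epsilon>)
    then show "lp_opnorm 2 (int_lattice d) (R_dis_diff d j k)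
           = ereal (4 * riesz_const d * (1 + (1 + \<epsilon> d j k) * (real d / 2 powr (real d / 2))))"
      unfolding p2 s_def[symmetric] N(1) Nt by simp
    have "1 + (real d - 2) / s - \<rho> / (s * s) \<le> 1 + t" "1 + t \<le> 1 + (real d - 2) / s + K / s"
      using N(2,3) c unfolding s_def[symmetric] ss Nt by (simp_all only: mult_le_cancel_left_pos mult_pos_pos zero_less_numeral)
    then have lo: "(real d - 2) / s - \<rho> / (s * s) \<le> t" and up: "t \<le> (real d - 2) / s + K / s"
      by linarith+
    have "((real d - 2) / s - \<rho> / (s * s)) * s \<le> t * s" "t * s \<le> ((real d - 2) / s + K / s) * s"
      using lo up s by (intro mult_right_mono; simp)+
    moreover have "((real d - 2) / s - \<rho> / (s * s)) * s = real d - 2 - \<rho> / s"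
      "((real d - 2) / s + K / s) * s = real d - 2 + K"
      using s by (simp_all add: left_diff_distrib distrib_right diff_divide_distrib)
    ultimately have "real d - 2 - \<rho> / s \<le> t * s" "t * s \<le> real d - 2 + K"
      by simp_all
    moreover have "\<rho> / s \<le> \<rho>" using pos s1 s by (simp add: field_simps)
    ultimately have "\<bar>t * s - real d\<bar> \<le> 2 + \<rho> + K" using pos by linarith
    moreover have "\<epsilon> d j k = (t * s - real d) / real d" using h(1) by (simp add: \<epsilon> field_simps)
    ultimately show "\<bar>\<epsilon> d j k\<bar> \<le> (2 + \<rho> + K) / real d"
      by (simp add: divide_right_mono)
  qed
  have "\<forall>\<^sub>F d in sequentially. \<forall>j\<in>{1..d}. \<forall>k\<in>{1..d}. j \<noteq> k \<longrightarrow> \<bar>\<epsilon> d j k\<bar> < \<delta>" if "0 < \<delta>" for \<delta>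
  proof -
    have "(\<lambda>d. (2 + \<rho> + K) / real d) \<longlonglongrightarrow> 0"
      by (rule lim_const_over_n)
    then have "\<forall>\<^sub>F d in sequentially. (2 + \<rho> + K) / real d < \<delta>"
      using that by (rule order_tendstoD)
    then show ?thesis
      using eventually_ge_at_top[of 2]
    proof eventually_elim
      case (elim d)
      then show ?case using small[of d] by (meson le_less_trans)
    qed
  qed
  then show ?thesis
    using first eq pos by (intro conjI exI[of _ \<rho>] exI[of _ "1 + K"] exI[of _ \<epsilon>]) auto
qed

end
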